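(* Let $\boldsymbol E\in\mathbb R^d$. Let $\boldsymbol A\in L^\infty_\#(\mathcal Y;\mathbb R^{d\times d})$ and suppose there are constants $0<c_A\le C_A<+\infty$ such that for a.e. $\boldsymbol x\in\mathcal Y$ the matrix $\boldsymbol A(\boldsymbol x)$ is symmetric and $c_A\|\boldsymbol v\|_{\mathbb R^d}^2\le(\boldsymbol A(\boldsymbol x)\boldsymbol v,\boldsymbol v)_{\mathbb R^d}\le C_A\|\boldsymbol v\|_{\mathbb R^d}^2$ for all $\boldsymbol v\in\mathbb R^d$. Let $\boldsymbol A^{(0)}\in\mathbb R^{d\times d}$ be symmetric with $c_A^{(0)}\|\boldsymbol v\|_{\mathbb R^d}^2\le(\boldsymbol A^{(0)}\boldsymbol v,\boldsymbol v)_{\mathbb R^d}\le C_A^{(0)}\|\boldsymbol v\|_{\mathbb R^d}^2$ for all $\boldsymbol v\in\mathbb R^d$, where $0<c_A^{(0)}\le C_A^{(0)}<+\infty$. Then there exists a unique weak solution $\tilde{\boldsymbol e}\in\mathscr E$ to the cell problem, i.e. a unique $\tilde{\boldsymbol e}\in\mathscr E$ with $$(\boldsymbol A\tilde{\boldsymbol e},\boldsymbol v)_{L^2_\#(\mathcal Y;\mathbb R^d)}=-(\boldsymbol A\boldsymbol E,\boldsymbol v)_{L^2_\#(\mathcal Y;\mathbb R^d)}\quad\text{for all }\boldsymbol v\in\mathscr E,$$ and there exists a unique solution $\boldsymbol e\in L^2_\#(\mathcal Y;\mathbb R^d)$ to the Lippmann--Schwinger equation $$\boldsymbol e+\boldsymbol\Gamma^{(0)}\bigl[(\boldsymbol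 A-\boldsymbol A^{(0)})\boldsymbol e\bigr]=\boldsymbol E\quad\text{a.e. in }\mathcal Y.$$ Moreover, these solutions are equivalent in the sense that $\boldsymbol e=\boldsymbol E+\tilde{\boldsymbol e}$.
   Context: Let $\mathcal Y=\prod_{\alpha=1}^d[-Y_\alpha,Y_\alpha]\subset\mathbb R^d$ with $Y_\alpha>0$, $|\mathcal Y|=2^d\prod_\alpha Y_\alpha$. $L^p_\#(\mathcal Y;\mathbb X)$ is the space of $\mathcal Y$-periodic (period $2Y_\alpha$ in direction $\alpha$) functions $\mathbb R^d\to\mathbb X$ in $L^p_{\mathrm{loc}}$; for $p=2$ the scalar product is $(\boldsymbol u,\boldsymbol v)_{L^2_\#}=\frac1{|\mathcal Y|}\int_{\mathcal Y}(\boldsymbol u(\boldsymbol x),\boldsymbol v(\boldsymbol x))_{\mathbb X}\,d\boldsymbol x$. For $\boldsymbol k\in\mathbb Z^d$ put $\boldsymbol\xi(\boldsymbol k)=(k_\alpha/Y_\alpha)_\alpha$, $\varphi_{\boldsymbol k}(\boldsymbol x)=\exp(\mathrm i\pi\,\boldsymbol\xi(\boldsymbol k)\cdot\boldsymbol x)$, and $\widehat{\boldsymbol u}(\boldsymbol k)=\frac1{|\mathcal Y|}\int_{\mathcal Y}\boldsymbol u(\boldsymbol x)\varphi_{-\boldsymbol k}(\boldsymbol x)\,d\boldsymbol x$. $\mathscr E=\{\boldsymbol u\in L^2_\#(\mathcal Y;\mathbb R^d):\nabla\times\boldsymbol u=\boldsymbol 0,\ \int_{\mathcal Y}\boldsymbol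 u\,d\boldsymbol x=\boldsymbol 0\}$, where $\nabla\times\boldsymbol u=\boldsymbol 0$ means $\int_{\mathcal Y}(u_\alpha\partial_\beta v-u_\beta\partial_\alpha v)\,d\boldsymbol x=0$ for all $\alpha,\beta$ and all $v$ in the real periodic Sobolev space $H^1_\#(\mathcal Y)$. The operator $\boldsymbol\Gamma^{(0)}$ (formally the convolution $\int_{\mathcal Y}\boldsymbol\Gamma^{(0)}(\boldsymbol x-\boldsymbol y)\boldsymbol u(\boldsymbol y)\,d\boldsymbol y$) is defined on $L^2_\#(\mathcal Y;\mathbb R^d)$ by $\boldsymbol\Gamma^{(0)}[\boldsymbol u](\boldsymbol x)=\sum_{\boldsymbol k\in\mathbb Z^d}\widehat{\boldsymbol\Gamma}{}^{(0)}(\boldsymbol k)\widehat{\boldsymbol u}(\boldsymbol k)\varphi_{\boldsymbol k}(\boldsymbol x)$, where $\widehat{\boldsymbol\Gamma}{}^{(0)}(\boldsymbol k)=\dfrac{\boldsymbol\xi(\boldsymbol k)\otimes\boldsymbol\xi(\boldsymbol k)}{(\boldsymbol A^{(0)}\boldsymbol\xi(\boldsymbol k),\boldsymbol\xi(\boldsymbol k))_{\mathbb R^d}}$ for $\boldsymbol k\ne\boldsymbol 0$ and $\widehat{\boldsymbol\Gamma}{}^{(0)}(\boldsymbol 0)=\boldsymbol 0$. The vector $\boldsymbol E$ is identified with the constant field. *)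

theory Defs
  imports "HOL-Analysis.Analysis"
begin

text \<open>
  The index type \<open>'n\<close> plays the role of the coordinate set, so that the dimension is
  \<open>CARD('n)\<close>.  Elements of the periodic Lebesgue spaces are represented by pointwise periodic
  functions; existence and uniqueness refer to their classes modulo null sets.
\<close>

definition cell :: "real^'n \<Rightarrow> (real^'n) set" where
  "cell Y = cbox (- Y) Y"

definition cell_volume :: "real^'n \<Rightarrow> real" where
  "cell_volume Y = 2 ^ CARD('n) * (\<Prod>\<alpha>\<in>UNIV. Y $ \<alpha>)"

definition cell_periodic :: "real^'n \<Rightarrow> (real^'n \<Rightarrow> 'b) \<Rightarrow> bool" where
  "cell_periodic Y u \<longleftrightarrow> (\<forall>\<alpha> x. u (x + (2 * Y $ \<alpha>) *\<^sub>R axis \<alpha> 1) = u x)"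

definition L2_per :: "real^'n \<Rightarrow> (real^'n \<Rightarrow> 'b::euclidean_space) set" where
  "L2_per Y = {u. u \<in> borel_measurable lebesgue \<and> cell_periodic Y u \<and>
     (\<forall>K. compact K \<longrightarrow> set_integrable lebesgue K (\<lambda>x. (norm (u x))\<^sup>2))}"

definition Linf_per :: "real^'n \<Rightarrow> (real^'n \<Rightarrow> 'b::euclidean_space) set" where
  "Linf_per Y = {u. u \<in> borel_measurable lebesgue \<and> cell_periodic Y u \<and>
     (\<forall>K. compact K \<longrightarrow> (\<exists>C. AE x in lebesgue. x \<in> K \<longrightarrow> norm (u x) \<le> C))}"

definition L2_inner ::
    "real^'n \<Rightarrow> (real^'n \<Rightarrow> 'b::euclidean_space) \<Rightarrow> (real^'n \<Rightarrow> 'b) \<Rightarrow> real" where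
  "L2_inner Y u v = (1 / cell_volume Y) * (LINT x:cell Y|lebesgue. u x \<bullet> v x)"

definition L2_norm :: "real^'n \<Rightarrow> (real^'n \<Rightarrow> 'b::euclidean_space) \<Rightarrow> real" where
  "L2_norm Y u = sqrt (L2_inner Y u u)"

definition partial :: "'n \<Rightarrow> (real^'n \<Rightarrow> real) \<Rightarrow> real^'n \<Rightarrow> real" where
  "partial \<alpha> f x = frechet_derivative f (at x) (axis \<alpha> 1)"

primrec Ck :: "nat \<Rightarrow> (real^'n \<Rightarrow> real) \<Rightarrow> bool" where
  "Ck 0 f \<longleftrightarrow> continuous_on UNIV f"
| "Ck (Suc k) f \<longleftrightarrow> (\<forall>x. f differentiable at x) \<and> (\<forall>\<alpha>. Ck k (partial \<alpha> f))"

definition Cinf_per :: "real^'n \<Rightarrow> (real^'n \<Rightarrow> real) set" where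
  "Cinf_per Y = {\<phi>. cell_periodic Y \<phi> \<and> (\<forall>k. Ck k \<phi>)}"

definition has_weak_gradient :: "real^'n \<Rightarrow> (real^'n \<Rightarrow> real) \<Rightarrow> (real^'n \<Rightarrow> real^'n) \<Rightarrow> bool" where
  "has_weak_gradient Y v g \<longleftrightarrow> v \<in> L2_per Y \<and> g \<in> L2_per Y \<and>
     (\<forall>\<phi>\<in>Cinf_per Y. \<forall>\<alpha>.
        (LINT x:cell Y|lebesgue. v x * partial \<alpha> \<phi> x) =
        - (LINT x:cell Y|lebesgue. g x $ \<alpha> * \<phi> x))"

text \<open>
  The real periodic Sobolev space of order one consists of the \<open>v\<close> that have a weak gradient in
  this sense.  A weak gradient is determined up to null sets, so quantifying over pairs
  \<open>(v, g)\<close> amounts to quantifying over \<open>v\<close> in that space with \<open>g = \<nabla> v\<close>.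
\<close>

definition curl_free :: "real^'n \<Rightarrow> (real^'n \<Rightarrow> real^'n) \<Rightarrow> bool" where
  "curl_free Y u \<longleftrightarrow> (\<forall>\<alpha> \<beta> v g. has_weak_gradient Y v g \<longrightarrow>
     (LINT x:cell Y|lebesgue. u x $ \<alpha> * g x $ \<beta> - u x $ \<beta> * g x $ \<alpha>) = 0)"

definition potential_fields :: "real^'n \<Rightarrow> (real^'n \<Rightarrow> real^'n) set" where
  "potential_fields Y =
     {u \<in> L2_per Y. curl_free Y u \<and> (LINT x:cell Y|lebesgue. u x) = 0}"

definition xi :: "real^'n \<Rightarrow> int^'n \<Rightarrow> real^'n" where
  "xi Y k = (\<chi> \<alpha>. of_int (k $ \<alpha>) / Y $ \<alpha>)"

definition fourier_char :: "real^'n \<Rightarrow> int^'n \<Rightarrow> real^'n \<Rightarrow> complex" where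
  "fourier_char Y k x = exp (\<i> * of_real (pi * (xi Y k \<bullet> x)))"

definition cvec :: "real^'n \<Rightarrow> complex^'n" where
  "cvec v = (\<chi> \<alpha>. of_real (v $ \<alpha>))"

definition cmat :: "real^'n^'m \<Rightarrow> complex^'n^'m" where
  "cmat M = (\<chi> \<alpha> \<beta>. of_real (M $ \<alpha> $ \<beta>))"

definition fourier_coeff :: "real^'n \<Rightarrow> (real^'n \<Rightarrow> real^'n) \<Rightarrow> int^'n \<Rightarrow> complex^'n" where
  "fourier_coeff Y u k =
     (1 / cell_volume Y) *\<^sub>R (LINT x:cell Y|lebesgue. fourier_char Y (- k) x *s cvec (u x))"

definition tensor :: "real^'n \<Rightarrow> real^'n \<Rightarrow> real^'n^'n" where
  "tensor v w = (\<chi> \<alpha> \<beta>. v $ \<alpha> * w $ \<beta>)"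

definition Gamma_hat :: "real^'n \<Rightarrow> real^'n^'n \<Rightarrow> int^'n \<Rightarrow> real^'n^'n" where
  "Gamma_hat Y A0 k =
     (if k = 0 then 0
      else (1 / ((A0 *v xi Y k) \<bullet> xi Y k)) *\<^sub>R tensor (xi Y k) (xi Y k))"

text \<open>Unconditional convergence in the mean-square norm of a series indexed by the lattice.\<close>

definition has_L2_sum ::
    "real^'n \<Rightarrow> (int^'n \<Rightarrow> real^'n \<Rightarrow> complex^'n) \<Rightarrow> (real^'n \<Rightarrow> complex^'n) \<Rightarrow> bool" where
  "has_L2_sum Y f w \<longleftrightarrow>
     ((\<lambda>F. L2_norm Y (\<lambda>x. w x - (\<Sum>k\<in>F. f k x))) \<longlongrightarrow> 0) (finite_subsets_at_top UNIV)"

text \<open>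
  For real \<open>u\<close> the terms with indices \<open>k\<close> and \<open>- k\<close> are complex conjugates of each other and
  the matrices \<open>Gamma_hat Y A0 k\<close> are bounded in \<open>k\<close> when \<open>A0\<close> is positive definite.  Hence for
  square-integrable \<open>u\<close> the series converges to a real field, unique up to null sets, and the
  choice below is one of its representatives.
\<close>

definition Gamma0 ::
    "real^'n \<Rightarrow> real^'n^'n \<Rightarrow> (real^'n \<Rightarrow> real^'n) \<Rightarrow> real^'n \<Rightarrow> real^'n" where
  "Gamma0 Y A0 u = (SOME w. w \<in> L2_per Y \<and>
     has_L2_sum Y
       (\<lambda>k x. fourier_char Y k x *s (cmat (Gamma_hat Y A0 k) *v fourier_coeff Y u k))
       (\<lambda>x. cvec (w x)))"

definition cell_problem_solution ::
    "real^'n \<Rightarrow> (real^'n \<Rightarrow> real^'n^'n) \<Rightarrow> real^'n \<Rightarrow> (real^'n \<Rightarrow> real^'n) \<Rightarrow> bool" where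
  "cell_problem_solution Y A E et \<longleftrightarrow> et \<in> potential_fields Y \<and>
     (\<forall>v\<in>potential_fields Y.
        L2_inner Y (\<lambda>x. A x *v et x) v = - L2_inner Y (\<lambda>x. A x *v E) v)"

definition lippmann_schwinger_solution ::
    "real^'n \<Rightarrow> (real^'n \<Rightarrow> real^'n^'n) \<Rightarrow> real^'n^'n \<Rightarrow> real^'n \<Rightarrow> (real^'n \<Rightarrow> real^'n) \<Rightarrow> bool" where
  "lippmann_schwinger_solution Y A A0 E e \<longleftrightarrow> e \<in> L2_per Y \<and>
     (AE x in lebesgue. x \<in> cell Y \<longrightarrow> e x + Gamma0 Y A0 (\<lambda>y. (A y - A0) *v e y) x = E)"

definition ex1_ae :: "((real^'n \<Rightarrow> 'b) \<Rightarrow> bool) \<Rightarrow> bool" where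
  "ex1_ae P \<longleftrightarrow> (\<exists>u. P u \<and> (\<forall>v. P v \<longrightarrow> (AE x in lebesgue. v x = u x)))"

end

theory Submission
  imports Defs
begin

text \<open>
  Potential fields are the orthogonal complement of a set of test fields, and a field of
  \<open>potential_fields Y\<close> has its Fourier coefficients at \<open>k\<close> parallel to \<open>xi Y k\<close>.  Parseval's identity
  therefore shows that \<open>w = Gamma0 Y A0 u\<close> is the unique potential field with \<open>(A0 w, v) = (u, v)\<close> for
  all potential fields \<open>v\<close>.  Testing with potential fields, which are orthogonal to constants, turns
  the Lippmann--Schwinger equation for \<open>e\<close> into \<open>(A e, v) = 0\<close> for all potential \<open>v\<close>, that is, into
  the cell problem for \<open>e - E\<close>.  The latter is uniquely solvable by coercivity and a contraction
  argument in the complete space of potential fields.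

  Parseval's identity needs the completeness of the exponentials: by Stone--Weierstrass on the
  torus, a function with vanishing Fourier coefficients has vanishing integral over every compact
  subset of the open cell.
\<close>

section \<open>Square-integrable functions\<close>

text \<open>Fields are functions, not classes: \<open>L2_norm\<close> is only a seminorm and
  \<open>Gamma0\<close> picks a representative by \<open>SOME\<close>. The operator is therefore
  used only through two facts that do not see null sets: its values are potential fields, and its
  \<open>A0\<close>-weighted products with potential fields are known. The obstacle to the first is
  that vanishing curl is tested against every function of the Sobolev space, not only against
  exponentials. In place of a density argument, the weak gradients themselves are tested with waves:
  their Fourier coefficients are parallel to \<open>xi Y k\<close> too, so a rotated gradient has
  coefficients orthogonal to \<open>xi Y k\<close>, and its product with the series of
  \<open>Gamma0\<close> vanishes term by term. In the completeness proof the function is merely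
  integrable, so uniform approximation on the torus is paired with its integral norm; the torus
  glues opposite faces of the cell, which is why only compact subsets of the open cell are
  reached.\<close>

definition square_integrable :: "'a measure \<Rightarrow> ('a \<Rightarrow> 'b::euclidean_space) \<Rightarrow> bool" where
  "square_integrable M u \<longleftrightarrow> u \<in> borel_measurable M \<and> integrable M (\<lambda>x. (norm (u x))\<^sup>2)"

definition l2_norm :: "'a measure \<Rightarrow> ('a \<Rightarrow> 'b::euclidean_space) \<Rightarrow> real" where
  "l2_norm M u = sqrt (\<integral>x. (norm (u x))\<^sup>2 \<partial>M)"

lemma square_integrable_measurable:
  "square_integrable M u \<Longrightarrow> u \<in> borel_measurable M"
  by (simp add: square_integrable_def)

lemma norm_add_square_le:
  fixes a b :: "'b::real_inner"
  shows "(norm (a + b))\<^sup>2 \<le> 2 * (norm a)\<^sup>2 + 2 * (norm b)\<^sup>2"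
proof -
  have "0 \<le> (norm (a - b))\<^sup>2" by simp
  then show ?thesis
    by (simp add: power2_norm_eq_inner algebra_simps inner_commute)
qed

lemma square_integrable_bound:
  assumes u: "square_integrable M u" and v: "v \<in> borel_measurable M"
    and le: "AE x in M. norm (v x) \<le> C * norm (u x)"
  shows "square_integrable M v"
proof -
  have "integrable M (\<lambda>x. C\<^sup>2 * (norm (u x))\<^sup>2)"
    using u by (simp add: square_integrable_def)
  moreover have "AE x in M. norm ((norm (v x))\<^sup>2) \<le> norm (C\<^sup>2 * (norm (u x))\<^sup>2)"
    using le
  proof eventually_elim
    case (elim x)
    then have "(norm (v x))\<^sup>2 \<le> (C * norm (u x))\<^sup>2" by (intro power_mono) auto
    then show ?case by (simp add: power_mult_distrib)
  qed
  moreover have "(\<lambda>x. (norm (v x))\<^sup>2) \<in> borel_measurable M"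
    using v by measurable
  ultimately have "integrable M (\<lambda>x. (norm (v x))\<^sup>2)"
    by (blast intro: Bochner_Integration.integrable_bound)
  with v show ?thesis by (simp add: square_integrable_def)
qed

lemma square_integrable_add:
  assumes "square_integrable M u" "square_integrable M v"
  shows "square_integrable M (\<lambda>x. u x + v x)"
proof -
  have [measurable]: "u \<in> borel_measurable M" "v \<in> borel_measurable M"
    using assms by (auto simp: square_integrable_def)
  have "integrable M (\<lambda>x. 2 * (norm (u x))\<^sup>2 + 2 * (norm (v x))\<^sup>2)"
    using assms by (simp add: square_integrable_def)
  then have "integrable M (\<lambda>x. (norm (u x + v x))\<^sup>2)"
    by (rule Bochner_Integration.integrable_bound) (auto simp: norm_add_square_le)
  then show ?thesis by (simp add: square_integrable_def)
qed

lemma square_integrable_bounded_linear: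
  assumes f: "bounded_linear f" and u: "square_integrable M u"
  shows "square_integrable M (\<lambda>x. f (u x))"
proof -
  obtain K where "\<And>x. norm (f x) \<le> norm x * K"
    using bounded_linear.bounded[OF f] by blast
  moreover have "(\<lambda>x. f (u x)) \<in> borel_measurable M"
    by (rule measurable_compose[OF square_integrable_measurable[OF u]
          borel_measurable_continuous_onI[OF linear_continuous_on[OF f]]])
  ultimately show ?thesis
    by (intro square_integrable_bound[OF u, where C=K]) (auto simp: mult.commute)
qed

lemma square_integrable_scaleR:
  "square_integrable M u \<Longrightarrow> square_integrable M (\<lambda>x. c *\<^sub>R u x)"
  by (rule square_integrable_bounded_linear[OF bounded_linear_scaleR_right])

lemma square_integrable_diff:
  assumes "square_integrable M u" "square_integrable M v"
  shows "square_integrable M (\<lambda>x. u x - v x)"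
  using square_integrable_add[OF assms(1) square_integrable_scaleR[OF assms(2), of "-1"]] by simp

lemma square_integrable_sum:
  assumes "\<And>i. i \<in> I \<Longrightarrow> square_integrable M (u i)"
  shows "square_integrable M (\<lambda>x. \<Sum>i\<in>I. u i x)"
  using assms
proof (induction I rule: infinite_finite_induct)
  case (insert i I)
  then show ?case using square_integrable_add[of M "u i" "\<lambda>x. \<Sum>i\<in>I. u i x"] by simp
qed (auto simp: square_integrable_def)

lemma square_integrable_inner:
  assumes "square_integrable M u" "square_integrable M v"
  shows "integrable M (\<lambda>x. u x \<bullet> v x)"
proof -
  have [measurable]: "u \<in> borel_measurable M" "v \<in> borel_measurable M"
    using assms by (auto simp: square_integrable_def)
  have "\<bar>a \<bullet> b\<bar> \<le> (norm a)\<^sup>2 + (norm b)\<^sup>2" for a b :: 'b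
  proof -
    have "\<bar>a \<bullet> b\<bar> \<le> norm a * norm b" by (rule Cauchy_Schwarz_ineq2)
    moreover have "2 * (norm a * norm b) \<le> (norm a)\<^sup>2 + (norm b)\<^sup>2"
      using sum_squares_bound[of "norm a" "norm b"] by simp
    moreover have "0 \<le> norm a * norm b" by simp
    ultimately show ?thesis by linarith
  qed
  moreover have "integrable M (\<lambda>x. (norm (u x))\<^sup>2 + (norm (v x))\<^sup>2)"
    using assms by (simp add: square_integrable_def)
  ultimately show ?thesis
    by (elim Bochner_Integration.integrable_bound) auto
qed

section \<open>The mean-square seminorm\<close>

lemma l2_norm_nonneg [simp]: "0 \<le> l2_norm M u"
  by (simp add: l2_norm_def)

lemma l2_norm_square: "(l2_norm M u)\<^sup>2 = (\<integral>x. u x \<bullet> u x \<partial>M)"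
  by (simp add: l2_norm_def power2_norm_eq_inner)

lemma l2_cauchy_schwarz:
  assumes u: "square_integrable M u" and v: "square_integrable M v"
  shows "\<bar>\<integral>x. u x \<bullet> v x \<partial>M\<bar> \<le> l2_norm M u * l2_norm M v"
proof -
  define a b c where "a = (\<integral>x. u x \<bullet> u x \<partial>M)" and "b = (\<integral>x. u x \<bullet> v x \<partial>M)"
    and "c = (\<integral>x. v x \<bullet> v x \<partial>M)"
  have q: "0 \<le> s\<^sup>2 * a + 2 * s * t * b + t\<^sup>2 * c" for s t
  proof -
    have "0 \<le> (\<integral>x. (s *\<^sub>R u x + t *\<^sub>R v x) \<bullet> (s *\<^sub>R u x + t *\<^sub>R v x) \<partial>M)" by simp
    also have "\<dots> = (\<integral>x. s\<^sup>2 * (u x \<bullet> u x) + 2 * s * t * (u x \<bullet> v x) + t\<^sup>2 * (v x \<bullet> v x) \<partial>M)"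
      by (simp add: algebra_simps inner_commute power2_eq_square)
    also have "\<dots> = s\<^sup>2 * a + 2 * s * t * b + t\<^sup>2 * c"
      using u v by (simp add: a_def b_def c_def square_integrable_inner)
    finally show ?thesis .
  qed
  have a0: "0 \<le> a" and c0: "0 \<le> c" by (simp_all add: a_def c_def)
  have "b\<^sup>2 \<le> a * c"
  proof (cases "c = 0")
    case True
    have "b = 0"
    proof (rule ccontr)
      assume "b \<noteq> 0"
      \<comment> \<open>With \<open>c = 0\<close> the form is affine in \<open>t\<close>; for
        \<open>s = 1\<close> this \<open>t\<close> gives a - (a + 1) = -1.\<close>
      then have "(1::real)\<^sup>2 * a + 2 * 1 * (- (a + 1) / (2 * b)) * b + (- (a + 1) / (2 * b))\<^sup>2 * c = -1"
        using True by (simp add: field_simps)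
      then show False using q[of 1 "- (a + 1) / (2 * b)"] by linarith
    qed
    then show ?thesis using a0 c0 by simp
  next
    case False
    then have c: "c > 0" using c0 by simp
    \<comment> \<open>The minimising ratio t/s = -b/c, cleared of its denominator.\<close>
    have "0 \<le> c\<^sup>2 * a + 2 * c * (- b) * b + (- b)\<^sup>2 * c" by (rule q)
    also have "\<dots> = c * (a * c - b\<^sup>2)" by (simp add: power2_eq_square algebra_simps)
    finally show ?thesis using c by (simp add: zero_le_mult_iff)
  qed
  then have "sqrt (b\<^sup>2) \<le> sqrt (a * c)" by (rule real_sqrt_le_mono)
  then show ?thesis
    by (simp add: l2_norm_def a_def b_def c_def real_sqrt_mult power2_norm_eq_inner)
qed

lemma l2_norm_triangle:
  assumes u: "square_integrable M u" and v: "square_integrable M v"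
  shows "l2_norm M (\<lambda>x. u x + v x) \<le> l2_norm M u + l2_norm M v"
proof (rule power2_le_imp_le)
  have "(l2_norm M (\<lambda>x. u x + v x))\<^sup>2 = (\<integral>x. u x \<bullet> u x + 2 * (u x \<bullet> v x) + v x \<bullet> v x \<partial>M)"
    by (simp add: l2_norm_square algebra_simps inner_commute)
  also have "\<dots> = (l2_norm M u)\<^sup>2 + 2 * (\<integral>x. u x \<bullet> v x \<partial>M) + (l2_norm M v)\<^sup>2"
    using u v by (simp add: l2_norm_square square_integrable_inner)
  also have "\<dots> \<le> (l2_norm M u + l2_norm M v)\<^sup>2"
    using l2_cauchy_schwarz[OF u v] by (simp add: power2_eq_square algebra_simps)
  finally show "(l2_norm M (\<lambda>x. u x + v x))\<^sup>2 \<le> (l2_norm M u + l2_norm M v)\<^sup>2" .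
qed simp

lemma l2_norm_diff_commute: "l2_norm M (\<lambda>x. u x - v x) = l2_norm M (\<lambda>x. v x - u x)"
  by (simp add: l2_norm_def norm_minus_commute)

lemma l2_norm_eq_0:
  assumes u: "square_integrable M u" and "l2_norm M u = 0"
  shows "AE x in M. u x = 0"
proof -
  have "(\<integral>x. (norm (u x))\<^sup>2 \<partial>M) = 0" using assms(2) by (simp add: l2_norm_def)
  then have "AE x in M. (norm (u x))\<^sup>2 = 0"
    using u by (subst (asm) integral_nonneg_eq_0_iff_AE) (auto simp: square_integrable_def)
  then show ?thesis by simp
qed

section \<open>Completeness of the mean-square seminorm\<close>

lemma convergent_of_geometric_increments:
  fixes a :: "nat \<Rightarrow> 'b::banach"
  assumes "\<And>k. 2 ^ k * (norm (a (Suc k) - a k))\<^sup>2 \<le> c"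
  shows "convergent a"
proof -
  have "c \<ge> 0" using assms[of 0] by (meson zero_le_power2 mult_nonneg_nonneg order_trans zero_le_numeral zero_le_power)
  \<comment> \<open>The weight 2^k on the squares forces increments of order 2^(-k/2), which are
    still summable.\<close>
  have bound: "norm (a (Suc k) - a k) \<le> sqrt c * (sqrt (1/2)) ^ k" for k
  proof (rule power2_le_imp_le)
    have "(sqrt c * (sqrt (1/2)) ^ k)\<^sup>2 = c * (1/2) ^ k"
      using \<open>c \<ge> 0\<close> by (simp add: power_mult_distrib flip: power_mult power_even_eq)
        (metis power_mult mult.commute real_sqrt_pow2 zero_le_divide_1_iff zero_le_numeral power_one_over)
    then have "2 ^ k * (norm (a (Suc k) - a k))\<^sup>2 \<le> 2 ^ k * (sqrt c * (sqrt (1/2)) ^ k)\<^sup>2"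
      using assms[of k] by (simp only:) (simp add: power_one_over)
    then show "(norm (a (Suc k) - a k))\<^sup>2 \<le> (sqrt c * (sqrt (1/2)) ^ k)\<^sup>2"
      by (rule mult_left_le_imp_le) simp
  qed (use \<open>c \<ge> 0\<close> in simp)
  have "sqrt (1/2) < (1::real)" by (simp add: real_sqrt_lt_1_iff)
  then have "summable (\<lambda>k. sqrt c * (sqrt (1/2)) ^ k)"
    by (intro summable_mult summable_geometric) simp
  then have "summable (\<lambda>k. a (Suc k) - a k)"
    using bound by (rule summable_comparison_test') 
  then have "convergent (\<lambda>n. \<Sum>k<n. a (Suc k) - a k)" by (simp add: summable_iff_convergent)
  then have "convergent (\<lambda>n. a n - a 0)" by (simp add: sum_lessThan_telescope)
  then have "convergent (\<lambda>n. (a n - a 0) + a 0)"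
    by (intro convergent_add convergent_const)
  then show ?thesis by simp
qed

text \<open>A fast subsequence converges almost everywhere, and Fatou's lemma turns its pointwise
  limit into a limit in the mean. The limit is exhibited as the \<open>lim\<close> of that
  subsequence, not merely asserted to exist, so that measurability and periodicity on the whole
  space can be read off later.\<close>

lemma l2_complete:
  fixes u :: "nat \<Rightarrow> 'a \<Rightarrow> 'b::euclidean_space"
  assumes u: "\<And>n. square_integrable M (u n)"
    and cauchy: "\<And>e. e > 0 \<Longrightarrow> \<exists>N. \<forall>m\<ge>N. \<forall>n\<ge>N. l2_norm M (\<lambda>x. u m x - u n x) < e"
  obtains r :: "nat \<Rightarrow> nat" where "strict_mono r"
    "square_integrable M (\<lambda>x. lim (\<lambda>i. u (r i) x))"
    "(\<lambda>n. l2_norm M (\<lambda>x. u n x - lim (\<lambda>i. u (r i) x))) \<longlonglongrightarrow> 0"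
proof -
  have [measurable]: "u n \<in> borel_measurable M" for n
    using u by (auto simp: square_integrable_def)
  have int: "integrable M (\<lambda>x. (norm (u m x - u n x))\<^sup>2)" for m n
    using square_integrable_diff[OF u u] by (auto simp: square_integrable_def)
  have sq: "(\<integral>\<^sup>+x. ennreal ((norm (u m x - u n x))\<^sup>2) \<partial>M) = ennreal ((l2_norm M (\<lambda>x. u m x - u n x))\<^sup>2)" for m n
    by (subst nn_integral_eq_integral[OF int]) (auto simp: l2_norm_def)
  have "\<forall>k. \<exists>N. \<forall>m\<ge>N. \<forall>n\<ge>N. l2_norm M (\<lambda>x. u m x - u n x) < (1/2)^k"
    by (intro allI cauchy) simp
  then obtain N where N: "\<And>k m n. m \<ge> N k \<Longrightarrow> n \<ge> N k \<Longrightarrow> l2_norm M (\<lambda>x. u m x - u n x) < (1/2)^k"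
    by metis
  \<comment> \<open>Summing the thresholds puts \<open>r k\<close> above \<open>N k\<close>; the
    extra \<open>k\<close> makes \<open>r\<close> strictly increasing.\<close>
  define r where "r k = k + (\<Sum>i\<le>k. N i)" for k
  have r: "strict_mono r" unfolding r_def by (intro strict_monoI_Suc) simp
  have rN: "r k \<ge> N k" for k
    unfolding r_def using member_le_sum[of k "{..k}" N] by simp
  have rN': "r (Suc k) \<ge> N k" for k
    using rN[of k] r by (metis order_trans strict_mono_less_eq le_Suc_eq order_refl)
  \<comment> \<open>The squared norms are at most 4^(-k), so the weight 2^k leaves a summable bound.
    The weighted sum is then finite almost everywhere and dominates each of its terms.\<close>
  have inc: "(\<integral>\<^sup>+x. ennreal (2 ^ k * (norm (u (r (Suc k)) x - u (r k) x))\<^sup>2) \<partial>M) \<le> ennreal ((1/2) ^ k)" for k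
  proof -
    have "(l2_norm M (\<lambda>x. u (r (Suc k)) x - u (r k) x))\<^sup>2 \<le> ((1/2)^k)\<^sup>2"
      by (rule power_mono[OF less_imp_le[OF N[OF rN' rN]]]) simp
    then have "2 ^ k * (l2_norm M (\<lambda>x. u (r (Suc k)) x - u (r k) x))\<^sup>2 \<le> 2 ^ k * ((1/2)^k)\<^sup>2"
      by (intro mult_left_mono) auto
    also have "\<dots> = (1/2::real)^k" by (simp add: power2_eq_square power_one_over)
    finally have "ennreal (2 ^ k * (l2_norm M (\<lambda>x. u (r (Suc k)) x - u (r k) x))\<^sup>2) \<le> ennreal ((1/2)^k)"
      by (rule ennreal_leI)
    then show ?thesis
      by (simp add: ennreal_mult nn_integral_cmult sq)
  qed
  have "(\<integral>\<^sup>+x. (\<Sum>k. ennreal (2 ^ k * (norm (u (r (Suc k)) x - u (r k) x))\<^sup>2)) \<partial>M)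
      = (\<Sum>k. \<integral>\<^sup>+x. ennreal (2 ^ k * (norm (u (r (Suc k)) x - u (r k) x))\<^sup>2) \<partial>M)"
    by (rule nn_integral_suminf) simp
  also have "\<dots> \<le> (\<Sum>k. ennreal ((1/2) ^ k))"
    by (intro suminf_le inc) auto
  also have "\<dots> = ennreal (\<Sum>k. (1/2) ^ k)"
    by (intro suminf_ennreal2 summable_geometric) auto
  also have "\<dots> < \<infinity>" by simp
  finally have "AE x in M. (\<Sum>k. ennreal (2 ^ k * (norm (u (r (Suc k)) x - u (r k) x))\<^sup>2)) \<noteq> \<infinity>"
    by (intro nn_integral_PInf_AE) auto
  then have conv: "AE x in M. convergent (\<lambda>i. u (r i) x)"
  proof eventually_elim
    case (elim x)
    let ?f = "\<lambda>k. 2 ^ k * (norm (u (r (Suc k)) x - u (r k) x))\<^sup>2"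
    define S where "S = (\<Sum>k. ennreal (?f k))"
    have "S \<noteq> \<infinity>" using elim by (simp only: S_def not_False_eq_True)
    then obtain c where c: "S = ennreal c" "c \<ge> 0"
      by (cases S rule: ennreal_cases) auto
    have "sum (\<lambda>k. ennreal (?f k)) {k} \<le> S" for k
      unfolding S_def by (rule sum_le_suminf) auto
    then have "ennreal (?f k) \<le> ennreal c" for k
      unfolding c(1) by (simp only: sum.insert sum.empty finite.emptyI empty_iff not_False_eq_True add_0_right)
    then have "?f k \<le> c" for k using c(2) by simp
    then show ?case by (rule convergent_of_geometric_increments)
  qed
  define w where "w x = lim (\<lambda>i. u (r i) x)" for x
  have [measurable]: "w \<in> borel_measurable M" unfolding w_def by measurable
  have lim: "AE x in M. (\<lambda>i. u (r i) x) \<longlonglongrightarrow> w x"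
    using conv by eventually_elim (simp add: w_def convergent_LIMSEQ_iff)
  \<comment> \<open>Since \<open>r i\<close> eventually exceeds \<open>K\<close>, the Cauchy bound
    along the subsequence passes to its limit.\<close>
  have fatou: "(\<integral>\<^sup>+x. ennreal ((norm (u n x - w x))\<^sup>2) \<partial>M) \<le> ennreal (e\<^sup>2)"
    if e: "e > 0" and K: "\<And>m. m \<ge> K \<Longrightarrow> l2_norm M (\<lambda>x. u n x - u m x) < e" for n K e
  proof -
    have "(\<integral>\<^sup>+x. ennreal ((norm (u n x - w x))\<^sup>2) \<partial>M)
        = (\<integral>\<^sup>+x. liminf (\<lambda>i. ennreal ((norm (u n x - u (r i) x))\<^sup>2)) \<partial>M)"
      using lim
      by (intro nn_integral_cong_AE, eventually_elim)
        (intro lim_imp_Liminf[symmetric] tendsto_intros tendsto_ennrealI; simp)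
    also have "\<dots> \<le> liminf (\<lambda>i. \<integral>\<^sup>+x. ennreal ((norm (u n x - u (r i) x))\<^sup>2) \<partial>M)"
      by (rule nn_integral_liminf) simp
    also have "\<dots> \<le> ennreal (e\<^sup>2)"
    proof (rule Liminf_le)
      have "eventually (\<lambda>i. i \<ge> K) sequentially" by (rule eventually_ge_at_top)
      then show "\<forall>\<^sub>F i in sequentially. (\<integral>\<^sup>+x. ennreal ((norm (u n x - u (r i) x))\<^sup>2) \<partial>M) \<le> ennreal (e\<^sup>2)"
      proof eventually_elim
        case (elim i)
        then have "r i \<ge> K" using seq_suble[OF r, of i] by simp
        then show ?case unfolding sq
          by (intro ennreal_leI power_mono[OF less_imp_le[OF K]]) auto
      qed
    qed simp
    finally show ?thesis .
  qed
  have wdiff: "square_integrable M (\<lambda>x. u n x - w x)" if "e > 0" and "\<And>m. m \<ge> K \<Longrightarrow> l2_norm M (\<lambda>x. u n x - u m x) < e" for n K e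
    using fatou[OF that] unfolding square_integrable_def
    by (auto intro!: integrableI_nn_integral_finite integrableI_bounded le_less_trans[OF _ ennreal_less_top])
  obtain K where K: "\<And>m n. m \<ge> K \<Longrightarrow> n \<ge> K \<Longrightarrow> l2_norm M (\<lambda>x. u m x - u n x) < 1"
    using cauchy[of 1] by auto
  have "square_integrable M (\<lambda>x. u K x - (u K x - w x))"
    by (intro square_integrable_diff u wdiff[of 1 K]) (use K in auto)
  then have w: "square_integrable M w" by simp
  have "(\<lambda>n. l2_norm M (\<lambda>x. u n x - w x)) \<longlonglongrightarrow> 0"
  proof (rule LIMSEQ_I)
    fix e :: real assume "e > 0"
    then obtain K where K: "\<And>m n. m \<ge> K \<Longrightarrow> n \<ge> K \<Longrightarrow> l2_norm M (\<lambda>x. u m x - u n x) < e/2"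
      using cauchy[of "e/2"] by auto
    have "l2_norm M (\<lambda>x. u n x - w x) < e" if n: "n \<ge> K" for n
    proof -
      have "integrable M (\<lambda>x. (norm (u n x - w x))\<^sup>2)"
        using square_integrable_diff[OF u w] by (simp add: square_integrable_def)
      then have "ennreal (\<integral>x. (norm (u n x - w x))\<^sup>2 \<partial>M) \<le> ennreal ((e/2)\<^sup>2)"
        using fatou[of "e/2" K n] K n \<open>e > 0\<close> by (simp add: nn_integral_eq_integral)
      then have "(\<integral>x. (norm (u n x - w x))\<^sup>2 \<partial>M) \<le> (e/2)\<^sup>2"
        by (simp add: power2_eq_square ennreal_le_iff)
      then have "l2_norm M (\<lambda>x. u n x - w x) \<le> sqrt ((e/2)\<^sup>2)"
        unfolding l2_norm_def by (rule real_sqrt_le_mono)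
      then show ?thesis using \<open>e > 0\<close> by simp
    qed
    then show "\<exists>no. \<forall>n\<ge>no. norm (l2_norm M (\<lambda>x. u n x - w x) - 0) < e" by auto
  qed
  with r w show ?thesis unfolding w_def by (rule that)
qed

section \<open>Periodic functions\<close>

abbreviation cell_measure :: "real^'n \<Rightarrow> (real^'n) measure" where
  "cell_measure Y \<equiv> lebesgue_on (cell Y)"

definition lattice_vector :: "real^'n \<Rightarrow> int^'n \<Rightarrow> real^'n" where
  "lattice_vector Y m = (\<chi> \<alpha>. of_int (m $ \<alpha>) * (2 * Y $ \<alpha>))"

lemma mem_cell: "x \<in> cell Y \<longleftrightarrow> (\<forall>\<alpha>. - Y $ \<alpha> \<le> x $ \<alpha> \<and> x $ \<alpha> \<le> Y $ \<alpha>)"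
  by (simp add: cell_def mem_box_cart)

lemma compact_cell: "compact (cell Y)"
  by (simp add: cell_def)

lemma cell_sets [measurable, simp]: "cell Y \<in> sets lebesgue"
  by (simp add: cell_def)

lemma measurable_on_cell:
  "f \<in> borel_measurable lebesgue \<Longrightarrow> f \<in> borel_measurable (cell_measure Y)"
  by (rule measurable_restrict_space1)

lemma continuous_borel_measurable_lebesgue:
  fixes f :: "'a::euclidean_space \<Rightarrow> 'b::topological_space"
  shows "continuous_on UNIV f \<Longrightarrow> f \<in> borel_measurable lebesgue"
  by (simp add: borel_measurable_continuous_onI measurable_completion)

lemma set_integral_cell:
  fixes f :: "real^'n \<Rightarrow> 'b::{banach, second_countable_topology}"
  shows "(LINT x:cell Y|lebesgue. f x) = integral\<^sup>L (cell_measure Y) f"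
  by (simp add: set_lebesgue_integral_def integral_restrict_space)

lemma set_integrable_cell:
  fixes f :: "real^'n \<Rightarrow> 'b::{banach, second_countable_topology}"
  shows "set_integrable lebesgue (cell Y) f \<longleftrightarrow> integrable (cell_measure Y) f"
  by (simp add: set_integrable_def integrable_restrict_space)

lemma AE_cell: "(AE x in cell_measure Y. P x) \<longleftrightarrow> (AE x in lebesgue. x \<in> cell Y \<longrightarrow> P x)"
  by (simp add: AE_restrict_space_iff)

lemma finite_cell_measure: "finite_measure (cell_measure Y)"
proof
  have "emeasure lebesgue (cell Y) < \<infinity>"
    unfolding cell_def using emeasure_lborel_cbox_finite[of "- Y" Y] by simp
  then show "emeasure (cell_measure Y) (space (cell_measure Y)) \<noteq> \<infinity>"
    by (simp add: emeasure_restrict_space)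
qed

section \<open>Translations, lattice periods and the reduction to one cell\<close>

lemma lebesgue_shift: "distr lebesgue lebesgue (\<lambda>x. a + x) = (lebesgue :: 'a::euclidean_space measure)"
  and measurable_shift: "(\<lambda>x::'a. a + x) \<in> lebesgue \<rightarrow>\<^sub>M lebesgue"
  for a :: "'a::euclidean_space"
proof -
  have *: "(\<lambda>x::'a. a + (\<Sum>j\<in>Basis. (1 * (x \<bullet> j)) *\<^sub>R j)) = (\<lambda>x. a + x)"
    by (simp add: euclidean_representation)
  show "distr lebesgue lebesgue (\<lambda>x. a + x) = lebesgue"
    using lebesgue_affine_euclidean[of "\<lambda>_. 1" a] unfolding * by (simp add: density_1)
  show "(\<lambda>x::'a. a + x) \<in> lebesgue \<rightarrow>\<^sub>M lebesgue"
    using lebesgue_affine_measurable[of "\<lambda>_. 1" a] unfolding * by simp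
qed

lemma
  fixes f :: "'a::euclidean_space \<Rightarrow> 'b::{banach, second_countable_topology}"
  assumes f: "f \<in> borel_measurable lebesgue"
  shows integral_shift: "(LINT x|lebesgue. f (a + x)) = (LINT x|lebesgue. f x)"
    and integrable_shift: "integrable lebesgue (\<lambda>x. f (a + x)) \<longleftrightarrow> integrable lebesgue f"
  using integral_distr[OF measurable_shift[of a] f] integrable_distr_eq[OF measurable_shift[of a] f]
  by (simp_all add: lebesgue_shift)

lemma measurable_shift_compose:
  "f \<in> borel_measurable lebesgue \<Longrightarrow> (\<lambda>x. f (a + x)) \<in> borel_measurable lebesgue"
  for a :: "'a::euclidean_space"
  by (rule measurable_compose[OF measurable_shift])

lemma cell_periodic_axis:
  assumes "cell_periodic Y u"
  shows "u (x + (of_int j * (2 * Y $ \<alpha>)) *\<^sub>R axis \<alpha> 1) = u x"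
proof -
  have nat: "u (x + (of_nat j * (2 * Y $ \<alpha>)) *\<^sub>R axis \<alpha> 1) = u x" for j :: nat and x
  proof (induction j)
    case (Suc j)
    have "x + (of_nat (Suc j) * (2 * Y $ \<alpha>)) *\<^sub>R axis \<alpha> 1
        = (x + (of_nat j * (2 * Y $ \<alpha>)) *\<^sub>R axis \<alpha> 1) + (2 * Y $ \<alpha>) *\<^sub>R axis \<alpha> 1"
      by (simp add: algebra_simps)
    then show ?case
      using assms[unfolded cell_periodic_def] by (simp only: Suc.IH)
  qed simp
  show ?thesis
  proof (cases j rule: int_cases2)
    case (nonneg n)
    then show ?thesis using nat[of x n] by simp
  next
    case (nonpos n)
    then show ?thesis using nat[of "x + (of_int j * (2 * Y $ \<alpha>)) *\<^sub>R axis \<alpha> 1" n]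
      by (simp add: algebra_simps)
  qed
qed

lemma cell_periodic_lattice:
  assumes "cell_periodic Y u"
  shows "u (lattice_vector Y m + x) = u x"
proof -
  have "u ((\<Sum>\<alpha>\<in>S. (of_int (m $ \<alpha>) * (2 * Y $ \<alpha>)) *\<^sub>R axis \<alpha> 1) + x) = u x" if "finite S" for S x
    using that
  proof (induction S arbitrary: x)
    case (insert \<alpha> S)
    have "(\<Sum>\<alpha>\<in>insert \<alpha> S. (of_int (m $ \<alpha>) * (2 * Y $ \<alpha>)) *\<^sub>R axis \<alpha> 1) + x
      = (\<Sum>\<alpha>\<in>S. (of_int (m $ \<alpha>) * (2 * Y $ \<alpha>)) *\<^sub>R axis \<alpha> 1) + (x + (of_int (m $ \<alpha>) * (2 * Y $ \<alpha>)) *\<^sub>R axis \<alpha> 1)"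
      using insert by simp
    then show ?case by (simp only: insert.IH cell_periodic_axis[OF assms])
  qed simp
  moreover have "(\<Sum>\<alpha>\<in>UNIV. (of_int (m $ \<alpha>) * (2 * Y $ \<alpha>)) *\<^sub>R axis \<alpha> 1) = lattice_vector Y m"
    by (simp add: vec_eq_iff lattice_vector_def axis_def if_distrib cong: if_cong)
  ultimately show ?thesis by (metis finite)
qed

lemma finite_int_vec_box: "finite {m :: int^'n. \<forall>\<alpha>. \<bar>m $ \<alpha>\<bar> \<le> B}"
proof (rule finite_subset)
  show "{m :: int^'n. \<forall>\<alpha>. \<bar>m $ \<alpha>\<bar> \<le> B} \<subseteq> vec_lambda ` (PiE UNIV (\<lambda>_. {-B..B}))"
  proof
    fix m :: "int^'n" assume m: "m \<in> {m. \<forall>\<alpha>. \<bar>m $ \<alpha>\<bar> \<le> B}"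
    have "vec_nth m \<in> PiE UNIV (\<lambda>_. {-B..B})"
      using m by (auto simp: abs_le_iff) (metis minus_le_iff)
    moreover have "m = vec_lambda (vec_nth m)" by simp
    ultimately show "m \<in> vec_lambda ` (PiE UNIV (\<lambda>_. {-B..B}))" by blast
  qed
qed (simp add: finite_PiE)

context
  fixes Y :: "real^'n"
  assumes Y_pos: "\<forall>\<alpha>. 0 < Y $ \<alpha>"
begin

text \<open>Rounding to the nearest multiple of the period leaves a remainder of at most half a
  period, which is \<open>Y $ \<alpha>\<close>.\<close>

lemma lattice_reduction:
  fixes x :: "real^'n"
  defines "m \<equiv> \<chi> \<alpha>. round (x $ \<alpha> / (2 * Y $ \<alpha>))"
  shows "- lattice_vector Y m + x \<in> cell Y"
proof -
  have "\<bar>x $ \<alpha> - of_int (m $ \<alpha>) * (2 * Y $ \<alpha>)\<bar> \<le> Y $ \<alpha>" for \<alpha>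
  proof -
    have y: "0 < Y $ \<alpha>" using Y_pos by simp
    have "\<bar>of_int (m $ \<alpha>) - x $ \<alpha> / (2 * Y $ \<alpha>)\<bar> * (2 * Y $ \<alpha>) \<le> 1/2 * (2 * Y $ \<alpha>)"
      unfolding m_def vec_lambda_beta using y by (intro mult_right_mono of_int_round_abs_le) simp
    moreover have "\<bar>of_int (m $ \<alpha>) - x $ \<alpha> / (2 * Y $ \<alpha>)\<bar> * (2 * Y $ \<alpha>)
        = \<bar>(of_int (m $ \<alpha>) - x $ \<alpha> / (2 * Y $ \<alpha>)) * (2 * Y $ \<alpha>)\<bar>"
      using y by (simp add: abs_mult)
    moreover have "(of_int (m $ \<alpha>) - x $ \<alpha> / (2 * Y $ \<alpha>)) * (2 * Y $ \<alpha>)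
        = of_int (m $ \<alpha>) * (2 * Y $ \<alpha>) - x $ \<alpha>"
      using y by (simp add: field_simps)
    ultimately show ?thesis by (simp add: abs_minus_commute)
  qed
  then show ?thesis by (auto simp: mem_cell lattice_vector_def abs_le_iff) (smt (verit))+
qed

text \<open>The exceptional set is covered by countably many lattice translates of its null part in
  the cell. Periodicity is imposed on the predicate itself, viewed as a function with values in
  \<open>bool\<close>.\<close>

lemma AE_of_AE_cell:
  assumes per: "cell_periodic Y P" and ae: "AE x in lebesgue. x \<in> cell Y \<longrightarrow> P x"
  shows "AE x in lebesgue. P x"
proof -
  define N where "N = {x \<in> cell Y. \<not> P x}"
  have N: "negligible N"
    using ae unfolding completion.AE_iff_null_sets negligible_iff_null_sets N_def by simp
  have "{x. \<not> P x} \<subseteq> (\<Union>m. (+) (lattice_vector Y m) ` N)"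
  proof
    fix x assume x: "x \<in> {x. \<not> P x}"
    obtain m where m: "- lattice_vector Y m + x \<in> cell Y" using lattice_reduction by blast
    have "P (lattice_vector Y m + (- lattice_vector Y m + x)) = P (- lattice_vector Y m + x)"
      by (rule cell_periodic_lattice[OF per])
    with x m have "- lattice_vector Y m + x \<in> N" by (simp add: N_def)
    then have "lattice_vector Y m + (- lattice_vector Y m + x) \<in> (+) (lattice_vector Y m) ` N" by blast
    then show "x \<in> (\<Union>m. (+) (lattice_vector Y m) ` N)" by auto
  qed
  moreover have "negligible (\<Union>m. (+) (lattice_vector Y m) ` N)"
    by (intro negligible_countable_Union countable_image uncountable_def[THEN iffD2]) (auto intro: negligible_translation N)
  ultimately have "negligible {x. \<not> P x}" by (rule negligible_subset[rotated])
  then show ?thesis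
    unfolding completion.AE_iff_null_sets negligible_iff_null_sets by simp
qed

text \<open>A compact set is covered by finitely many lattice translates of the cell, and
  integrability over each of them is integrability over the cell by translation.\<close>

lemma set_integrable_periodic:
  fixes f :: "real^'n \<Rightarrow> 'b::{banach, second_countable_topology}"
  assumes f: "f \<in> borel_measurable lebesgue" and per: "cell_periodic Y f"
    and int: "integrable (cell_measure Y) f" and K: "compact K"
  shows "set_integrable lebesgue K f"
proof -
  obtain B where B: "\<And>x. x \<in> K \<Longrightarrow> norm x \<le> B"
    using compact_imp_bounded[OF K] by (auto simp: bounded_iff)
  define b where "b = Min (range (\<lambda>\<alpha>. 2 * Y $ \<alpha>))"
  have b: "0 < b" and bY: "b \<le> 2 * Y $ \<alpha>" for \<alpha>
    using Y_pos by (auto simp: b_def)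
  \<comment> \<open>For a point of \<open>K\<close> the quotients by the periods are at most
    \<open>B / b\<close>; the added 1 absorbs the rounding error of at most 1/2.\<close>
  define F where "F = {m :: int^'n. \<forall>\<alpha>. \<bar>m $ \<alpha>\<bar> \<le> \<lceil>B / b + 1\<rceil>}"
  have F: "finite F" unfolding F_def by (rule finite_int_vec_box)
  let ?C = "\<lambda>m. {x. - lattice_vector Y m + x \<in> cell Y}"
  have C: "?C m \<in> sets lebesgue" for m
    using measurable_sets[OF measurable_shift cell_sets, of "- lattice_vector Y m" Y]
    by (simp add: vimage_def)
  have "K \<subseteq> (\<Union>m\<in>F. ?C m)"
  proof
    fix x assume x: "x \<in> K"
    define m where "m = (\<chi> \<alpha>. round (x $ \<alpha> / (2 * Y $ \<alpha>)))"
    have "\<bar>m $ \<alpha>\<bar> \<le> \<lceil>B / b + 1\<rceil>" for \<alpha>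
    proof -
      have y: "0 < Y $ \<alpha>" using Y_pos by simp
      have "\<bar>x $ \<alpha>\<bar> \<le> B" using B[OF x] component_le_norm_cart[of x \<alpha>] by simp
      then have "\<bar>x $ \<alpha> / (2 * Y $ \<alpha>)\<bar> \<le> B / b"
        using y b bY[of \<alpha>] by (auto simp: abs_divide intro!: frac_le)
      moreover have "\<bar>of_int (m $ \<alpha>) - x $ \<alpha> / (2 * Y $ \<alpha>)\<bar> \<le> 1/2"
        unfolding m_def vec_lambda_beta by (rule of_int_round_abs_le)
      ultimately have "\<bar>real_of_int (m $ \<alpha>)\<bar> \<le> B / b + 1" by linarith
      then show ?thesis by linarith
    qed
    then have "m \<in> F" by (simp add: F_def)
    moreover have "x \<in> ?C m" using lattice_reduction[of x] by (simp add: m_def)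
    ultimately show "x \<in> (\<Union>m\<in>F. ?C m)" by blast
  qed
  moreover have "set_integrable lebesgue (?C m) f" for m
  proof -
    have "integrable lebesgue (\<lambda>x. indicator (cell Y) x *\<^sub>R f x)"
      using int by (simp add: integrable_restrict_space)
    then have "integrable lebesgue (\<lambda>x. indicator (cell Y) (- lattice_vector Y m + x) *\<^sub>R f (- lattice_vector Y m + x))"
      by (subst integrable_shift[of "\<lambda>x. indicator (cell Y) x *\<^sub>R f x"]) (use f in auto)
    moreover have "f (- lattice_vector Y m + x) = f x" for x
      using cell_periodic_lattice[OF per, of m "- lattice_vector Y m + x"] by simp
    ultimately show ?thesis unfolding set_integrable_def
      by (simp add: indicator_def)
  qed
  then have "set_integrable lebesgue (\<Union>m\<in>F. ?C m) f"
    by (intro set_integrable_UN F C)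
  moreover have "K \<in> sets lebesgue" using K by (simp add: lmeasurable_compact fmeasurableD)
  ultimately show ?thesis by (intro set_integrable_subset[of _ "\<Union>m\<in>F. ?C m" f K])
qed

text \<open>Local integrability reduces to a single cell, so the analysis can run over the finite
  measure \<open>cell_measure Y\<close>; measurability and periodicity remain conditions on the
  whole space.\<close>

lemma L2_per_iff:
  "u \<in> L2_per Y \<longleftrightarrow> u \<in> borel_measurable lebesgue \<and> cell_periodic Y u \<and> square_integrable (cell_measure Y) u"
proof
  assume u: "u \<in> L2_per Y"
  then have "set_integrable lebesgue (cell Y) (\<lambda>x. (norm (u x))\<^sup>2)"
    using compact_cell by (auto simp: L2_per_def)
  then show "u \<in> borel_measurable lebesgue \<and> cell_periodic Y u \<and> square_integrable (cell_measure Y) u"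
    using u by (auto simp: L2_per_def square_integrable_def set_integrable_cell measurable_on_cell)
next
  assume u: "u \<in> borel_measurable lebesgue \<and> cell_periodic Y u \<and> square_integrable (cell_measure Y) u"
  then have "cell_periodic Y (\<lambda>x. (norm (u x))\<^sup>2)" by (simp add: cell_periodic_def)
  with u show "u \<in> L2_per Y"
    by (auto simp: L2_per_def square_integrable_def intro!: set_integrable_periodic)
qed

text \<open>Cutting the cell at the hyperplane where coordinate \<alpha> is t - Y_\<alpha> and
  moving the lower piece up by one period yields the translated cell up to null sets, and the
  integrand does not notice the move.\<close>

lemma integral_cell_shift:
  fixes f :: "real^'n \<Rightarrow> 'b::{banach, second_countable_topology}"
  assumes f: "f \<in> borel_measurable lebesgue" and per: "cell_periodic Y f"
    and int: "integrable (cell_measure Y) f" and t: "0 \<le> t" "t \<le> 2 * Y $ \<alpha>"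
  shows "(LINT x|cell_measure Y. f (t *\<^sub>R axis \<alpha> 1 + x)) = (LINT x|cell_measure Y. f x)"
    and "integrable (cell_measure Y) (\<lambda>x. f (t *\<^sub>R axis \<alpha> 1 + x))"
proof -
  let ?e = "axis \<alpha> 1 :: real^'n"
  let ?h = "\<lambda>c. {x :: real^'n. x $ \<alpha> = c}"
  define S1 where "S1 = {x \<in> cell Y. x $ \<alpha> > t - Y $ \<alpha>}"
  define S2 where "S2 = {x \<in> cell Y. x $ \<alpha> < t - Y $ \<alpha>}"
  \<comment> \<open>\<open>p + x\<close> lies in \<open>S2\<close> exactly when \<open>x\<close>
    lies in \<open>S2\<close> moved up by one period.\<close>
  define p where "p = (- 2 * Y $ \<alpha>) *\<^sub>R ?e"
  have [measurable]: "S1 \<in> sets lebesgue" "S2 \<in> sets lebesgue"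
  proof -
    have "{x :: real^'n. x $ \<alpha> > t - Y $ \<alpha>} \<in> sets lebesgue" "{x :: real^'n. x $ \<alpha> < t - Y $ \<alpha>} \<in> sets lebesgue"
      by (auto intro!: borel_open sets_completionI_sets open_halfspace_component_gt_cart open_halfspace_component_lt_cart)
    then show "S1 \<in> sets lebesgue" "S2 \<in> sets lebesgue"
      unfolding S1_def S2_def Collect_conj_eq Collect_mem_eq by auto
  qed
  note [measurable] = f
  have Sint: "integrable lebesgue (\<lambda>x. indicator S x *\<^sub>R f x)" if "S \<subseteq> cell Y" "S \<in> sets lebesgue" for S
    using set_integrable_subset[of lebesgue "cell Y" f S] that int
    unfolding set_integrable_cell by (auto simp: set_integrable_def)
  have S1: "integrable lebesgue (\<lambda>x. indicator S1 x *\<^sub>R f x)"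
    and S2: "integrable lebesgue (\<lambda>x. indicator S2 x *\<^sub>R f x)"
    by (auto intro!: Sint simp: S1_def S2_def) (use \<open>S1 \<in> sets lebesgue\<close> \<open>S2 \<in> sets lebesgue\<close> in \<open>auto simp: S1_def S2_def\<close>)
  have pf: "f (p + x) = f x" for x
  proof -
    have "f ((p + x) + (2 * Y $ \<alpha>) *\<^sub>R axis \<alpha> 1) = f (p + x)"
      using per by (simp only: cell_periodic_def)
    then show ?thesis by (simp add: p_def)
  qed
  have hyp: "AE x in lebesgue. x $ \<alpha> \<noteq> c" for c :: real
    using negligible_standard_hyperplane[of "axis \<alpha> (1::real)" c]
    unfolding completion.AE_iff_null_sets negligible_iff_null_sets by (auto simp: inner_axis Basis_vec_def)
  have S2': "integrable lebesgue (\<lambda>x. indicator S2 (p + x) *\<^sub>R f x)"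
    and S2'': "(LINT x|lebesgue. indicator S2 (p + x) *\<^sub>R f x) = (LINT x|lebesgue. indicator S2 x *\<^sub>R f x)"
    using S2 integrable_shift[of "\<lambda>x. indicator S2 x *\<^sub>R f x" p] integral_shift[of "\<lambda>x. indicator S2 x *\<^sub>R f x" p]
    by (simp_all add: pf)
  have "(LINT x|cell_measure Y. f x) = (LINT x|lebesgue. indicator (cell Y) x *\<^sub>R f x)"
    by (simp add: integral_restrict_space)
  also have "\<dots> = (LINT x|lebesgue. indicator S1 x *\<^sub>R f x + indicator S2 x *\<^sub>R f x)"
  proof (rule integral_cong_AE)
    show "AE x in lebesgue. indicator (cell Y) x *\<^sub>R f x = indicator S1 x *\<^sub>R f x + indicator S2 x *\<^sub>R f x"
      using hyp[of "t - Y $ \<alpha>"] by eventually_elim (auto simp: S1_def S2_def indicator_def)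
  qed measurable
  also have "\<dots> = (LINT x|lebesgue. indicator S1 x *\<^sub>R f x) + (LINT x|lebesgue. indicator S2 (p + x) *\<^sub>R f x)"
    using S1 S2 S2'' by simp
  also have "\<dots> = (LINT x|lebesgue. indicator S1 x *\<^sub>R f x + indicator S2 (p + x) *\<^sub>R f x)"
    using S1 S2' by simp
  finally have I0: "(LINT x|cell_measure Y. f x) = (LINT x|lebesgue. indicator S1 x *\<^sub>R f x + indicator S2 (p + x) *\<^sub>R f x)" .
  \<comment> \<open>Off the cutting and bounding hyperplanes strict and weak inequalities agree, so
    the two pieces match the translated cell exactly.\<close>
  have ind: "AE x in lebesgue. indicator S1 x *\<^sub>R f x + indicator S2 (p + x) *\<^sub>R f x
      = indicator (cell Y) (- (t *\<^sub>R ?e) + x) *\<^sub>R f x"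
    using hyp[of "t - Y $ \<alpha>"] hyp[of "Y $ \<alpha>"] hyp[of "t + Y $ \<alpha>"]
  proof eventually_elim
    case (elim x)
    let ?o = "\<forall>\<beta>. \<beta> \<noteq> \<alpha> \<longrightarrow> - Y $ \<beta> \<le> x $ \<beta> \<and> x $ \<beta> \<le> Y $ \<beta>"
    have y: "Y $ \<alpha> > 0" using Y_pos by simp
    have c: "- (s *\<^sub>R ?e) + x \<in> cell Y \<longleftrightarrow> ?o \<and> - Y $ \<alpha> \<le> x $ \<alpha> - s \<and> x $ \<alpha> - s \<le> Y $ \<alpha>" for s
      unfolding mem_cell by (auto simp: axis_def)
    have 1: "x \<in> S1 \<longleftrightarrow> ?o \<and> t - Y $ \<alpha> < x $ \<alpha> \<and> x $ \<alpha> < Y $ \<alpha>"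
      using c[of 0] elim t y by (auto simp: S1_def)
    have 2: "p + x \<in> S2 \<longleftrightarrow> ?o \<and> Y $ \<alpha> < x $ \<alpha> \<and> x $ \<alpha> < t + Y $ \<alpha>"
      using c[of "2 * Y $ \<alpha>"] elim t y by (auto simp: S2_def p_def)
    have 3: "- (t *\<^sub>R ?e) + x \<in> cell Y \<longleftrightarrow> ?o \<and> t - Y $ \<alpha> < x $ \<alpha> \<and> x $ \<alpha> < t + Y $ \<alpha>"
      using c[of t] elim by auto
    show ?case unfolding indicator_def 1 2 3 using elim t y by auto
  qed
  have m: "(\<lambda>x. indicator (cell Y) (- (t *\<^sub>R ?e) + x) *\<^sub>R f x) \<in> borel_measurable lebesgue"
    using measurable_shift_compose[of "indicator (cell Y) :: _ \<Rightarrow> real" "- (t *\<^sub>R ?e)"] by measurable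
  have m': "(\<lambda>x. indicator S1 x *\<^sub>R f x + indicator S2 (p + x) *\<^sub>R f x) \<in> borel_measurable lebesgue"
    using S1 S2' by measurable
  have i: "integrable lebesgue (\<lambda>x. indicator (cell Y) (- (t *\<^sub>R ?e) + x) *\<^sub>R f x)"
    by (rule integrable_cong_AE_imp[OF _ m]) (use S1 S2' ind in auto)
  have "(LINT x|cell_measure Y. f (t *\<^sub>R ?e + x)) = (LINT x|lebesgue. indicator (cell Y) x *\<^sub>R f (t *\<^sub>R ?e + x))"
    by (simp add: integral_restrict_space)
  also have "\<dots> = (LINT x|lebesgue. indicator (cell Y) (- (t *\<^sub>R ?e) + x) *\<^sub>R f x)"
    using integral_shift[OF m, of "t *\<^sub>R ?e"] by simp
  also have "\<dots> = (LINT x|cell_measure Y. f x)"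
    unfolding I0 by (rule integral_cong_AE[OF m m']) (use ind in auto)
  finally show "(LINT x|cell_measure Y. f (t *\<^sub>R axis \<alpha> 1 + x)) = (LINT x|cell_measure Y. f x)" .
  show "integrable (cell_measure Y) (\<lambda>x. f (t *\<^sub>R axis \<alpha> 1 + x))"
    using i integrable_shift[OF m, of "t *\<^sub>R ?e"] by (simp add: integrable_restrict_space)
qed

end

section \<open>Integration by parts on the cell\<close>

lemma continuous_integrable_cell:
  fixes f :: "real^'n \<Rightarrow> 'b::euclidean_space"
  assumes f: "continuous_on UNIV f"
  shows "integrable (cell_measure Y) f"
proof -
  have "compact (f ` cell Y)"
    by (rule compact_continuous_image[OF continuous_on_subset[OF f] compact_cell]) simp
  from compact_imp_bounded[OF this] obtain B where "\<And>x. x \<in> cell Y \<Longrightarrow> norm (f x) \<le> B"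
    by (auto simp: bounded_iff)
  then show ?thesis
    by (intro finite_measure.integrable_const_bound[OF finite_cell_measure, of _ B] measurable_on_cell
        continuous_borel_measurable_lebesgue f) (simp add: AE_cell)
qed

lemma continuous_square_integrable_cell:
  fixes f :: "real^'n \<Rightarrow> 'b::euclidean_space"
  assumes f: "continuous_on UNIV f"
  shows "square_integrable (cell_measure Y) f"
  unfolding square_integrable_def
  by (intro conjI measurable_on_cell continuous_borel_measurable_lebesgue continuous_integrable_cell
      continuous_intros f)

lemma partial_eq:
  assumes "(f has_derivative D) (at x)"
  shows "partial \<alpha> f x = D (axis \<alpha> 1)"
  using frechet_derivative_at[OF assms] by (simp add: partial_def)

lemma has_real_derivative_along_axis:
  assumes "\<And>x. f differentiable at x"
  shows "((\<lambda>s. f (s *\<^sub>R axis \<alpha> 1 + x)) has_real_derivative partial \<alpha> f (s *\<^sub>R axis \<alpha> 1 + x)) (at s)"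
proof -
  let ?D = "frechet_derivative f (at (s *\<^sub>R axis \<alpha> 1 + x))"
  have D: "(f has_derivative ?D) (at (s *\<^sub>R axis \<alpha> 1 + x))"
    using assms frechet_derivative_works by blast
  have "((\<lambda>s. s *\<^sub>R axis \<alpha> 1 + x) has_derivative (\<lambda>h. h *\<^sub>R axis \<alpha> 1)) (at s)"
    by (auto intro!: derivative_eq_intros)
  from has_derivative_compose[OF this D]
  have "((\<lambda>s. f (s *\<^sub>R axis \<alpha> 1 + x)) has_derivative (\<lambda>h. ?D (h *\<^sub>R axis \<alpha> 1))) (at s)" .
  moreover have "?D (h *\<^sub>R axis \<alpha> 1) = partial \<alpha> f (s *\<^sub>R axis \<alpha> 1 + x) * h" for h
    using linear_scale[OF has_derivative_linear[OF D]] by (simp add: partial_def)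
  ultimately show ?thesis by (simp add: has_field_derivative_def)
qed

lemma partial_periodic:
  fixes f :: "real^'n \<Rightarrow> real"
  assumes d: "\<And>x. f differentiable at x" and per: "cell_periodic Y f"
  shows "cell_periodic Y (partial \<alpha> f)"
  unfolding cell_periodic_def
proof (intro allI)
  fix \<beta> and x :: "real^'n"
  let ?p = "(2 * Y $ \<beta>) *\<^sub>R axis \<beta> 1 :: real^'n"
  let ?D = "frechet_derivative f (at (x + ?p))"
  have D: "(f has_derivative ?D) (at (x + ?p))"
    using d frechet_derivative_works by blast
  have "((\<lambda>x. x + ?p) has_derivative (\<lambda>h. h)) (at x)"
    by (auto intro!: derivative_eq_intros)
  from has_derivative_compose[OF this D]
  have "((\<lambda>x. f (x + ?p)) has_derivative ?D) (at x)" .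
  moreover have "(\<lambda>x. f (x + ?p)) = f"
    using per by (simp add: cell_periodic_def)
  ultimately have "(f has_derivative ?D) (at x)" by simp
  then show "partial \<alpha> f (x + ?p) = partial \<alpha> f x"
    using partial_eq[of f ?D x \<alpha>] by (simp add: partial_def)
qed

text \<open>Difference quotients along an axis integrate to zero by translation invariance and
  converge boundedly to the partial derivative. This takes the place of iterated integration and of
  cancelling boundary terms on opposite faces.\<close>

lemma integral_partial_eq_0:
  fixes f :: "real^'n \<Rightarrow> real"
  assumes Y_pos: "\<forall>\<alpha>. 0 < Y $ \<alpha>" and d: "\<And>x. f differentiable at x"
    and c: "continuous_on UNIV (partial \<alpha> f)" and per: "cell_periodic Y f"
  shows "(LINT x|cell_measure Y. partial \<alpha> f x) = 0"
proof -
  let ?e = "axis \<alpha> 1 :: real^'n"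
  \<comment> \<open>All increments are at most one period, the range covered by
    \<open>integral_cell_shift\<close>.\<close>
  define h where "h n = 2 * Y $ \<alpha> / (real n + 1)" for n
  have y: "0 < Y $ \<alpha>" using Y_pos by simp
  have h: "0 < h n" "h n \<le> 2 * Y $ \<alpha>" for n
    using y by (auto simp: h_def field_simps)
  define q where "q n x = (f (h n *\<^sub>R ?e + x) - f x) / h n" for n x
  have cont: "continuous_on UNIV f"
    using d differentiable_imp_continuous_within by (auto simp: continuous_on_eq_continuous_within)
  have meas: "f \<in> borel_measurable lebesgue" and int: "integrable (cell_measure Y) f"
    using cont by (auto intro: continuous_borel_measurable_lebesgue continuous_integrable_cell)
  have q0: "(LINT x|cell_measure Y. q n x) = 0" for n
    using integral_cell_shift[OF Y_pos meas per int, of "h n" \<alpha>] int h[of n]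
    by (simp add: q_def)
  \<comment> \<open>The mean value point lies less than one period above a point of the cell, hence
    in the box enlarged by the factor 3.\<close>
  have "compact (partial \<alpha> f ` cbox (- 3 *\<^sub>R Y) (3 *\<^sub>R Y))"
    by (rule compact_continuous_image[OF continuous_on_subset[OF c] compact_cbox]) simp
  from compact_imp_bounded[OF this]
  obtain B where B: "\<And>x. x \<in> cbox (- 3 *\<^sub>R Y) (3 *\<^sub>R Y) \<Longrightarrow> \<bar>partial \<alpha> f x\<bar> \<le> B"
    by (auto simp: bounded_iff)
  have qB: "\<bar>q n x\<bar> \<le> B" if x: "x \<in> cell Y" for n x
  proof -
    obtain s where s: "0 < s" "s < h n"
      and eq: "f (h n *\<^sub>R ?e + x) - f (0 *\<^sub>R ?e + x) = (h n - 0) * partial \<alpha> f (s *\<^sub>R ?e + x)"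
      using MVT2[OF h(1) has_real_derivative_along_axis[OF d], of n \<alpha> x] by auto
    have "s *\<^sub>R ?e + x \<in> cbox (- 3 *\<^sub>R Y) (3 *\<^sub>R Y)"
      unfolding mem_box_cart
    proof
      fix \<beta>
      have "0 < Y $ \<beta>" "- Y $ \<beta> \<le> x $ \<beta>" "x $ \<beta> \<le> Y $ \<beta>" using x Y_pos by (auto simp: mem_cell)
      then show "(- 3 *\<^sub>R Y) $ \<beta> \<le> (s *\<^sub>R ?e + x) $ \<beta> \<and> (s *\<^sub>R ?e + x) $ \<beta> \<le> (3 *\<^sub>R Y) $ \<beta>"
        using s h[of n] by (cases "\<beta> = \<alpha>") (auto simp: axis_def)
    qed
    then show ?thesis using eq B h(1)[of n] by (simp add: q_def)
  qed
  have h0: "h \<longlonglongrightarrow> 0"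
    using tendsto_mult_right_zero[OF LIMSEQ_inverse_real_of_nat, of "2 * Y $ \<alpha>"]
    unfolding h_def by (simp add: divide_inverse add.commute)
  have lim: "(\<lambda>n. q n x) \<longlonglongrightarrow> partial \<alpha> f x" for x
  proof -
    have "((\<lambda>t. (f (t *\<^sub>R ?e + x) - f x) / t) \<longlongrightarrow> partial \<alpha> f x) (at 0)"
      using has_real_derivative_along_axis[OF d, of \<alpha> x 0] by (simp add: DERIV_def)
    moreover have "filterlim h (at 0) sequentially"
      using h0 h(1) by (auto simp: filterlim_at less_imp_neq[symmetric])
    ultimately show ?thesis unfolding q_def by (rule filterlim_compose)
  qed
  have "(\<lambda>n. LINT x|cell_measure Y. q n x) \<longlonglongrightarrow> (LINT x|cell_measure Y. partial \<alpha> f x)"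
  proof (rule integral_dominated_convergence)
    show "partial \<alpha> f \<in> borel_measurable (cell_measure Y)"
      by (intro measurable_on_cell continuous_borel_measurable_lebesgue c)
    have "(\<lambda>x. (f (h n *\<^sub>R ?e + x) - f x) / h n) \<in> borel_measurable lebesgue" for n
      using measurable_shift_compose[OF meas, of "h n *\<^sub>R ?e"] meas by measurable
    then show "q n \<in> borel_measurable (cell_measure Y)" for n
      unfolding q_def[abs_def] by (rule measurable_on_cell)
    show "integrable (cell_measure Y) (\<lambda>_. B)"
      by (rule finite_measure.integrable_const[OF finite_cell_measure])
    show "AE x in cell_measure Y. norm (q n x) \<le> B" for n
      using qB by (simp add: AE_cell)
  qed (use lim in simp)
  then show ?thesis unfolding q0 by (simp add: LIMSEQ_const_iff)
qed

section \<open>Cosine waves as real test functions\<close>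

definition wave :: "real^'n \<Rightarrow> int^'n \<Rightarrow> real \<Rightarrow> real^'n \<Rightarrow> real" where
  "wave Y k b x = cos (pi * (xi Y k \<bullet> x) + b)"

lemma has_derivative_cos_affine:
  "((\<lambda>x. c * cos (a \<bullet> x + b)) has_derivative (\<lambda>h. (c * (a \<bullet> h)) * cos (a \<bullet> x + (b + pi/2)))) (at x)"
  by (auto intro!: derivative_eq_intros simp: cos_add sin_add algebra_simps)

lemma partial_cos_affine:
  "partial \<alpha> (\<lambda>x. c * cos (a \<bullet> x + b)) = (\<lambda>x. (c * a $ \<alpha>) * cos (a \<bullet> x + (b + pi/2)))"
  by (simp add: fun_eq_iff partial_eq[OF has_derivative_cos_affine] inner_axis)

text \<open>Differentiation acts on the family by a factor and a phase shift of \<open>pi/2\<close>.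
  Hence the induction must range over all \<open>c\<close> and \<open>b\<close>, and sines are
  covered as shifted cosines.\<close>

lemma Ck_cos_affine: "Ck k (\<lambda>x :: real^'n. c * cos (a \<bullet> x + b))"
proof (induction k arbitrary: c b)
  case (Suc k)
  then show ?case
    using has_derivative_cos_affine[of c a b] by (auto simp: partial_cos_affine differentiable_def)
qed (auto intro!: continuous_intros)

lemma wave_eq: "wave Y k b = (\<lambda>x. 1 * cos ((pi *\<^sub>R xi Y k) \<bullet> x + b))"
  by (simp add: wave_def fun_eq_iff)

lemma partial_wave: "partial \<alpha> (wave Y k b) x = pi * xi Y k $ \<alpha> * wave Y k (b + pi/2) x"
  unfolding wave_eq partial_cos_affine by simp

lemma continuous_wave: "continuous_on UNIV (wave Y k b)"
  unfolding wave_eq by (intro continuous_intros)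

context
  fixes Y :: "real^'n"
  assumes Y_pos: "\<forall>\<alpha>. 0 < Y $ \<alpha>"
begin

lemma xi_shift: "xi Y k \<bullet> (x + (2 * Y $ \<alpha>) *\<^sub>R axis \<alpha> 1) = xi Y k \<bullet> x + 2 * of_int (k $ \<alpha>)"
  using Y_pos[rule_format, of \<alpha>] by (simp add: inner_add_right inner_axis xi_def)

lemma wave_periodic: "cell_periodic Y (wave Y k b)"
proof -
  have "cos (pi * (xi Y k \<bullet> x + 2 * of_int (k $ \<alpha>)) + b) = cos (pi * (xi Y k \<bullet> x) + b)" for x \<alpha>
  proof -
    have "pi * (xi Y k \<bullet> x + 2 * of_int (k $ \<alpha>)) + b = (pi * (xi Y k \<bullet> x) + b) + 2 * pi * of_int (k $ \<alpha>)"
      by (simp add: algebra_simps)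
    moreover have "cos (\<theta> + 2 * pi * of_int n) = cos \<theta>" for \<theta> :: real and n
      by (simp add: cos_add)
    ultimately show ?thesis by (simp only:)
  qed
  then show ?thesis by (simp add: cell_periodic_def wave_def xi_shift)
qed

lemma wave_Cinf_per: "wave Y k b \<in> Cinf_per Y"
proof -
  have "Ck j (wave Y k b)" for j
    unfolding wave_eq by (rule Ck_cos_affine)
  with wave_periodic show ?thesis by (simp add: Cinf_per_def)
qed

lemma continuous_L2_per:
  fixes f :: "real^'n \<Rightarrow> 'b::euclidean_space"
  assumes "continuous_on UNIV f" "cell_periodic Y f"
  shows "f \<in> L2_per Y"
  using assms by (simp add: L2_per_iff[OF Y_pos] continuous_borel_measurable_lebesgue continuous_square_integrable_cell)

text \<open>The product of two smooth periodic functions is periodic, so its derivative integrates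
  to zero and the product rule becomes integration by parts without boundary terms. This admits the
  waves as test functions in \<open>curl_free\<close>.\<close>

lemma Cinf_per_has_weak_gradient:
  assumes v: "v \<in> Cinf_per Y"
  shows "has_weak_gradient Y v (\<lambda>x. \<chi> \<alpha>. partial \<alpha> v x)"
  unfolding has_weak_gradient_def
proof (intro conjI ballI allI)
  have C1: "f differentiable at x" "continuous_on UNIV (partial \<alpha> f)" "continuous_on UNIV f"
    "cell_periodic Y f" if "f \<in> Cinf_per Y" for f \<alpha> x
  proof -
    have *: "Ck 0 f" "Ck (Suc 0) f" "cell_periodic Y f" using that by (auto simp: Cinf_per_def)
    then show "f differentiable at x" "continuous_on UNIV (partial \<alpha> f)" "continuous_on UNIV f"
      "cell_periodic Y f" by auto
  qed
  show "v \<in> L2_per Y" using C1[OF v] by (intro continuous_L2_per)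
  show "(\<lambda>x. \<chi> \<alpha>. partial \<alpha> v x) \<in> L2_per Y"
    using partial_periodic[OF C1(1)[OF v] C1(4)[OF v]] C1[OF v]
    by (intro continuous_L2_per continuous_on_vec_lambda) (auto simp: cell_periodic_def)
  fix \<phi> \<alpha> assume \<phi>: "\<phi> \<in> Cinf_per Y"
  have p: "partial \<alpha> (\<lambda>x. v x * \<phi> x) = (\<lambda>x. v x * partial \<alpha> \<phi> x + partial \<alpha> v x * \<phi> x)"
  proof
    fix x
    have "(v has_derivative frechet_derivative v (at x)) (at x)" "(\<phi> has_derivative frechet_derivative \<phi> (at x)) (at x)"
      using C1(1)[OF v] C1(1)[OF \<phi>] frechet_derivative_works by blast+
    from partial_eq[OF has_derivative_mult[OF this]]
    show "partial \<alpha> (\<lambda>x. v x * \<phi> x) x = v x * partial \<alpha> \<phi> x + partial \<alpha> v x * \<phi> x"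
      by (simp add: partial_def)
  qed
  have "(LINT x|cell_measure Y. partial \<alpha> (\<lambda>x. v x * \<phi> x) x) = 0"
  proof (rule integral_partial_eq_0[OF Y_pos])
    show "(\<lambda>x. v x * \<phi> x) differentiable at x" for x
      using C1(1)[OF v] C1(1)[OF \<phi>] by (rule differentiable_mult)
    show "continuous_on UNIV (partial \<alpha> (\<lambda>x. v x * \<phi> x))"
      unfolding p by (intro continuous_intros C1[OF v] C1[OF \<phi>])
    show "cell_periodic Y (\<lambda>x. v x * \<phi> x)"
      using C1(4)[OF v] C1(4)[OF \<phi>] by (auto simp: cell_periodic_def)
  qed
  then have "(LINT x|cell_measure Y. v x * partial \<alpha> \<phi> x + partial \<alpha> v x * \<phi> x) = 0" unfolding p .
  moreover have "integrable (cell_measure Y) (\<lambda>x. v x * partial \<alpha> \<phi> x)"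
    "integrable (cell_measure Y) (\<lambda>x. partial \<alpha> v x * \<phi> x)"
    by (intro continuous_integrable_cell continuous_intros C1[OF v] C1[OF \<phi>])+
  ultimately have "(LINT x|cell_measure Y. v x * partial \<alpha> \<phi> x) + (LINT x|cell_measure Y. partial \<alpha> v x * \<phi> x) = 0"
    by simp
  then show "(LINT x:cell Y|lebesgue. v x * partial \<alpha> \<phi> x) =
        - (LINT x:cell Y|lebesgue. (\<chi> \<alpha>. partial \<alpha> v x) $ \<alpha> * \<phi> x)"
    unfolding set_integral_cell vec_lambda_beta by simp
qed

lemma L2_per_component:
  assumes "u \<in> L2_per Y"
  shows "(\<lambda>x. u x $ \<alpha>) \<in> L2_per Y"
proof -
  have "(\<lambda>x. u x $ \<alpha>) \<in> borel_measurable lebesgue"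
    using assms unfolding L2_per_iff[OF Y_pos]
    by (intro measurable_compose[OF _ borel_measurable_continuous_onI[OF linear_continuous_on[OF bounded_linear_vec_nth]]]) simp
  then show ?thesis
    using assms square_integrable_bounded_linear[OF bounded_linear_vec_nth, of "cell_measure Y" u \<alpha>]
    by (auto simp: L2_per_iff[OF Y_pos] cell_periodic_def)
qed

lemma integrable_mult_wave:
  assumes "u \<in> L2_per Y"
  shows "integrable (cell_measure Y) (\<lambda>x. u x * wave Y k b x)"
  using square_integrable_inner[OF _ continuous_square_integrable_cell[OF continuous_wave, of Y Y k b], of u] assms
  by (simp add: L2_per_iff[OF Y_pos])

lemma curl_free_wave:
  assumes u: "u \<in> L2_per Y" and curl: "curl_free Y u"
  shows "xi Y k $ \<beta> * (LINT x|cell_measure Y. u x $ \<alpha> * wave Y k b x)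
      = xi Y k $ \<alpha> * (LINT x|cell_measure Y. u x $ \<beta> * wave Y k b x)"
proof -
  note i = integrable_mult_wave[OF L2_per_component[OF u], of _ k b]
  \<comment> \<open>The test wave has phase \<open>b - pi/2\<close> because differentiation adds
    \<open>pi/2\<close>.\<close>
  have "(LINT x|cell_measure Y. u x $ \<alpha> * (pi * xi Y k $ \<beta> * wave Y k b x) - u x $ \<beta> * (pi * xi Y k $ \<alpha> * wave Y k b x)) = 0"
    using curl[unfolded curl_free_def, rule_format, OF Cinf_per_has_weak_gradient[OF wave_Cinf_per[of k "b - pi/2"]], of \<alpha> \<beta>]
    unfolding set_integral_cell partial_wave by simp
  then have "(LINT x|cell_measure Y. pi * (xi Y k $ \<beta> * (u x $ \<alpha> * wave Y k b x)) - pi * (xi Y k $ \<alpha> * (u x $ \<beta> * wave Y k b x))) = 0"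
    by (simp add: mult_ac)
  then have "pi * (xi Y k $ \<beta> * (LINT x|cell_measure Y. u x $ \<alpha> * wave Y k b x))
      - pi * (xi Y k $ \<alpha> * (LINT x|cell_measure Y. u x $ \<beta> * wave Y k b x)) = 0"
    using i[of \<alpha>] i[of \<beta>] by (subst (asm) Bochner_Integration.integral_diff) auto
  then show ?thesis by simp
qed

text \<open>Here the wave is the smooth test function in the definition of a weak gradient:
  component \<alpha> of \<open>g\<close> yields \<open>xi Y k $ \<alpha>\<close> times an integral
  that does not depend on \<alpha>. The relation agrees with \<open>curl_free_wave\<close>, so
  curl-free fields and gradients share one Fourier argument.\<close>

lemma weak_gradient_wave:
  assumes "has_weak_gradient Y v g"
  shows "xi Y k $ \<beta> * (LINT x|cell_measure Y. g x $ \<alpha> * wave Y k b x)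
      = xi Y k $ \<alpha> * (LINT x|cell_measure Y. g x $ \<beta> * wave Y k b x)"
proof -
  have "(LINT x|cell_measure Y. g x $ \<alpha> * wave Y k b x)
      = - (pi * xi Y k $ \<alpha> * (LINT x|cell_measure Y. v x * wave Y k (b + pi/2) x))" for \<alpha>
  proof -
    have "(LINT x|cell_measure Y. v x * (pi * xi Y k $ \<alpha> * wave Y k (b + pi/2) x))
        = - (LINT x|cell_measure Y. g x $ \<alpha> * wave Y k b x)"
      using assms wave_Cinf_per[of k b] unfolding has_weak_gradient_def set_integral_cell
      by (auto simp flip: partial_wave)
    moreover have "(LINT x|cell_measure Y. v x * (pi * xi Y k $ \<alpha> * wave Y k (b + pi/2) x))
        = pi * xi Y k $ \<alpha> * (LINT x|cell_measure Y. v x * wave Y k (b + pi/2) x)"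
      by (simp add: mult.left_commute[of "v _"] flip: integral_mult_right_zero)
    ultimately show ?thesis by simp
  qed
  then show ?thesis by simp
qed

end

section \<open>Trigonometric polynomials and uniqueness of Fourier coefficients\<close>

lemma xi_zero [simp]: "xi Y 0 = 0"
  by (simp add: xi_def vec_eq_iff)

lemma xi_add: "xi Y (k + l) = xi Y k + xi Y l"
  by (simp add: xi_def vec_eq_iff add_divide_distrib)

lemma xi_uminus: "xi Y (- k) = - xi Y k"
  by (simp add: xi_def vec_eq_iff)

lemma fourier_char_cis: "fourier_char Y k x = cis (pi * (xi Y k \<bullet> x))"
  by (simp add: fourier_char_def cis_conv_exp)

lemma fourier_char_0 [simp]: "fourier_char Y 0 x = 1"
  by (simp add: fourier_char_cis)

lemma fourier_char_add: "fourier_char Y (k + l) x = fourier_char Y k x * fourier_char Y l x"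
  by (simp add: fourier_char_cis xi_add inner_add_left distrib_left cis_mult)

lemma fourier_char_shift: "fourier_char Y k (x + y) = fourier_char Y k x * fourier_char Y k y"
  by (simp add: fourier_char_cis inner_add_right distrib_left cis_mult)

lemma fourier_char_uminus: "fourier_char Y (- k) x = cnj (fourier_char Y k x)"
  by (simp add: fourier_char_cis xi_uminus cis_cnj)

lemma continuous_fourier_char: "continuous_on UNIV (fourier_char Y k)"
  unfolding fourier_char_def[abs_def] by (intro continuous_intros)

lemma fourier_char_wave:
  "fourier_char Y k x = Complex (wave Y k 0 x) (wave Y k (- pi / 2) x)"
  by (simp add: fourier_char_cis wave_def complex_eq_iff cos_add cos_diff)

text \<open>Generated by closure rules rather than written as sums: a property linear in the
  function, such as the vanishing of an integral against \<open>h\<close>, needs one check per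
  rule.\<close>

inductive_set trig_polys :: "real^'n \<Rightarrow> (real^'n \<Rightarrow> complex) set" for Y where
  char: "fourier_char Y k \<in> trig_polys Y"
| scale: "f \<in> trig_polys Y \<Longrightarrow> (\<lambda>x. c * f x) \<in> trig_polys Y"
| add: "f \<in> trig_polys Y \<Longrightarrow> g \<in> trig_polys Y \<Longrightarrow> (\<lambda>x. f x + g x) \<in> trig_polys Y"

lemma trig_polys_const: "(\<lambda>x. c) \<in> trig_polys Y"
  using trig_polys.scale[OF trig_polys.char[of Y 0], of c] by simp

lemma trig_polys_sum:
  "(\<And>i. i \<in> I \<Longrightarrow> f i \<in> trig_polys Y) \<Longrightarrow> (\<lambda>x. \<Sum>i\<in>I. f i x) \<in> trig_polys Y"
  by (induction I rule: infinite_finite_induct) (auto intro: trig_polys_const trig_polys.add)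

lemma trig_polys_mult:
  assumes "f \<in> trig_polys Y" "g \<in> trig_polys Y"
  shows "(\<lambda>x. f x * g x) \<in> trig_polys Y"
  using assms
proof (induction f rule: trig_polys.induct)
  case (char k)
  from char show ?case
  proof (induction g rule: trig_polys.induct)
    case (char l)
    have "fourier_char Y (k + l) = (\<lambda>x. fourier_char Y k x * fourier_char Y l x)"
      by (simp add: fun_eq_iff fourier_char_add)
    then show ?case using trig_polys.char[of Y "k + l"] by simp
  next
    case (scale f c)
    then show ?case using trig_polys.scale[of "\<lambda>x. fourier_char Y k x * f x" Y c] by (simp add: mult_ac)
  next
    case (add f g)
    then show ?case using trig_polys.add[of "\<lambda>x. fourier_char Y k x * f x" Y "\<lambda>x. fourier_char Y k x * g x"]
      by (simp add: distrib_left)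
  qed
next
  case (scale f c)
  then show ?case using trig_polys.scale[of "\<lambda>x. f x * g x" Y c] by (simp add: mult_ac)
next
  case (add f f')
  then show ?case using trig_polys.add[of "\<lambda>x. f x * g x" Y "\<lambda>x. f' x * g x"]
    by (simp add: distrib_right)
qed

lemma trig_polys_continuous: "f \<in> trig_polys Y \<Longrightarrow> continuous_on UNIV f"
  by (induction rule: trig_polys.induct) (auto intro!: continuous_intros continuous_fourier_char)

section \<open>The torus embedding and the completeness of the exponentials\<close>

definition torus_map :: "real^'n \<Rightarrow> real^'n \<Rightarrow> complex^'n" where
  "torus_map Y x = (\<chi> \<alpha>. fourier_char Y (axis \<alpha> 1) x)"

lemma continuous_torus_map: "continuous_on UNIV (torus_map Y)"
  unfolding torus_map_def[abs_def] by (intro continuous_on_vec_lambda continuous_fourier_char)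

lemma complex_vec_real_decomposition:
  fixes z :: "complex^'n"
  shows "z = (\<Sum>\<alpha>\<in>UNIV. Re (z $ \<alpha>) *\<^sub>R axis \<alpha> 1 + Im (z $ \<alpha>) *\<^sub>R axis \<alpha> \<i>)"
proof -
  have "(\<Sum>\<alpha>\<in>UNIV. Re (z $ \<alpha>) *\<^sub>R axis \<alpha> 1 + Im (z $ \<alpha>) *\<^sub>R axis \<alpha> \<i>) $ \<beta> = z $ \<beta>" for \<beta>
  proof -
    have "(\<Sum>\<alpha>\<in>UNIV. Re (z $ \<alpha>) *\<^sub>R axis \<alpha> 1 + Im (z $ \<alpha>) *\<^sub>R axis \<alpha> \<i>) $ \<beta>
        = (\<Sum>\<alpha>\<in>UNIV. if \<alpha> = \<beta> then Re (z $ \<beta>) *\<^sub>R 1 + Im (z $ \<beta>) *\<^sub>R \<i> else 0)"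
      unfolding sum_component by (intro sum.cong) (auto simp: axis_def)
    also have "\<dots> = z $ \<beta>" by (simp add: complex_eq_iff)
    finally show ?thesis .
  qed
  then show ?thesis by (simp add: vec_eq_iff)
qed

text \<open>A real-linear function of a complex coordinate is a combination of the coordinate and
  its conjugate, and conjugating a character negates its frequency. Closure under products extends
  this from linear functions to polynomials.\<close>

lemma trig_polys_real_polynomial:
  assumes "real_polynomial_function p"
  shows "(\<lambda>x. complex_of_real (p (torus_map Y x))) \<in> trig_polys Y"
  using assms
proof (induction p rule: real_polynomial_function.induct)
  case (linear f)
  then have f: "linear f" by (rule bounded_linear.linear)
  have fz: "f z = (\<Sum>\<alpha>\<in>UNIV. Re (z $ \<alpha>) * f (axis \<alpha> 1) + Im (z $ \<alpha>) * f (axis \<alpha> \<i>))" for z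
    by (subst complex_vec_real_decomposition[of z])
      (simp add: linear_sum[OF f] linear_add[OF f] linear_scale[OF f])
  \<comment> \<open>The difference is written as a sum with factor - 1 so that it fits the rules of
    \<open>trig_polys\<close>.\<close>
  have re: "complex_of_real (Re z * a + Im z * b)
      = (of_real a / 2) * (z + cnj z) + (of_real b * (- \<i> / 2)) * (z + (- 1) * cnj z)" for z a b
    by (simp add: complex_eq_iff)
  have eq: "complex_of_real (f (torus_map Y x)) = (\<Sum>\<alpha>\<in>UNIV.
      (of_real (f (axis \<alpha> 1)) / 2) * (fourier_char Y (axis \<alpha> 1) x + fourier_char Y (- axis \<alpha> 1) x)
      + (of_real (f (axis \<alpha> \<i>)) * (- \<i> / 2)) * (fourier_char Y (axis \<alpha> 1) x + (- 1) * fourier_char Y (- axis \<alpha> 1) x))" for x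
    unfolding fz[of "torus_map Y x"] of_real_sum re fourier_char_uminus by (simp only: torus_map_def vec_lambda_beta)
  show ?case
    unfolding eq by (intro trig_polys_sum trig_polys.intros)
next
  case (const c)
  show ?case by (rule trig_polys_const)
next
  case (add f g)
  then show ?case using trig_polys.add by fastforce
next
  case (mult f g)
  then show ?case using trig_polys_mult by fastforce
qed

lemma integrable_mult_continuous:
  fixes h :: "real^'n \<Rightarrow> real" and f :: "real^'n \<Rightarrow> complex"
  assumes h: "integrable (cell_measure Y) h" and f: "continuous_on UNIV f"
  shows "integrable (cell_measure Y) (\<lambda>x. of_real (h x) * f x)"
proof -
  have "compact (f ` cell Y)"
    by (rule compact_continuous_image[OF continuous_on_subset[OF f] compact_cell]) simp
  from compact_imp_bounded[OF this] obtain B where B: "\<And>x. x \<in> cell Y \<Longrightarrow> norm (f x) \<le> B"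
    by (auto simp: bounded_iff)
  have "f \<in> borel_measurable (cell_measure Y)"
    by (intro measurable_on_cell continuous_borel_measurable_lebesgue f)
  then have m: "(\<lambda>x. of_real (h x) * f x) \<in> borel_measurable (cell_measure Y)"
    using h by measurable
  have "AE x in cell_measure Y. norm (of_real (h x) * f x) \<le> norm (B * h x)"
    unfolding AE_cell
  proof (intro AE_I2 impI)
    fix x assume "x \<in> cell Y"
    then have "cmod (f x) \<le> \<bar>B\<bar>" using B by (meson abs_ge_self order_trans)
    then have "\<bar>h x\<bar> * cmod (f x) \<le> \<bar>h x\<bar> * \<bar>B\<bar>" by (rule mult_left_mono) simp
    then show "norm (of_real (h x) * f x) \<le> norm (B * h x)" by (simp add: norm_mult abs_mult mult.commute)
  qed
  moreover have "integrable (cell_measure Y) (\<lambda>x. B * h x)" using h by simp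
  ultimately show ?thesis using m by (blast intro: Bochner_Integration.integrable_bound)
qed

text \<open>Strictly inside the cell the phase of each coordinate lies between - pi and pi, where
  \<open>Arg\<close> recovers it; on the faces, opposite points have the same image.\<close>

lemma torus_map_inj:
  assumes Y_pos: "\<forall>\<alpha>. 0 < Y $ \<alpha>" and x: "x \<in> box (- Y) Y" and y: "y \<in> box (- Y) Y"
    and eq: "torus_map Y x = torus_map Y y"
  shows "x = y"
proof -
  have "x $ \<alpha> = y $ \<alpha>" for \<alpha>
  proof -
    have Ya: "0 < Y $ \<alpha>" using Y_pos by simp
    have xi: "xi Y (axis \<alpha> 1) \<bullet> z = z $ \<alpha> / Y $ \<alpha>" for z
    proof -
      have "xi Y (axis \<alpha> 1) = axis \<alpha> (1 / Y $ \<alpha>)" by (simp add: xi_def vec_eq_iff axis_def)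
      then show ?thesis by (simp add: inner_axis')
    qed
    have arg: "Arg (fourier_char Y (axis \<alpha> 1) z) = pi * (z $ \<alpha> / Y $ \<alpha>)" if "z \<in> box (- Y) Y" for z
    proof -
      have "- Y $ \<alpha> < z $ \<alpha>" "z $ \<alpha> < Y $ \<alpha>" using that by (auto simp: mem_box_cart)
      then have "- 1 < z $ \<alpha> / Y $ \<alpha>" "z $ \<alpha> / Y $ \<alpha> < 1" using Ya by (auto simp: field_simps)
      then have "pi * - 1 < pi * (z $ \<alpha> / Y $ \<alpha>)" "pi * (z $ \<alpha> / Y $ \<alpha>) < pi * 1"
        by (intro mult_strict_left_mono; simp)+
      then show ?thesis
        by (intro cis_Arg_unique) (auto simp: fourier_char_cis xi sgn_eq)
    qed
    have "fourier_char Y (axis \<alpha> 1) x = fourier_char Y (axis \<alpha> 1) y"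
      using arg_cong[OF eq, of "\<lambda>v. v $ \<alpha>"] by (simp add: torus_map_def)
    then have "pi * (x $ \<alpha> / Y $ \<alpha>) = pi * (y $ \<alpha> / Y $ \<alpha>)"
      using arg[OF x] arg[OF y] by metis
    then show ?thesis using Ya by auto
  qed
  then show ?thesis by (simp add: vec_eq_iff)
qed

text \<open>By inner regularity \<open>S\<close> is exhausted, up to measure e, by a closed subset.
  Being bounded it is compact, and a positive function with zero integral over it forces it to be
  null.\<close>

lemma negligible_of_integral_zero:
  fixes h :: "'a::euclidean_space \<Rightarrow> real"
  assumes S: "S \<in> sets lebesgue" "bounded S" and pos: "\<And>x. x \<in> S \<Longrightarrow> 0 < h x"
    and int: "\<And>K. compact K \<Longrightarrow> K \<subseteq> S \<Longrightarrow> integrable lebesgue (\<lambda>x. indicator K x * h x)"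
    and zero: "\<And>K. compact K \<Longrightarrow> K \<subseteq> S \<Longrightarrow> (LINT x|lebesgue. indicator K x * h x) = 0"
  shows "negligible S"
proof -
  have "\<exists>T. S \<subseteq> T \<and> T \<in> lmeasurable \<and> measure lebesgue T < e" if e: "e > 0" for e
  proof -
    obtain T where T: "closed T" "T \<subseteq> S" "S - T \<in> lmeasurable" "measure lebesgue (S - T) < e"
      using sets_lebesgue_inner_closed[OF S(1) e] by (metis emeasure_eq_measure2 ennreal_leI not_le)
    have K: "compact T" using T S(2) by (meson bounded_subset compact_eq_bounded_closed)
    have "AE x in lebesgue. indicator T x * h x = 0"
      using zero[OF K T(2)] int[OF K T(2)] pos T(2)
      by (subst (asm) integral_nonneg_eq_0_iff_AE) (auto simp: indicator_def intro!: AE_I2 less_imp_le)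
    moreover have "indicator T x * h x = 0 \<longleftrightarrow> x \<notin> T" for x
      using pos T(2) by (force simp: indicator_def)
    ultimately have "AE x in lebesgue. x \<notin> T" by simp
    then have "negligible T"
      unfolding completion.AE_iff_null_sets negligible_iff_null_sets by simp
    then have T0: "T \<in> lmeasurable" "measure lebesgue T = 0"
      using negligible_imp_measurable negligible_imp_measure0 by auto
    have "measure lebesgue ((S - T) \<union> T) \<le> measure lebesgue (S - T) + measure lebesgue T"
      using T(3) T0(1) by (intro measure_Un_le) auto
    then show ?thesis
      using T T0 fmeasurable.Un[OF T(3) T0(1)] by (intro exI[of _ "(S - T) \<union> T"]) auto
  qed
  then show ?thesis by (simp add: negligible_outer)
qed

context
  fixes Y :: "real^'n" and h :: "real^'n \<Rightarrow> real"
  assumes Y_pos: "\<forall>\<alpha>. 0 < Y $ \<alpha>"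
    and h: "h \<in> borel_measurable lebesgue" "integrable (cell_measure Y) h"
    and coeffs: "\<And>k. (LINT x|cell_measure Y. of_real (h x) * fourier_char Y k x) = 0"
begin

lemma integral_trig_poly_zero:
  assumes "f \<in> trig_polys Y"
  shows "(LINT x|cell_measure Y. of_real (h x) * f x) = 0"
  using assms
proof (induction f rule: trig_polys.induct)
  case (char k)
  then show ?case by (rule coeffs)
next
  case (scale f c)
  have "(LINT x|cell_measure Y. of_real (h x) * (c * f x)) = c * (LINT x|cell_measure Y. of_real (h x) * f x)"
    by (simp add: mult.left_commute[of _ c])
  with scale show ?case by simp
next
  case (add f g)
  then show ?case
    using integrable_mult_continuous[OF h(2) trig_polys_continuous] by (simp add: distrib_left)
qed

text \<open>On the compact image of the cell, \<open>F\<close> is within e of a polynomial, whose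
  integral against \<open>h\<close> vanishes; the error is at most e times the integral of the
  absolute value of \<open>h\<close>, and e is arbitrary.\<close>

lemma integral_torus_continuous_zero:
  fixes F :: "complex^'n \<Rightarrow> real"
  assumes F: "continuous_on UNIV F"
  shows "(LINT x|cell_measure Y. h x * F (torus_map Y x)) = 0"
proof -
  let ?T = "torus_map Y"
  have TC: "compact (?T ` cell Y)"
    by (rule compact_continuous_image[OF continuous_on_subset[OF continuous_torus_map] compact_cell]) simp
  have cF: "integrable (cell_measure Y) (\<lambda>x. h x * G (?T x))" if "continuous_on UNIV G" for G
  proof -
    have "integrable (cell_measure Y) (\<lambda>x. of_real (h x) * complex_of_real (G (?T x)))"
      by (intro integrable_mult_continuous h continuous_intros
          continuous_on_compose2[OF that continuous_torus_map]) auto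
    then have "integrable (cell_measure Y) (\<lambda>x. complex_of_real (h x * G (?T x)))" by simp
    then show ?thesis unfolding complex_of_real_integrable_eq .
  qed
  have "\<bar>LINT x|cell_measure Y. h x * F (?T x)\<bar> \<le> e * (LINT x|cell_measure Y. \<bar>h x\<bar>)" if e: "e > 0" for e
  proof -
    obtain p where p: "real_polynomial_function p" and pe: "\<And>z. z \<in> ?T ` cell Y \<Longrightarrow> \<bar>F z - p z\<bar> < e"
      using Stone_Weierstrass_real_polynomial_function[OF TC continuous_on_subset[OF F] e] by auto
    have cp: "continuous_on UNIV p"
      using continuous_real_polymonial_function[OF p] by (simp add: continuous_at_imp_continuous_on)
    have "complex_of_real (LINT x|cell_measure Y. h x * p (?T x)) = 0"
      using integral_trig_poly_zero[OF trig_polys_real_polynomial[OF p]]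
      by (simp flip: of_real_mult)
    then have "(LINT x|cell_measure Y. h x * F (?T x)) = (LINT x|cell_measure Y. h x * (F (?T x) - p (?T x)))"
      using cF[OF F] cF[OF cp] by (simp add: right_diff_distrib)
    also have "\<bar>\<dots>\<bar> \<le> (LINT x|cell_measure Y. e * \<bar>h x\<bar>)"
    proof (rule order_trans[OF integral_abs_bound], rule integral_mono_AE)
      show "integrable (cell_measure Y) (\<lambda>x. \<bar>h x * (F (?T x) - p (?T x))\<bar>)"
        using cF[OF continuous_on_diff[OF F cp]] by (rule integrable_abs)
      show "integrable (cell_measure Y) (\<lambda>x. e * \<bar>h x\<bar>)" using h(2) by simp
      show "AE x in cell_measure Y. \<bar>h x * (F (?T x) - p (?T x))\<bar> \<le> e * \<bar>h x\<bar>"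
        unfolding AE_cell
      proof (intro AE_I2 impI)
        fix x assume "x \<in> cell Y"
        then have "\<bar>F (?T x) - p (?T x)\<bar> \<le> e" using pe less_imp_le by blast
        then have "\<bar>h x\<bar> * \<bar>F (?T x) - p (?T x)\<bar> \<le> \<bar>h x\<bar> * e" by (rule mult_left_mono) simp
        then show "\<bar>h x * (F (?T x) - p (?T x))\<bar> \<le> e * \<bar>h x\<bar>" by (simp add: abs_mult mult.commute)
      qed
    qed
    finally show ?thesis by simp
  qed
  then have "\<bar>LINT x|cell_measure Y. h x * F (?T x)\<bar> \<le> 0 * (LINT x|cell_measure Y. \<bar>h x\<bar>)"
    by (intro tendsto_lowerbound[where F="at_right 0" and f="\<lambda>e. e * (LINT x|cell_measure Y. \<bar>h x\<bar>)"] tendsto_intros)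
      (auto simp: eventually_at_right_less intro: eventually_at_rightI[of 0 1])
  then show ?thesis by simp
qed

text \<open>Continuous cut-off functions of the distance to the image of \<open>K\<close> decrease
  to its indicator, so dominated convergence carries over the vanishing integrals. Injectivity on
  the open cell makes the preimage of that image equal to \<open>K\<close> up to the null
  faces.\<close>

lemma integral_compact_zero:
  assumes K: "compact K" "K \<subseteq> box (- Y) Y"
  shows "integrable lebesgue (\<lambda>x. indicator K x * h x)"
    and "(LINT x|lebesgue. indicator K x * h x) = 0"
proof -
  let ?T = "torus_map Y"
  have Ks: "K \<in> sets lebesgue" using K(1) by (simp add: lmeasurable_compact fmeasurableD)
  have boxc: "box (- Y) Y \<subseteq> cell Y" by (simp add: cell_def box_subset_cbox)
  show i: "integrable lebesgue (\<lambda>x. indicator K x * h x)"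
    using set_integrable_subset[of lebesgue "cell Y" h K] h(2) Ks subset_trans[OF K(2) boxc]
    by (simp add: set_integrable_cell) (simp add: set_integrable_def)
  show "(LINT x|lebesgue. indicator K x * h x) = 0"
  \<comment> \<open>\<open>infdist\<close> to the empty set is 0 by convention, so the cut-off
    functions separate points from the image only for nonempty \<open>K\<close>.\<close>
  proof (cases "K = {}")
    case False
    define C where "C = ?T ` K"
    have C: "closed C" "C \<noteq> {}"
      unfolding C_def using False
      by (auto intro!: compact_imp_closed compact_continuous_image K(1) continuous_on_subset[OF continuous_torus_map])
    define F where "F n z = max 0 (1 - real n * infdist z C)" for n z
    have Fc: "continuous_on UNIV (F n)" for n
      unfolding F_def[abs_def] by (intro continuous_intros)
    have Flim: "(\<lambda>n. F n z) \<longlonglongrightarrow> indicator C z" for z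
    proof (cases "z \<in> C")
      case True
      then show ?thesis by (simp add: F_def)
    next
      case False
      then have pos: "infdist z C > 0"
        using C by (simp add: infdist_pos_not_in_closed)
      obtain N :: nat where N: "1 / infdist z C < real N" using reals_Archimedean2 by blast
      have "F n z = 0" if "n \<ge> N" for n
      proof -
        have "1 / infdist z C < real n" using N that by simp
        then have "1 < real n * infdist z C" using pos by (simp add: field_simps)
        then show ?thesis by (simp add: F_def)
      qed
      then have "\<forall>\<^sub>F n in sequentially. F n z = 0" by (auto simp: eventually_sequentially)
      with False show ?thesis by (simp add: tendsto_eventually)
    qed
    have Tm: "?T \<in> borel_measurable lebesgue"
      by (intro continuous_borel_measurable_lebesgue continuous_torus_map)
    have m: "(\<lambda>x. h x * indicator C (?T x)) \<in> borel_measurable (cell_measure Y)"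
    proof (rule measurable_on_cell)
      have "indicator C \<in> borel_measurable borel" using C by simp
      from measurable_compose[OF Tm this]
      show "(\<lambda>x. h x * indicator C (?T x)) \<in> borel_measurable lebesgue" using h by measurable
    qed
    have "(\<lambda>n. LINT x|cell_measure Y. h x * F n (?T x)) \<longlonglongrightarrow> (LINT x|cell_measure Y. h x * indicator C (?T x))"
    proof (rule integral_dominated_convergence[OF m])
      have "(\<lambda>x. F n (?T x)) \<in> borel_measurable lebesgue" for n
        by (rule measurable_compose[OF Tm borel_measurable_continuous_onI[OF Fc]])
      then show "(\<lambda>x. h x * F n (?T x)) \<in> borel_measurable (cell_measure Y)" for n
        using h(1) by (intro measurable_on_cell) measurable
      show "integrable (cell_measure Y) (\<lambda>x. \<bar>h x\<bar>)" using h(2) by simp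
      show "AE x in cell_measure Y. (\<lambda>n. h x * F n (?T x)) \<longlonglongrightarrow> h x * indicator C (?T x)"
        by (intro AE_I2 tendsto_mult tendsto_const Flim)
      have "\<bar>F n z\<bar> \<le> 1" for n z by (auto simp: F_def infdist_nonneg)
      then show "AE x in cell_measure Y. norm (h x * F n (?T x)) \<le> \<bar>h x\<bar>" for n
        by (intro AE_I2) (auto simp: abs_mult mult_left_le)
    qed
    then have "(LINT x|cell_measure Y. h x * indicator C (?T x)) = 0"
      by (simp add: integral_torus_continuous_zero[OF Fc] LIMSEQ_const_iff)
    also have "(LINT x|cell_measure Y. h x * indicator C (?T x)) = (LINT x|cell_measure Y. indicator K x * h x)"
    proof (rule integral_cong_AE[OF m])
      show "(\<lambda>x. indicator K x * h x) \<in> borel_measurable (cell_measure Y)"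
        using h(1) borel_measurable_indicator[OF Ks, where 'b=real] by (intro measurable_on_cell) (rule borel_measurable_times)
      have "negligible (cbox (- Y) Y - box (- Y) Y)" by (rule negligible_frontier_interval)
      then have "AE x in lebesgue. x \<notin> cbox (- Y) Y - box (- Y) Y"
        unfolding negligible_iff_null_sets by (rule AE_not_in)
      then show "AE x in cell_measure Y. h x * indicator C (?T x) = indicator K x * h x"
        unfolding AE_cell
      proof eventually_elim
        case (elim x)
        show ?case
        proof
          assume "x \<in> cell Y"
          with elim have x: "x \<in> box (- Y) Y" by (auto simp: cell_def)
          have "?T x \<in> C \<longleftrightarrow> x \<in> K"
            unfolding C_def using torus_map_inj[OF Y_pos x] K(2) by (auto 0 3)
          then show "h x * indicator C (?T x) = indicator K x * h x" by (simp add: indicator_def)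
        qed
      qed
    qed
    also have "\<dots> = (LINT x|lebesgue. indicator K x * h x)"
    proof -
      have "(\<lambda>x. indicator (cell Y) x *\<^sub>R (indicator K x * h x)) = (\<lambda>x. indicator K x * h x)"
        using K(2) boxc by (auto simp: fun_eq_iff indicator_def)
      moreover have "(LINT x|cell_measure Y. indicator K x * h x)
          = (LINT x|lebesgue. indicator (cell Y) x *\<^sub>R (indicator K x * h x))"
        by (rule integral_restrict_space) simp
      ultimately show ?thesis by (simp only:)
    qed
    finally show ?thesis .
  qed simp
qed

end

text \<open>The hypotheses are symmetric under \<open>h\<close> and \<open>- h\<close>, so the sets
  where either is positive are both null; the faces of the cell are null as well.\<close>

lemma fourier_uniqueness:
  fixes Y :: "real^'n" and h :: "real^'n \<Rightarrow> real"
  assumes Y_pos: "\<forall>\<alpha>. 0 < Y $ \<alpha>"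
    and h: "h \<in> borel_measurable lebesgue" "integrable (cell_measure Y) h"
    and coeffs: "\<And>k. (LINT x|cell_measure Y. of_real (h x) * fourier_char Y k x) = 0"
  shows "AE x in cell_measure Y. h x = 0"
proof -
  have neg: "negligible {x \<in> box (- Y) Y. 0 < f x}"
    if f: "f \<in> borel_measurable lebesgue" "integrable (cell_measure Y) f"
      and c: "\<And>k. (LINT x|cell_measure Y. of_real (f x) * fourier_char Y k x) = 0" for f
  proof (rule negligible_of_integral_zero)
    have "{x \<in> space lebesgue. 0 < f x} \<in> sets lebesgue" using f(1) by measurable
    moreover have "box (- Y) Y \<in> sets lebesgue" by simp
    ultimately show "{x \<in> box (- Y) Y. 0 < f x} \<in> sets lebesgue"
      unfolding Collect_conj_eq Collect_mem_eq by (intro sets.Int) auto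
    show "bounded {x \<in> box (- Y) Y. 0 < f x}"
      by (rule bounded_subset[OF bounded_box[of "- Y" Y]]) auto
  qed (auto intro: integral_compact_zero[OF Y_pos f c])
  have c': "(LINT x|cell_measure Y. of_real (- h x) * fourier_char Y k x) = 0" for k
    using coeffs[of k] by simp
  have "negligible ({x \<in> box (- Y) Y. 0 < h x} \<union> {x \<in> box (- Y) Y. 0 < - h x} \<union> (cbox (- Y) Y - box (- Y) Y))"
    by (intro negligible_Un negligible_frontier_interval neg) (use h coeffs c' in auto)
  then have "AE x in lebesgue. x \<notin> {x \<in> box (- Y) Y. 0 < h x} \<union> {x \<in> box (- Y) Y. 0 < - h x} \<union> (cbox (- Y) Y - box (- Y) Y)"
    unfolding negligible_iff_null_sets by (rule AE_not_in)
  then show ?thesis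
    unfolding AE_cell by eventually_elim (force simp: cell_def)
qed

section \<open>Fourier series in the mean-square sense\<close>

lemma L2_inner_eq: "L2_inner Y u v = (LINT x|cell_measure Y. u x \<bullet> v x) / cell_volume Y"
  by (simp add: L2_inner_def set_integral_cell)

lemma L2_inner_commute: "L2_inner Y u v = L2_inner Y v u"
  by (simp add: L2_inner_def inner_commute)

lemma L2_inner_add_left:
  assumes "square_integrable (cell_measure Y) u" "square_integrable (cell_measure Y) v" "square_integrable (cell_measure Y) w"
  shows "L2_inner Y (\<lambda>x. u x + v x) w = L2_inner Y u w + L2_inner Y v w"
  using assms by (simp add: L2_inner_eq inner_add_left square_integrable_inner add_divide_distrib)

lemma L2_inner_scaleR_left: "L2_inner Y (\<lambda>x. c *\<^sub>R u x) w = c * L2_inner Y u w"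
  by (simp add: L2_inner_eq)

lemma L2_inner_diff_left:
  assumes "square_integrable (cell_measure Y) u" "square_integrable (cell_measure Y) v" "square_integrable (cell_measure Y) w"
  shows "L2_inner Y (\<lambda>x. u x - v x) w = L2_inner Y u w - L2_inner Y v w"
  using assms by (simp add: L2_inner_eq inner_diff_left square_integrable_inner diff_divide_distrib)

lemma L2_inner_diff_right:
  assumes "square_integrable (cell_measure Y) u" "square_integrable (cell_measure Y) v" "square_integrable (cell_measure Y) w"
  shows "L2_inner Y w (\<lambda>x. u x - v x) = L2_inner Y w u - L2_inner Y w v"
  using L2_inner_diff_left[OF assms] by (simp add: L2_inner_commute[of Y w])

lemma L2_inner_zero_left [simp]: "L2_inner Y (\<lambda>x. 0) w = 0"
  by (simp add: L2_inner_eq)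

lemma L2_inner_sum_left:
  assumes "\<And>i. i \<in> I \<Longrightarrow> square_integrable (cell_measure Y) (u i)" "square_integrable (cell_measure Y) w"
  shows "L2_inner Y (\<lambda>x. \<Sum>i\<in>I. u i x) w = (\<Sum>i\<in>I. L2_inner Y (u i) w)"
  using assms(1)
proof (induction I rule: infinite_finite_induct)
  case (insert i I)
  then show ?case
    using assms(2) by (simp add: L2_inner_add_left square_integrable_sum)
qed simp_all

lemma L2_inner_cong_AE:
  assumes "square_integrable (cell_measure Y) u" "square_integrable (cell_measure Y) u'" "square_integrable (cell_measure Y) w"
    and ae: "AE x in cell_measure Y. u x = u' x"
  shows "L2_inner Y u w = L2_inner Y u' w"
proof -
  have "(LINT x|cell_measure Y. u x \<bullet> w x) = (LINT x|cell_measure Y. u' x \<bullet> w x)"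
    using assms(1-3)[THEN square_integrable_measurable] ae by (intro integral_cong_AE) auto
  then show ?thesis by (simp add: L2_inner_eq)
qed

lemma cell_volume_pos: "\<forall>\<alpha>. 0 < Y $ \<alpha> \<Longrightarrow> 0 < cell_volume Y"
  by (simp add: cell_volume_def prod_pos)

lemma measure_cell:
  assumes "\<forall>\<alpha>. 0 < Y $ \<alpha>"
  shows "measure lebesgue (cell Y) = cell_volume Y"
proof -
  have "cell Y \<noteq> {}" using assms by (auto simp: cell_def interval_eq_empty_cart not_le less_imp_le order_less_imp_le)
      (smt (verit, best) less_imp_le)
  then have "measure lebesgue (cell Y) = (\<Prod>\<alpha>\<in>UNIV. 2 * Y $ \<alpha>)"
    unfolding cell_def by (simp add: content_cbox_cart)
  then show ?thesis by (simp add: cell_volume_def prod.distrib)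
qed

lemma L2_norm_l2_norm:
  assumes "\<forall>\<alpha>. 0 < Y $ \<alpha>"
  shows "L2_norm Y u = l2_norm (cell_measure Y) u / sqrt (cell_volume Y)"
  by (simp add: L2_norm_def L2_inner_eq l2_norm_def power2_norm_eq_inner real_sqrt_divide)

lemma fourier_char_periodic:
  assumes "\<forall>\<alpha>. 0 < Y $ \<alpha>"
  shows "cell_periodic Y (fourier_char Y k)"
  using wave_periodic[OF assms] unfolding cell_periodic_def fourier_char_wave by simp

text \<open>Translation by half a wavelength changes the sign of the character but not its integral
  over the cell.\<close>

lemma integral_fourier_char:
  fixes Y :: "real^'n"
  assumes Y_pos: "\<forall>\<alpha>. 0 < Y $ \<alpha>"
  shows "(LINT x|cell_measure Y. fourier_char Y k x) = (if k = 0 then of_real (cell_volume Y) else 0)"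
proof (cases "k = 0")
  case True
  have "fourier_char Y k = (\<lambda>x. 1)" using True by (simp add: fun_eq_iff)
  then show ?thesis
    using True measure_cell[OF Y_pos] by (simp add: measure_restrict_space scaleR_conv_of_real)
next
  case False
  then obtain \<alpha> where \<alpha>: "k $ \<alpha> \<noteq> 0" by (auto simp: vec_eq_iff)
  \<comment> \<open>Half the wavelength in direction \<alpha>; it is at most
    \<open>Y $ \<alpha>\<close> because a nonzero integer has modulus at least 1.\<close>
  define t where "t = Y $ \<alpha> / \<bar>of_int (k $ \<alpha>)\<bar>"
  have y: "0 < Y $ \<alpha>" using Y_pos by simp
  have k1: "1 \<le> \<bar>real_of_int (k $ \<alpha>)\<bar>" using \<alpha> by linarith
  have t: "0 \<le> t" "t \<le> 2 * Y $ \<alpha>"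
  proof -
    have "t \<le> Y $ \<alpha> / 1" unfolding t_def using y k1 by (intro divide_left_mono) auto
    then show "t \<le> 2 * Y $ \<alpha>" using y by simp
    show "0 \<le> t" using y by (simp add: t_def)
  qed
  have "xi Y k \<bullet> (t *\<^sub>R axis \<alpha> 1) = of_int (k $ \<alpha>) / \<bar>of_int (k $ \<alpha>)\<bar>"
    using y by (simp add: inner_axis xi_def t_def)
  then have "xi Y k \<bullet> (t *\<^sub>R axis \<alpha> 1) = 1 \<or> xi Y k \<bullet> (t *\<^sub>R axis \<alpha> 1) = - 1"
    using \<alpha> by (cases "k $ \<alpha> > 0") auto
  then have m: "fourier_char Y k (t *\<^sub>R axis \<alpha> 1) = - 1"
    by (auto simp: fourier_char_cis complex_eq_iff)
  have "(LINT x|cell_measure Y. fourier_char Y k (t *\<^sub>R axis \<alpha> 1 + x)) = (LINT x|cell_measure Y. fourier_char Y k x)"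
    using t by (intro integral_cell_shift[OF Y_pos] fourier_char_periodic[OF Y_pos]
        continuous_borel_measurable_lebesgue continuous_fourier_char continuous_integrable_cell)
  then have "- (LINT x|cell_measure Y. fourier_char Y k x) = (LINT x|cell_measure Y. fourier_char Y k x)"
    by (simp add: fourier_char_shift m)
  then show ?thesis using False by simp
qed

section \<open>Real fields inside complex vectors\<close>

lemma cvec_linear: "linear cvec"
  by (intro linearI) (simp_all add: cvec_def vec_eq_iff scaleR_conv_of_real[where 'a=complex])

lemma cvec_bounded_linear: "bounded_linear cvec"
  using cvec_linear by (rule linear_conv_bounded_linear[THEN iffD1])

text \<open>The inner product on complex vectors is the real part of the Hermitian one. With respect
  to it \<open>re_vec\<close> is the adjoint of \<open>cvec\<close>, and multiplication by a complex
  scalar has multiplication by the conjugate as its adjoint.\<close>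

definition re_vec :: "complex^'n \<Rightarrow> real^'n" where
  "re_vec z = (\<chi> \<alpha>. Re (z $ \<alpha>))"

lemma inner_cvec: "z \<bullet> cvec u = re_vec z \<bullet> u"
  by (simp add: inner_vec_def re_vec_def cvec_def inner_complex_def)

lemma re_vec_cvec [simp]: "re_vec (cvec u) = u"
  by (simp add: re_vec_def cvec_def vec_eq_iff)

lemma inner_cvec_cvec [simp]: "cvec u \<bullet> cvec v = u \<bullet> v"
  by (simp add: inner_cvec)

lemma cvec_diff: "cvec (u - v) = cvec u - cvec v"
  by (rule linear_diff[OF cvec_linear])

lemma L2_inner_cvec [simp]: "L2_inner Y (\<lambda>x. cvec (u x)) (\<lambda>x. cvec (v x)) = L2_inner Y u v"
  by (simp add: L2_inner_eq)

lemma L2_norm_cvec [simp]: "L2_norm Y (\<lambda>x. cvec (u x)) = L2_norm Y u"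
  by (simp add: L2_norm_def)

lemma square_integrable_cvec:
  "square_integrable M u \<Longrightarrow> square_integrable M (\<lambda>x. cvec (u x))"
  by (rule square_integrable_bounded_linear[OF cvec_bounded_linear])

lemma continuous_char_smult: "continuous_on UNIV (\<lambda>x. fourier_char Y k x *s a)"
  unfolding vector_scalar_mult_def
  by (intro continuous_on_vec_lambda continuous_intros continuous_fourier_char)

lemma square_integrable_char_smult: "square_integrable (cell_measure Y) (\<lambda>x. fourier_char Y k x *s a)"
  by (intro continuous_square_integrable_cell continuous_char_smult)

lemma inner_smult_complex: "(c *s a) \<bullet> b = a \<bullet> (cnj c *s b)" for a b :: "complex^'n"
  by (simp add: inner_vec_def inner_complex_def algebra_simps)

lemma smult_smult: "c *s (d *s a) = (c * d) *s a" for a :: "complex^'n"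
  by (simp add: vec_eq_iff)

text \<open>Characters have modulus 1, and on a cell of finite measure a norm is dominated by 1 plus
  its square.\<close>

lemma smult_cvec_integrable:
  fixes u :: "real^'n \<Rightarrow> real^'n"
  assumes "square_integrable (cell_measure Y) u"
  shows "integrable (cell_measure Y) (\<lambda>x. fourier_char Y k x *s cvec (u x))"
proof -
  have norm: "norm (fourier_char Y k x *s a) = norm a" for x a
    by (simp add: norm_eq_sqrt_inner inner_smult_complex smult_smult flip: fourier_char_uminus fourier_char_add)
  have m: "(\<lambda>x. cvec (u x)) \<in> borel_measurable (cell_measure Y)"
    by (rule square_integrable_measurable[OF square_integrable_cvec[OF assms]])
  have c: "continuous_on UNIV (\<lambda>p :: complex \<times> (complex^'n). fst p *s snd p)"
    unfolding vector_scalar_mult_def by (intro continuous_on_vec_lambda continuous_intros)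
  have "(\<lambda>x. fourier_char Y k x *s cvec (u x)) \<in> borel_measurable (cell_measure Y)"
    by (rule borel_measurable_continuous_Pair[OF _ m c])
      (intro measurable_on_cell continuous_borel_measurable_lebesgue continuous_fourier_char)
  moreover have "integrable (cell_measure Y) (\<lambda>x. 1 + (norm (cvec (u x)))\<^sup>2)"
    using square_integrable_cvec[OF assms] unfolding square_integrable_def
    by (intro Bochner_Integration.integrable_add finite_measure.integrable_const[OF finite_cell_measure]) simp
  moreover have "norm a \<le> 1 + (norm a)\<^sup>2" for a :: "complex^'n"
  proof -
    have "0 \<le> (norm a - 1)\<^sup>2" by simp
    then show ?thesis by (simp add: power2_eq_square algebra_simps) (smt (verit) norm_ge_zero)
  qed
  ultimately show ?thesis
    by (elim Bochner_Integration.integrable_bound) (auto simp: norm)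
qed

text \<open>The bridge between coefficients and \<open>L2_inner\<close>. Although the product is
  real, letting \<open>a\<close> range over all complex vectors recovers the whole
  coefficient.\<close>

lemma inner_fourier_coeff:
  assumes "square_integrable (cell_measure Y) u"
  shows "L2_inner Y (\<lambda>x. fourier_char Y k x *s a) (\<lambda>x. cvec (u x)) = a \<bullet> fourier_coeff Y u k"
proof -
  have "(LINT x|cell_measure Y. (fourier_char Y k x *s a) \<bullet> cvec (u x))
      = (LINT x|cell_measure Y. a \<bullet> (fourier_char Y (- k) x *s cvec (u x)))"
    by (simp add: inner_smult_complex fourier_char_uminus)
  also have "\<dots> = a \<bullet> (LINT x|cell_measure Y. fourier_char Y (- k) x *s cvec (u x))"
    by (rule integral_inner_right) (intro smult_cvec_integrable assms)
  finally show ?thesis by (simp add: L2_inner_eq fourier_coeff_def set_integral_cell)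
qed

lemma fourier_coeff_component:
  assumes "square_integrable (cell_measure Y) u"
  shows "fourier_coeff Y u k $ \<alpha>
    = of_real (1 / cell_volume Y) * (LINT x|cell_measure Y. of_real (u x $ \<alpha>) * fourier_char Y (- k) x)"
proof -
  have "(LINT x|cell_measure Y. fourier_char Y (- k) x *s cvec (u x)) $ \<alpha>
      = (LINT x|cell_measure Y. (fourier_char Y (- k) x *s cvec (u x)) $ \<alpha>)"
    by (rule integral_bounded_linear[symmetric, OF bounded_linear_vec_nth]) (intro smult_cvec_integrable assms)
  then show ?thesis
    by (simp add: fourier_coeff_def set_integral_cell scaleR_conv_of_real[where 'a=complex] cvec_def mult.commute)
qed

lemma fourier_coeff_uminus:
  assumes "square_integrable (cell_measure Y) u"
  shows "fourier_coeff Y u (- k) $ \<alpha> = cnj (fourier_coeff Y u k $ \<alpha>)"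
proof -
  have "cnj (LINT x|cell_measure Y. of_real (u x $ \<alpha>) * fourier_char Y (- k) x)
      = (LINT x|cell_measure Y. cnj (of_real (u x $ \<alpha>) * fourier_char Y (- k) x))"
    by (rule Bochner_Integration.integral_cnj[symmetric])
  then show ?thesis
    unfolding fourier_coeff_component[OF assms] by (simp add: fourier_char_uminus)
qed

text \<open>Real and imaginary parts of a Fourier integral are, up to sign, integrals against waves
  of phase 0 and - pi/2, so the real relations assemble into a complex one.\<close>

lemma fourier_coeff_parallel:
  fixes u :: "real^'n \<Rightarrow> real^'n"
  assumes Y_pos: "\<forall>\<alpha>. 0 < Y $ \<alpha>" and u: "u \<in> L2_per Y"
    and par: "\<And>b. xi Y k $ \<beta> * (LINT x|cell_measure Y. u x $ \<alpha> * wave Y k b x)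
      = xi Y k $ \<alpha> * (LINT x|cell_measure Y. u x $ \<beta> * wave Y k b x)"
  shows "of_real (xi Y k $ \<beta>) * fourier_coeff Y u k $ \<alpha> = of_real (xi Y k $ \<alpha>) * fourier_coeff Y u k $ \<beta>"
proof -
  have sq: "square_integrable (cell_measure Y) u" using u by (simp add: L2_per_iff[OF Y_pos])
  have "(LINT x|cell_measure Y. of_real (u x $ \<gamma>) * fourier_char Y (- k) x)
      = Complex (LINT x|cell_measure Y. u x $ \<gamma> * wave Y k 0 x) (- (LINT x|cell_measure Y. u x $ \<gamma> * wave Y k (- pi / 2) x))" for \<gamma>
  proof -
    have i: "integrable (cell_measure Y) (\<lambda>x. of_real (u x $ \<gamma>) * fourier_char Y (- k) x)"
    proof (rule integrable_mult_continuous[OF _ continuous_fourier_char])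
      have "square_integrable (cell_measure Y) (\<lambda>x. u x $ \<gamma>)"
        using L2_per_component[OF Y_pos u] by (simp add: L2_per_iff[OF Y_pos])
      from square_integrable_inner[OF this continuous_square_integrable_cell, of "\<lambda>_. 1"]
      show "integrable (cell_measure Y) (\<lambda>x. u x $ \<gamma>)" by simp
    qed
    have "Re (LINT x|cell_measure Y. of_real (u x $ \<gamma>) * fourier_char Y (- k) x)
        = (LINT x|cell_measure Y. Re (of_real (u x $ \<gamma>) * fourier_char Y (- k) x))"
      "Im (LINT x|cell_measure Y. of_real (u x $ \<gamma>) * fourier_char Y (- k) x)
        = (LINT x|cell_measure Y. Im (of_real (u x $ \<gamma>) * fourier_char Y (- k) x))"
      using integral_Re[OF i] integral_Im[OF i] by simp_all
    moreover have c: "fourier_char Y (- k) x = Complex (wave Y k 0 x) (- wave Y k (- pi / 2) x)" for x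
      by (simp only: fourier_char_uminus fourier_char_wave[of Y k x] complex_cnj)
    ultimately show ?thesis unfolding c by (simp add: complex_eq_iff)
  qed
  moreover have "of_real (xi Y k $ \<beta>) * Complex (LINT x|cell_measure Y. u x $ \<alpha> * wave Y k 0 x) (- (LINT x|cell_measure Y. u x $ \<alpha> * wave Y k (- pi / 2) x))
     = of_real (xi Y k $ \<alpha>) * Complex (LINT x|cell_measure Y. u x $ \<beta> * wave Y k 0 x) (- (LINT x|cell_measure Y. u x $ \<beta> * wave Y k (- pi / 2) x))"
    using par by (simp add: complex_eq_iff)
  ultimately show ?thesis
    unfolding fourier_coeff_component[OF sq] by (simp add: mult.left_commute)
qed

context
  fixes Y :: "real^'n"
  assumes Y_pos: "\<forall>\<alpha>. 0 < Y $ \<alpha>"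
begin

abbreviation sqint :: "(real^'n \<Rightarrow> 'b::euclidean_space) \<Rightarrow> bool" where
  "sqint \<equiv> square_integrable (cell_measure Y)"

lemma L2_per_sqint: "u \<in> L2_per Y \<Longrightarrow> sqint u"
  by (simp add: L2_per_iff[OF Y_pos])

lemma L2_inner_self_nonneg: "0 \<le> L2_inner Y u u"
  using cell_volume_pos[OF Y_pos] by (simp add: L2_inner_eq)

lemma L2_norm_nonneg: "0 \<le> L2_norm Y u"
  by (simp add: L2_norm_def L2_inner_self_nonneg)

lemma L2_norm_square: "(L2_norm Y u)\<^sup>2 = L2_inner Y u u"
  by (simp add: L2_norm_def L2_inner_self_nonneg)

lemma L2_cauchy_schwarz:
  assumes "sqint u" "sqint v"
  shows "\<bar>L2_inner Y u v\<bar> \<le> L2_norm Y u * L2_norm Y v"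
proof -
  have "\<bar>L2_inner Y u v\<bar> = \<bar>LINT x|cell_measure Y. u x \<bullet> v x\<bar> / cell_volume Y"
    using cell_volume_pos[OF Y_pos] by (simp add: L2_inner_eq)
  also have "\<dots> \<le> (l2_norm (cell_measure Y) u * l2_norm (cell_measure Y) v) / cell_volume Y"
    using cell_volume_pos[OF Y_pos] l2_cauchy_schwarz[OF assms] by (intro divide_right_mono) auto
  also have "\<dots> = L2_norm Y u * L2_norm Y v"
    using cell_volume_pos[OF Y_pos] by (simp add: L2_norm_l2_norm[OF Y_pos])
  finally show ?thesis .
qed

lemma L2_norm_triangle:
  assumes "sqint u" "sqint v"
  shows "L2_norm Y (\<lambda>x. u x + v x) \<le> L2_norm Y u + L2_norm Y v"
  using l2_norm_triangle[OF assms] cell_volume_pos[OF Y_pos]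
  by (simp add: L2_norm_l2_norm[OF Y_pos] divide_right_mono flip: add_divide_distrib)

lemma L2_norm_eq_0_imp_AE:
  assumes "sqint u" "L2_norm Y u = 0"
  shows "AE x in cell_measure Y. u x = 0"
  using assms cell_volume_pos[OF Y_pos] by (intro l2_norm_eq_0) (auto simp: L2_norm_l2_norm[OF Y_pos])

lemma L2_per_complete:
  fixes u :: "nat \<Rightarrow> real^'n \<Rightarrow> 'b::euclidean_space"
  assumes u: "\<And>n. u n \<in> L2_per Y"
    and cauchy: "\<And>e. e > 0 \<Longrightarrow> \<exists>N. \<forall>m\<ge>N. \<forall>n\<ge>N. L2_norm Y (\<lambda>x. u m x - u n x) < e"
  obtains w where "w \<in> L2_per Y" "(\<lambda>n. L2_norm Y (\<lambda>x. u n x - w x)) \<longlonglongrightarrow> 0"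
proof -
  have v: "0 < sqrt (cell_volume Y)" using cell_volume_pos[OF Y_pos] by simp
  have c: "\<exists>N. \<forall>m\<ge>N. \<forall>n\<ge>N. l2_norm (cell_measure Y) (\<lambda>x. u m x - u n x) < e" if "e > 0" for e
    using cauchy[of "e / sqrt (cell_volume Y)"] that v
    by (simp add: L2_norm_l2_norm[OF Y_pos] divide_less_cancel)
  obtain r where r: "square_integrable (cell_measure Y) (\<lambda>x. lim (\<lambda>i. u (r i) x))"
    "(\<lambda>n. l2_norm (cell_measure Y) (\<lambda>x. u n x - lim (\<lambda>i. u (r i) x))) \<longlonglongrightarrow> 0"
    by (rule l2_complete[OF L2_per_sqint[OF u] c], assumption, rule that)
  let ?w = "\<lambda>x. lim (\<lambda>i. u (r i) x)"
  have "?w \<in> borel_measurable lebesgue"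
    using u by (intro borel_measurable_lim_metric) (simp add: L2_per_iff[OF Y_pos])
  \<comment> \<open>At congruent points the sequences coincide, hence so do their
    \<open>lim\<close>, convergent or not: periodicity is exact and not only almost
    everywhere.\<close>
  moreover have "cell_periodic Y ?w"
    using u by (simp add: L2_per_iff[OF Y_pos] cell_periodic_def)
  ultimately have "?w \<in> L2_per Y" using r(1) by (simp add: L2_per_iff[OF Y_pos])
  moreover have "(\<lambda>n. L2_norm Y (\<lambda>x. u n x - ?w x)) \<longlonglongrightarrow> 0"
    using tendsto_divide[OF r(2) tendsto_const, of "sqrt (cell_volume Y)"] v
    by (simp add: L2_norm_l2_norm[OF Y_pos])
  ultimately show ?thesis by (rule that)
qed

text \<open>Pointwise, the product is the real part of the character of frequency
  \<open>k - l\<close> times the Hermitian product of \<open>a\<close> and \<open>b\<close>, so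
  orthogonality is the vanishing mean of that character.\<close>

lemma L2_inner_char_char:
  "L2_inner Y (\<lambda>x. fourier_char Y k x *s a) (\<lambda>x. fourier_char Y l x *s b) = (if k = l then a \<bullet> b else 0)"
proof -
  define c where "c = (\<Sum>\<alpha>\<in>UNIV. a $ \<alpha> * cnj (b $ \<alpha>))"
  have "(fourier_char Y k x *s a) \<bullet> (fourier_char Y l x *s b) = Re (fourier_char Y (k - l) x * c)" for x
  proof -
    have "(fourier_char Y k x *s a) \<bullet> (fourier_char Y l x *s b)
        = (\<Sum>\<alpha>\<in>UNIV. Re ((fourier_char Y k x * cnj (fourier_char Y l x)) * (a $ \<alpha> * cnj (b $ \<alpha>))))"
      unfolding inner_vec_def by (intro sum.cong) (auto simp: inner_complex_def algebra_simps)
    also have "\<dots> = Re (fourier_char Y (k - l) x * c)"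
      using fourier_char_add[of Y k "- l" x] by (simp add: c_def sum_distrib_left fourier_char_uminus)
    finally show ?thesis .
  qed
  then have "(LINT x|cell_measure Y. (fourier_char Y k x *s a) \<bullet> (fourier_char Y l x *s b))
      = Re (LINT x|cell_measure Y. fourier_char Y (k - l) x * c)"
    using integral_Re[OF continuous_integrable_cell, of "\<lambda>x. fourier_char Y (k - l) x * c" Y]
    by (simp add: continuous_intros continuous_fourier_char)
  also have "\<dots> = (if k = l then cell_volume Y * Re c else 0)"
    by (simp add: integral_fourier_char[OF Y_pos])
  also have "Re c = a \<bullet> b"
    by (simp add: c_def inner_vec_def inner_complex_def)
  finally show ?thesis using cell_volume_pos[OF Y_pos] by (simp add: L2_inner_eq)
qed

section \<open>Finite Fourier sums, Parseval and Riesz-Fischer\<close>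

definition fourier_sum :: "(int^'n \<Rightarrow> complex^'n) \<Rightarrow> (int^'n) set \<Rightarrow> real^'n \<Rightarrow> complex^'n" where
  "fourier_sum h F x = (\<Sum>k\<in>F. fourier_char Y k x *s h k)"

lemma sqint_fourier_sum: "sqint (fourier_sum h F)"
  unfolding fourier_sum_def[abs_def] by (intro square_integrable_sum square_integrable_char_smult)

lemma L2_inner_fourier_sum_cvec:
  assumes "sqint u"
  shows "L2_inner Y (fourier_sum h F) (\<lambda>x. cvec (u x)) = (\<Sum>k\<in>F. h k \<bullet> fourier_coeff Y u k)"
  unfolding fourier_sum_def[abs_def]
  by (simp add: L2_inner_sum_left square_integrable_char_smult square_integrable_cvec assms inner_fourier_coeff)

lemma L2_inner_char_fourier_sum:
  assumes "finite F"
  shows "L2_inner Y (\<lambda>x. fourier_char Y k x *s a) (fourier_sum h F) = (if k \<in> F then a \<bullet> h k else 0)"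
proof -
  have "L2_inner Y (fourier_sum h F) (\<lambda>x. fourier_char Y k x *s a) = (\<Sum>l\<in>F. if l = k then h l \<bullet> a else 0)"
    unfolding fourier_sum_def[abs_def]
    by (simp add: L2_inner_sum_left square_integrable_char_smult L2_inner_char_char)
  then show ?thesis
    using assms by (simp add: L2_inner_commute[of Y _ "fourier_sum h F"] inner_commute)
qed

lemma L2_inner_fourier_sum:
  assumes "finite F" "finite G"
  shows "L2_inner Y (fourier_sum h F) (fourier_sum h G) = (\<Sum>k\<in>F \<inter> G. (norm (h k))\<^sup>2)"
proof -
  have eq: "fourier_sum h F = (\<lambda>x. \<Sum>k\<in>F. fourier_char Y k x *s h k)"
    by (simp add: fun_eq_iff fourier_sum_def)
  have "L2_inner Y (fourier_sum h F) (fourier_sum h G)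
     = (\<Sum>k\<in>F. L2_inner Y (\<lambda>x. fourier_char Y k x *s h k) (fourier_sum h G))"
    unfolding eq by (intro L2_inner_sum_left square_integrable_char_smult sqint_fourier_sum)
  also have "\<dots> = (\<Sum>k\<in>F. if k \<in> G then h k \<bullet> h k else 0)"
    using assms by (simp add: L2_inner_char_fourier_sum)
  also have "\<dots> = (\<Sum>k\<in>F \<inter> G. (norm (h k))\<^sup>2)"
    using assms by (simp add: sum.inter_restrict power2_norm_eq_inner)
  finally show ?thesis .
qed

lemma L2_norm_diff_square:
  assumes "sqint u" "sqint v"
  shows "(L2_norm Y (\<lambda>x. u x - v x))\<^sup>2 = L2_inner Y u u - 2 * L2_inner Y v u + L2_inner Y v v"
  using assms by (simp add: L2_norm_square L2_inner_diff_left L2_inner_diff_right square_integrable_diff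
      L2_inner_commute[of Y u v])

lemma bessel_inequality:
  assumes u: "sqint u" and F: "finite F"
  shows "(\<Sum>k\<in>F. (norm (fourier_coeff Y u k))\<^sup>2) \<le> L2_inner Y u u"
proof -
  let ?S = "fourier_sum (fourier_coeff Y u) F"
  have "0 \<le> (L2_norm Y (\<lambda>x. cvec (u x) - ?S x))\<^sup>2" by simp
  also have "\<dots> = L2_inner Y u u - (\<Sum>k\<in>F. (norm (fourier_coeff Y u k))\<^sup>2)"
    using F by (simp add: L2_norm_diff_square square_integrable_cvec u sqint_fourier_sum
        L2_inner_fourier_sum L2_inner_fourier_sum_cvec power2_norm_eq_inner)
  finally show ?thesis by simp
qed

text \<open>Pairing is exact on finite sums, and Cauchy-Schwarz bounds the remainder by the
  mean-square error of the series. Leaving \<open>h\<close> arbitrary lets the identity serve both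
  the series defining \<open>Gamma0\<close> and the Fourier series of a field.\<close>

lemma parseval:
  assumes w: "w \<in> L2_per Y" and g: "g \<in> L2_per Y"
    and sum: "has_L2_sum Y (\<lambda>k x. fourier_char Y k x *s h k) (\<lambda>x. cvec (w x))"
  shows "((\<lambda>k. h k \<bullet> fourier_coeff Y g k) has_sum L2_inner Y w g) UNIV"
proof -
  note sq = L2_per_sqint[OF w] L2_per_sqint[OF g]
  have "((\<lambda>F. L2_norm Y (\<lambda>x. cvec (w x) - fourier_sum h F x) * L2_norm Y g) \<longlongrightarrow> 0 * L2_norm Y g) (finite_subsets_at_top UNIV)"
    using sum unfolding has_L2_sum_def fourier_sum_def[abs_def] by (intro tendsto_mult tendsto_const)
  then have lim: "((\<lambda>F. L2_norm Y (\<lambda>x. cvec (w x) - fourier_sum h F x) * L2_norm Y g) \<longlongrightarrow> 0) (finite_subsets_at_top UNIV)"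
    by simp
  have "norm ((\<Sum>k\<in>F. h k \<bullet> fourier_coeff Y g k) - L2_inner Y w g)
      \<le> L2_norm Y (\<lambda>x. cvec (w x) - fourier_sum h F x) * L2_norm Y g" for F
  proof -
    have "L2_inner Y w g - (\<Sum>k\<in>F. h k \<bullet> fourier_coeff Y g k)
        = L2_inner Y (\<lambda>x. cvec (w x) - fourier_sum h F x) (\<lambda>x. cvec (g x))"
      by (simp add: L2_inner_diff_left square_integrable_cvec sq sqint_fourier_sum L2_inner_fourier_sum_cvec)
    also have "\<bar>\<dots>\<bar> \<le> L2_norm Y (\<lambda>x. cvec (w x) - fourier_sum h F x) * L2_norm Y (\<lambda>x. cvec (g x))"
      by (intro L2_cauchy_schwarz square_integrable_diff square_integrable_cvec sq sqint_fourier_sum)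
    finally show ?thesis by (simp add: abs_minus_commute)
  qed
  then have "((\<lambda>F. (\<Sum>k\<in>F. h k \<bullet> fourier_coeff Y g k) - L2_inner Y w g) \<longlongrightarrow> 0) (finite_subsets_at_top UNIV)"
    by (intro Lim_null_comparison[OF _ lim]) auto
  then show ?thesis unfolding has_sum_def by (simp add: LIM_zero_iff)
qed

text \<open>Partial sums over cubes are Cauchy because, by orthogonality, their squared distances
  are differences of a bounded increasing sequence. Coefficients pass to the limit by continuity of
  the pairing, and Pythagoras upgrades convergence along cubes to convergence over all finite
  sets.\<close>

lemma riesz_fischer:
  assumes sym: "\<And>k \<alpha>. h (- k) $ \<alpha> = cnj (h k $ \<alpha>)"
    and bound: "\<And>F. finite F \<Longrightarrow> (\<Sum>k\<in>F. (norm (h k))\<^sup>2) \<le> B"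
  obtains w where "w \<in> L2_per Y" "\<And>k. fourier_coeff Y w k = h k"
    "has_L2_sum Y (\<lambda>k x. fourier_char Y k x *s h k) (\<lambda>x. cvec (w x))"
proof -
  \<comment> \<open>Cubes are invariant under negation of the index, which makes the partial sums
    real; they are also nested and exhaust the lattice.\<close>
  define Q where "Q n = {k :: int^'n. \<forall>\<alpha>. \<bar>k $ \<alpha>\<bar> \<le> int n}" for n
  define a where "a n = (\<Sum>k\<in>Q n. (norm (h k))\<^sup>2)" for n
  have Qfin: "finite (Q n)" for n unfolding Q_def by (rule finite_int_vec_box)
  have Qmono: "Q m \<subseteq> Q n" if "m \<le> n" for m n
    using that by (auto simp: Q_def intro: order_trans)
  have Qex: "\<exists>n. k \<in> Q n" for k
  proof -
    have "\<bar>k $ \<alpha>\<bar> \<le> int (nat (\<Sum>\<beta>\<in>UNIV. \<bar>k $ \<beta>\<bar>))" for \<alpha>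
      using member_le_sum[of \<alpha> UNIV "\<lambda>\<beta>. \<bar>k $ \<beta>\<bar>"] by (simp add: sum_nonneg)
    then show ?thesis unfolding Q_def by blast
  qed
  define s where "s n x = re_vec (fourier_sum h (Q n) x)" for n x
  have real: "cvec (s n x) = fourier_sum h (Q n) x" for n x
  proof -
    have "cnj (fourier_sum h (Q n) x $ \<alpha>) = fourier_sum h (Q n) x $ \<alpha>" for \<alpha>
    proof -
      have "cnj (fourier_sum h (Q n) x $ \<alpha>) = (\<Sum>k\<in>Q n. fourier_char Y (- k) x * h (- k) $ \<alpha>)"
        by (simp add: fourier_sum_def sum_component fourier_char_uminus sym)
      also have "\<dots> = (\<Sum>k\<in>Q n. fourier_char Y k x * h k $ \<alpha>)"
        by (rule sum.reindex_bij_witness[of _ uminus uminus]) (auto simp: Q_def)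
      finally show ?thesis by (simp add: fourier_sum_def sum_component)
    qed
    then have "Im (fourier_sum h (Q n) x $ \<alpha>) = 0" for \<alpha>
      by (metis Reals_cnj_iff complex_is_Real_iff)
    then show ?thesis
      by (simp add: vec_eq_iff s_def re_vec_def cvec_def complex_eq_iff)
  qed
  have sL2: "s n \<in> L2_per Y" for n
  proof (rule continuous_L2_per[OF Y_pos])
    have "continuous_on UNIV (fourier_sum h (Q n))"
      unfolding fourier_sum_def[abs_def] by (intro continuous_on_sum continuous_char_smult)
    then show "continuous_on UNIV (s n)"
      unfolding s_def[abs_def] re_vec_def by (intro continuous_on_vec_lambda continuous_intros)
    show "cell_periodic Y (s n)"
      using fourier_char_periodic[OF Y_pos] by (simp add: cell_periodic_def s_def fourier_sum_def)
  qed
  note ssq = L2_per_sqint[OF sL2]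
  \<comment> \<open>For nested cubes the mixed term is the smaller of the two sums.\<close>
  have dist: "(L2_norm Y (\<lambda>x. s m x - s n x))\<^sup>2 = \<bar>a m - a n\<bar>" for m n
  proof -
    have "(L2_norm Y (\<lambda>x. s m x - s n x))\<^sup>2 = (L2_norm Y (\<lambda>x. cvec (s m x - s n x)))\<^sup>2" by simp
    also have "\<dots> = (L2_norm Y (\<lambda>x. fourier_sum h (Q m) x - fourier_sum h (Q n) x))\<^sup>2"
      by (simp add: cvec_diff real)
    also have "\<dots> = a m - 2 * (\<Sum>k\<in>Q n \<inter> Q m. (norm (h k))\<^sup>2) + a n"
      by (simp add: L2_norm_diff_square sqint_fourier_sum L2_inner_fourier_sum Qfin a_def)
    also have "\<dots> = \<bar>a m - a n\<bar>"
    proof (cases "m \<le> n")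
      case True
      then have "Q n \<inter> Q m = Q m" using Qmono by blast
      moreover have "a m \<le> a n" unfolding a_def by (intro sum_mono2 Qfin Qmono True) auto
      ultimately show ?thesis by (simp add: a_def)
    next
      case False
      then have le: "n \<le> m" by simp
      then have "Q n \<inter> Q m = Q n" using Qmono by blast
      moreover have "a n \<le> a m" unfolding a_def by (intro sum_mono2 Qfin Qmono le) auto
      ultimately show ?thesis by (simp add: a_def)
    qed
    finally show ?thesis .
  qed
  have "incseq a" unfolding a_def incseq_def by (intro allI impI sum_mono2 Qfin Qmono) auto
  then have "convergent a"
    using bound[OF Qfin] unfolding a_def[symmetric]
    by (meson Bseq_mono_convergent incseq_bounded monoD incseq_def)
  then have aC: "Cauchy a" by (rule convergent_Cauchy)
  have cauchy: "\<exists>N. \<forall>m\<ge>N. \<forall>n\<ge>N. L2_norm Y (\<lambda>x. s m x - s n x) < e" if "e > 0" for e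
  proof -
    obtain N where N: "\<And>m n. m \<ge> N \<Longrightarrow> n \<ge> N \<Longrightarrow> norm (a m - a n) < e\<^sup>2"
      using CauchyD[OF aC, of "e\<^sup>2"] \<open>e > 0\<close> by auto
    have "L2_norm Y (\<lambda>x. s m x - s n x) < e" if "m \<ge> N" "n \<ge> N" for m n
      using N[OF that] \<open>e > 0\<close> by (intro power2_less_imp_less[of _ e]) (auto simp: dist)
    then show ?thesis by blast
  qed
  obtain w where w: "w \<in> L2_per Y" and lim: "(\<lambda>n. L2_norm Y (\<lambda>x. s n x - w x)) \<longlonglongrightarrow> 0"
    by (rule L2_per_complete[OF sL2 cauchy], assumption, rule that)
  note wsq = L2_per_sqint[OF w]
  have coeff: "fourier_coeff Y w k = h k" for k
  proof -
    have "b \<bullet> fourier_coeff Y w k = b \<bullet> h k" for b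
    proof -
      let ?c = "\<lambda>x. fourier_char Y k x *s b"
      have "(\<lambda>n. L2_inner Y ?c (\<lambda>x. cvec (s n x)) - L2_inner Y ?c (\<lambda>x. cvec (w x))) \<longlonglongrightarrow> 0"
      proof (rule Lim_null_comparison)
        show "(\<lambda>n. L2_norm Y ?c * L2_norm Y (\<lambda>x. s n x - w x)) \<longlonglongrightarrow> 0"
          using tendsto_mult[OF tendsto_const lim] by simp
        have "L2_inner Y ?c (\<lambda>x. cvec (s n x)) - L2_inner Y ?c (\<lambda>x. cvec (w x))
          = L2_inner Y ?c (\<lambda>x. cvec (s n x - w x))" for n
          by (simp add: cvec_diff L2_inner_diff_right square_integrable_char_smult square_integrable_cvec ssq wsq)
        moreover have "\<bar>L2_inner Y ?c (\<lambda>x. cvec (s n x - w x))\<bar> \<le> L2_norm Y ?c * L2_norm Y (\<lambda>x. cvec (s n x - w x))" for n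
          by (intro L2_cauchy_schwarz square_integrable_char_smult square_integrable_cvec square_integrable_diff ssq wsq)
        ultimately show "\<forall>\<^sub>F n in sequentially. norm (L2_inner Y ?c (\<lambda>x. cvec (s n x)) - L2_inner Y ?c (\<lambda>x. cvec (w x)))
            \<le> L2_norm Y ?c * L2_norm Y (\<lambda>x. s n x - w x)" by simp
      qed
      moreover have "\<forall>\<^sub>F n in sequentially. L2_inner Y ?c (\<lambda>x. cvec (s n x)) - L2_inner Y ?c (\<lambda>x. cvec (w x))
          = b \<bullet> h k - b \<bullet> fourier_coeff Y w k"
      proof -
        obtain n0 where "k \<in> Q n0" using Qex by blast
        then have "k \<in> Q n" if "n \<ge> n0" for n using Qmono that by blast
        then show ?thesis unfolding eventually_sequentially
          by (intro exI[of _ n0]) (simp add: real L2_inner_char_fourier_sum Qfin inner_fourier_coeff wsq)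
      qed
      ultimately have "(\<lambda>n. b \<bullet> h k - b \<bullet> fourier_coeff Y w k) \<longlonglongrightarrow> 0"
        by (rule Lim_transform_eventually)
      then show ?thesis by (simp add: LIMSEQ_const_iff)
    qed
    then show ?thesis by (metis vector_eq_ldot)
  qed
  \<comment> \<open>The right-hand side can only decrease as \<open>F\<close> grows, so a cube with
    small error controls every finite set containing it.\<close>
  have approx: "(L2_norm Y (\<lambda>x. cvec (w x) - fourier_sum h F x))\<^sup>2 = L2_inner Y w w - (\<Sum>k\<in>F. (norm (h k))\<^sup>2)"
    if "finite F" for F
    using that by (simp add: L2_norm_diff_square square_integrable_cvec wsq sqint_fourier_sum
        L2_inner_fourier_sum L2_inner_fourier_sum_cvec coeff power2_norm_eq_inner)
  have "((\<lambda>F. L2_norm Y (\<lambda>x. cvec (w x) - fourier_sum h F x)) \<longlongrightarrow> 0) (finite_subsets_at_top UNIV)"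
  proof (rule tendstoI)
    fix e :: real assume "e > 0"
    then obtain n where n: "L2_norm Y (\<lambda>x. s n x - w x) < e"
      using lim[THEN LIMSEQ_D, of e] by (auto simp: abs_less_iff)
    have n': "L2_norm Y (\<lambda>x. cvec (w x) - fourier_sum h (Q n) x) < e"
    proof -
      have "L2_norm Y (\<lambda>x. cvec (w x) - fourier_sum h (Q n) x) = L2_norm Y (\<lambda>x. w x - s n x)"
        by (simp flip: real cvec_diff)
      also have "\<dots> = L2_norm Y (\<lambda>x. s n x - w x)"
        unfolding L2_norm_l2_norm[OF Y_pos] by (simp only: l2_norm_diff_commute)
      finally show ?thesis using n by simp
    qed
    show "\<forall>\<^sub>F F in finite_subsets_at_top UNIV. dist (L2_norm Y (\<lambda>x. cvec (w x) - fourier_sum h F x)) 0 < e"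
      unfolding eventually_finite_subsets_at_top
    proof (intro exI[of _ "Q n"] conjI allI impI)
      fix F assume F: "finite F \<and> Q n \<subseteq> F \<and> F \<subseteq> UNIV"
      have "(L2_norm Y (\<lambda>x. cvec (w x) - fourier_sum h F x))\<^sup>2 \<le> (L2_norm Y (\<lambda>x. cvec (w x) - fourier_sum h (Q n) x))\<^sup>2"
        using F Qfin by (auto simp: approx intro!: sum_mono2)
      then have "L2_norm Y (\<lambda>x. cvec (w x) - fourier_sum h F x) \<le> L2_norm Y (\<lambda>x. cvec (w x) - fourier_sum h (Q n) x)"
        by (rule power2_le_imp_le) (rule L2_norm_nonneg)
      then show "dist (L2_norm Y (\<lambda>x. cvec (w x) - fourier_sum h F x)) 0 < e"
        using n' L2_norm_nonneg[of "\<lambda>x. cvec (w x) - fourier_sum h F x"] by simp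
    qed (use Qfin in auto)
  qed
  then have "has_L2_sum Y (\<lambda>k x. fourier_char Y k x *s h k) (\<lambda>x. cvec (w x))"
    unfolding has_L2_sum_def fourier_sum_def .
  with w coeff show ?thesis by (rule that)
qed

lemma AE_eq_of_fourier_coeff_eq:
  assumes u: "u \<in> L2_per Y" and v: "v \<in> L2_per Y" and eq: "\<And>k. fourier_coeff Y u k = fourier_coeff Y v k"
  shows "AE x in cell_measure Y. u x = v x"
proof -
  have "AE x in cell_measure Y. u x $ \<alpha> - v x $ \<alpha> = 0" for \<alpha>
  proof (rule fourier_uniqueness[OF Y_pos])
    note cu = L2_per_component[OF Y_pos u, of \<alpha>] and cv = L2_per_component[OF Y_pos v, of \<alpha>]
    show "(\<lambda>x. u x $ \<alpha> - v x $ \<alpha>) \<in> borel_measurable lebesgue"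
      using cu cv unfolding L2_per_iff[OF Y_pos] by (intro borel_measurable_diff) auto
    have i: "integrable (cell_measure Y) (\<lambda>x. f x)" if "f \<in> L2_per Y" for f :: "real^'n \<Rightarrow> real"
      using square_integrable_inner[OF L2_per_sqint[OF that] continuous_square_integrable_cell, of "\<lambda>_. 1"] by simp
    show "integrable (cell_measure Y) (\<lambda>x. u x $ \<alpha> - v x $ \<alpha>)"
      using i[OF cu] i[OF cv] by simp
    fix k
    have "(LINT x|cell_measure Y. of_real (u x $ \<alpha>) * fourier_char Y k x)
        = (LINT x|cell_measure Y. of_real (v x $ \<alpha>) * fourier_char Y k x)"
      using arg_cong[OF eq[of "- k"], of "\<lambda>z. z $ \<alpha>"] cell_volume_pos[OF Y_pos]
      by (simp add: fourier_coeff_component L2_per_sqint u v)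
    then show "(LINT x|cell_measure Y. of_real (u x $ \<alpha> - v x $ \<alpha>) * fourier_char Y k x) = 0"
      using integrable_mult_continuous[OF i[OF cu] continuous_fourier_char[of Y k]]
        integrable_mult_continuous[OF i[OF cv] continuous_fourier_char[of Y k]]
      by (simp add: left_diff_distrib)
  qed
  then have "AE x in cell_measure Y. \<forall>\<alpha>. u x $ \<alpha> - v x $ \<alpha> = 0"
    by (simp add: AE_all_countable)
  then show ?thesis by eventually_elim (simp add: vec_eq_iff)
qed

text \<open>Riesz-Fischer supplies some limit with the coefficients of \<open>v\<close>;
  completeness of the exponentials identifies it with \<open>v\<close> almost everywhere.\<close>

lemma fourier_series_converges:
  assumes v: "v \<in> L2_per Y"
  shows "has_L2_sum Y (\<lambda>k x. fourier_char Y k x *s fourier_coeff Y v k) (\<lambda>x. cvec (v x))"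
proof -
  note vsq = L2_per_sqint[OF v]
  obtain w where w: "w \<in> L2_per Y" "\<And>k. fourier_coeff Y w k = fourier_coeff Y v k"
    and sum: "has_L2_sum Y (\<lambda>k x. fourier_char Y k x *s fourier_coeff Y v k) (\<lambda>x. cvec (w x))"
    by (rule riesz_fischer[OF fourier_coeff_uminus[OF vsq] bessel_inequality[OF vsq]], assumption, rule that)
  have ae: "AE x in cell_measure Y. w x = v x"
    by (rule AE_eq_of_fourier_coeff_eq[OF w(1) v w(2)])
  have "L2_norm Y (\<lambda>x. cvec (v x) - fourier_sum h F x) = L2_norm Y (\<lambda>x. cvec (w x) - fourier_sum h F x)" for h F
  proof -
    have "(LINT x|cell_measure Y. (cvec (v x) - fourier_sum h F x) \<bullet> (cvec (v x) - fourier_sum h F x))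
        = (LINT x|cell_measure Y. (cvec (w x) - fourier_sum h F x) \<bullet> (cvec (w x) - fourier_sum h F x))"
      using ae square_integrable_measurable[OF square_integrable_cvec[OF vsq]]
        square_integrable_measurable[OF square_integrable_cvec[OF L2_per_sqint[OF w(1)]]]
        square_integrable_measurable[OF sqint_fourier_sum[of h F]]
      by (intro integral_cong_AE) auto
    then show ?thesis by (simp add: L2_norm_def L2_inner_eq)
  qed
  from this[of "fourier_coeff Y v"] sum show ?thesis
    unfolding has_L2_sum_def fourier_sum_def by simp
qed

end

section \<open>Potential fields and the Green operator\<close>

lemma L2_per_diff:
  assumes "\<forall>\<alpha>. 0 < Y $ \<alpha>" "u \<in> L2_per Y" "v \<in> L2_per Y"
  shows "(\<lambda>x. u x - v x) \<in> L2_per Y"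
  using assms(2,3) unfolding L2_per_iff[OF assms(1)]
  by (auto intro!: borel_measurable_diff square_integrable_diff simp: cell_periodic_def)

lemma L2_per_add:
  assumes "\<forall>\<alpha>. 0 < Y $ \<alpha>" "u \<in> L2_per Y" "v \<in> L2_per Y"
  shows "(\<lambda>x. u x + v x) \<in> L2_per Y"
  using assms(2,3) unfolding L2_per_iff[OF assms(1)]
  by (auto intro!: borel_measurable_add square_integrable_add simp: cell_periodic_def)

lemma L2_per_bounded_linear:
  assumes "\<forall>\<alpha>. 0 < Y $ \<alpha>" "u \<in> L2_per Y" "bounded_linear f"
  shows "(\<lambda>x. f (u x)) \<in> L2_per Y"
  using assms(2) square_integrable_bounded_linear[OF assms(3)]
    measurable_compose[OF _ borel_measurable_continuous_onI[OF linear_continuous_on[OF assms(3)]]]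
  unfolding L2_per_iff[OF assms(1)] by (auto simp: cell_periodic_def)

lemma L2_per_scaleR:
  assumes "\<forall>\<alpha>. 0 < Y $ \<alpha>" "u \<in> L2_per Y"
  shows "(\<lambda>x. c *\<^sub>R u x) \<in> L2_per Y"
  by (rule L2_per_bounded_linear[OF assms bounded_linear_scaleR_right])

lemma L2_per_const:
  assumes "\<forall>\<alpha>. 0 < Y $ \<alpha>"
  shows "(\<lambda>x. c) \<in> L2_per Y"
  by (rule continuous_L2_per[OF assms]) (auto simp: cell_periodic_def)

lemma cvec_zero: "cvec 0 = 0"
  by (rule linear_0[OF cvec_linear])

lemma norm_smult_complex: "norm (c *s a) = cmod c * norm a" for a :: "complex^'n"
proof -
  have "(c *s a) \<bullet> (c *s a) = (cmod c)\<^sup>2 * (a \<bullet> a)"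
  proof -
    have "cnj c * c = of_real ((cmod c)\<^sup>2)" using complex_norm_square[of c] by (simp add: mult.commute)
    moreover have "of_real r *s a = r *\<^sub>R a" for r :: real
      by (simp add: vec_eq_iff scaleR_conv_of_real[where 'a=complex])
    ultimately have "cnj c *s (c *s a) = (cmod c)\<^sup>2 *\<^sub>R a" by (simp only: smult_smult)
    then show ?thesis by (simp add: inner_smult_complex)
  qed
  then show ?thesis by (simp add: norm_eq_sqrt_inner real_sqrt_mult)
qed

lemma xi_eq_0_iff:
  assumes "\<forall>\<alpha>. 0 < Y $ \<alpha>"
  shows "xi Y k = 0 \<longleftrightarrow> k = 0"
  using assms by (auto simp: xi_def vec_eq_iff less_imp_neq[symmetric])

text \<open>At \<open>k = 0\<close> both sides vanish since \<open>xi Y 0 = 0\<close>, so no case distinction is needed.\<close>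

lemma Gamma_hat_mult:
  "cmat (Gamma_hat Y A0 k) *v z =
    ((\<Sum>\<beta>\<in>UNIV. of_real (xi Y k $ \<beta>) * z $ \<beta>) / of_real ((A0 *v xi Y k) \<bullet> xi Y k)) *s cvec (xi Y k)"
proof (cases "k = 0")
  case True
  then have 0: "xi Y k = 0" "Gamma_hat Y A0 k = 0" by (simp_all add: Gamma_hat_def)
  show ?thesis unfolding 0 by (simp add: vec_eq_iff cmat_def cvec_def matrix_vector_mult_def)
next
  case False
  then have g: "Gamma_hat Y A0 k = (1 / ((A0 *v xi Y k) \<bullet> xi Y k)) *\<^sub>R tensor (xi Y k) (xi Y k)"
    by (simp add: Gamma_hat_def)
  show ?thesis unfolding g
    by (simp add: vec_eq_iff cmat_def cvec_def matrix_vector_mult_def tensor_def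
        sum_distrib_left sum_distrib_right sum_divide_distrib mult_ac)
qed

lemma inner_smult_cvec:
  "(s *s cvec a) \<bullet> z = Re (s * cnj (\<Sum>\<beta>\<in>UNIV. of_real (a $ \<beta>) * z $ \<beta>))"
  by (simp add: inner_vec_def inner_complex_def cvec_def sum_distrib_left algebra_simps flip: sum.distrib)

text \<open>Taking the bilinear sum q itself as the scalar in front of \<open>cvec a\<close> makes
  the real inner product equal to the squared modulus of q, so the ordinary Cauchy-Schwarz
  inequality applies.\<close>

lemma norm_xi_sum_le:
  "cmod (\<Sum>\<beta>\<in>UNIV. of_real (a $ \<beta>) * z $ \<beta>) \<le> norm (cvec a) * norm z"
proof -
  define q where "q = (\<Sum>\<beta>\<in>UNIV. of_real (a $ \<beta>) * z $ \<beta>)"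
  have "(cmod q)\<^sup>2 = (q *s cvec a) \<bullet> z"
    unfolding inner_smult_cvec q_def[symmetric] by (metis complex_norm_square Re_complex_of_real)
  also have "\<dots> \<le> norm (q *s cvec a) * norm z" by (rule norm_cauchy_schwarz)
  also have "\<dots> = cmod q * (norm (cvec a) * norm z)" by (simp add: norm_smult_complex)
  finally have "cmod q * cmod q \<le> cmod q * (norm (cvec a) * norm z)" by (simp add: power2_eq_square)
  then show ?thesis unfolding q_def[symmetric]
    by (cases "q = 0") (simp_all add: mult_le_cancel_left)
qed

lemma inner_matrix_symmetric:
  fixes B :: "real^'n^'n"
  assumes "transpose B = B"
  shows "(B *v u) \<bullet> v = u \<bullet> (B *v v)"
  using dot_lmul_matrix[of u B v] assms by (metis transpose_matrix_vector)

lemma re_vec_cmat: "re_vec (cmat B *v z) = B *v re_vec z"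
  by (simp add: vec_eq_iff re_vec_def cmat_def matrix_vector_mult_def)

lemma smult_cmat: "c *s (cmat B *v z) = cmat B *v (c *s z)"
  by (simp add: vec_eq_iff matrix_vector_mult_def sum_distrib_left mult_ac)

text \<open>
  The test fields to which the potential fields are orthogonal: rotated gradients encode the
  vanishing curl, constant fields the vanishing mean.
\<close>

definition curl_test :: "'n \<Rightarrow> 'n \<Rightarrow> (real^'n \<Rightarrow> real^'n) \<Rightarrow> real^'n \<Rightarrow> real^'n" where
  "curl_test \<alpha> \<beta> g x = g x $ \<beta> *\<^sub>R axis \<alpha> 1 - g x $ \<alpha> *\<^sub>R axis \<beta> 1"

definition potential_tests :: "real^'n \<Rightarrow> (real^'n \<Rightarrow> real^'n) set" where
  "potential_tests Y = {curl_test \<alpha> \<beta> g | \<alpha> \<beta> v g. has_weak_gradient Y v g} \<union> range (\<lambda>c x. c)"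

context
  fixes Y :: "real^'n"
  assumes Y_pos: "\<forall>\<alpha>. 0 < Y $ \<alpha>"
begin

lemma curl_test_L2_per:
  assumes "g \<in> L2_per Y"
  shows "curl_test \<alpha> \<beta> g \<in> L2_per Y"
proof -
  have "bounded_linear (\<lambda>z :: real^'n. z $ \<beta> *\<^sub>R axis \<alpha> 1 - z $ \<alpha> *\<^sub>R axis \<beta> 1 :: real^'n)"
    by (intro bounded_linear_intros bounded_linear_vec_nth)
  from L2_per_bounded_linear[OF Y_pos assms this] show ?thesis
    by (simp add: curl_test_def[abs_def])
qed

lemma potential_tests_L2_per: "t \<in> potential_tests Y \<Longrightarrow> t \<in> L2_per Y"
  unfolding potential_tests_def
  by (auto intro: curl_test_L2_per L2_per_const[OF Y_pos] simp: has_weak_gradient_def)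

text \<open>As a family of orthogonality relations, membership is visibly stable under linear
  combinations, changes on null sets and mean-square limits, and one Parseval computation can verify
  vanishing curl and mean together.\<close>

lemma potential_fields_iff:
  "u \<in> potential_fields Y \<longleftrightarrow> u \<in> L2_per Y \<and> (\<forall>t\<in>potential_tests Y. L2_inner Y u t = 0)"
proof (cases "u \<in> L2_per Y")
  case True
  have vol: "cell_volume Y \<noteq> 0" using cell_volume_pos[OF Y_pos] by simp
  have i: "integrable (cell_measure Y) u"
  proof -
    have "integrable (cell_measure Y) (\<lambda>x. u x \<bullet> b)" for b
      using square_integrable_inner[OF L2_per_sqint[OF Y_pos True] continuous_square_integrable_cell, of "\<lambda>_. b"] by simp
    then have "integrable (cell_measure Y) (\<lambda>x. \<Sum>b\<in>Basis. (u x \<bullet> b) *\<^sub>R b)"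
      by (intro Bochner_Integration.integrable_sum integrable_scaleR_left) auto
    then show ?thesis by (simp add: euclidean_representation)
  qed
  have "curl_free Y u \<longleftrightarrow> (\<forall>\<alpha> \<beta> v g. has_weak_gradient Y v g \<longrightarrow> L2_inner Y u (curl_test \<alpha> \<beta> g) = 0)"
    using vol by (simp add: curl_free_def L2_inner_def curl_test_def inner_diff_right inner_axis mult.commute)
  moreover have "(LINT x|cell_measure Y. u x) = 0 \<longleftrightarrow> (\<forall>c. L2_inner Y u (\<lambda>x. c) = 0)"
  proof -
    have "L2_inner Y u (\<lambda>x. c) = (LINT x|cell_measure Y. u x) \<bullet> c / cell_volume Y" for c
      unfolding L2_inner_eq using integral_inner_left[of c "cell_measure Y" u] i by simp
    then show ?thesis using vol by (auto simp: inner_eq_zero_iff)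
  qed
  ultimately show ?thesis
    using True unfolding potential_fields_def potential_tests_def set_integral_cell by blast
qed (simp add: potential_fields_def)

lemma potential_L2_per: "u \<in> potential_fields Y \<Longrightarrow> u \<in> L2_per Y"
  by (simp add: potential_fields_def)

lemma potential_diff:
  assumes "u \<in> potential_fields Y" "v \<in> potential_fields Y"
  shows "(\<lambda>x. u x - v x) \<in> potential_fields Y"
  using assms potential_tests_L2_per
  by (auto simp: potential_fields_iff L2_per_diff[OF Y_pos] L2_inner_diff_left L2_per_sqint[OF Y_pos])

lemma potential_scaleR:
  assumes "u \<in> potential_fields Y"
  shows "(\<lambda>x. c *\<^sub>R u x) \<in> potential_fields Y"
  using assms by (auto simp: potential_fields_iff L2_per_scaleR[OF Y_pos] L2_inner_scaleR_left)

lemma potential_cong_AE: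
  assumes "u \<in> potential_fields Y" "v \<in> L2_per Y" "AE x in cell_measure Y. v x = u x"
  shows "v \<in> potential_fields Y"
  using assms potential_tests_L2_per L2_inner_cong_AE[OF _ _ _ assms(3)]
  by (auto simp: potential_fields_iff L2_per_sqint[OF Y_pos])

lemma potential_orthogonal_const:
  "u \<in> potential_fields Y \<Longrightarrow> L2_inner Y u (\<lambda>x. c) = 0"
  unfolding potential_fields_iff potential_tests_def by blast

lemma L2_inner_tendsto:
  fixes u :: "nat \<Rightarrow> real^'n \<Rightarrow> 'b::euclidean_space"
  assumes "\<And>n. u n \<in> L2_per Y" "w \<in> L2_per Y" "g \<in> L2_per Y"
    and lim: "(\<lambda>n. L2_norm Y (\<lambda>x. u n x - w x)) \<longlonglongrightarrow> 0"
  shows "(\<lambda>n. L2_inner Y (u n) g) \<longlonglongrightarrow> L2_inner Y w g"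
proof (rule LIM_zero_cancel, rule Lim_null_comparison)
  show "(\<lambda>n. L2_norm Y (\<lambda>x. u n x - w x) * L2_norm Y g) \<longlonglongrightarrow> 0"
    using tendsto_mult_left_zero[OF lim] .
  note sq = assms(1-3)[THEN L2_per_sqint[OF Y_pos]]
  have "\<bar>L2_inner Y (u n) g - L2_inner Y w g\<bar> \<le> L2_norm Y (\<lambda>x. u n x - w x) * L2_norm Y g" for n
    using L2_cauchy_schwarz[OF Y_pos square_integrable_diff[OF sq(1,2)] sq(3), of n]
    by (simp add: L2_inner_diff_left sq)
  then show "\<forall>\<^sub>F n in sequentially. norm (L2_inner Y (u n) g - L2_inner Y w g)
      \<le> L2_norm Y (\<lambda>x. u n x - w x) * L2_norm Y g" by simp
qed

lemma potential_limit:
  assumes "\<And>n. u n \<in> potential_fields Y" "w \<in> L2_per Y"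
    and "(\<lambda>n. L2_norm Y (\<lambda>x. u n x - w x)) \<longlonglongrightarrow> 0"
  shows "w \<in> potential_fields Y"
  unfolding potential_fields_iff
proof (intro conjI ballI)
  fix t assume t: "t \<in> potential_tests Y"
  have "(\<lambda>n. L2_inner Y (u n) t) \<longlonglongrightarrow> L2_inner Y w t"
    by (intro L2_inner_tendsto potential_L2_per assms potential_tests_L2_per t)
  moreover have "L2_inner Y (u n) t = 0" for n
    using assms(1) t by (simp add: potential_fields_iff)
  ultimately show "L2_inner Y w t = 0" by (simp add: LIMSEQ_const_iff)
qed (rule assms(2))

lemma L2_per_matrix: "u \<in> L2_per Y \<Longrightarrow> (\<lambda>x. B *v u x) \<in> L2_per Y"
  for B :: "real^'n^'n"
  by (rule L2_per_bounded_linear[OF Y_pos _ matrix_vector_mul_bounded_linear])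

text \<open>Stated as a pairing with an arbitrary \<open>h\<close>, the form in which Parseval
  presents coefficients.\<close>

lemma fourier_coeff_matrix:
  fixes B :: "real^'n^'n"
  assumes B: "transpose B = B" and u: "u \<in> L2_per Y"
  shows "h \<bullet> fourier_coeff Y (\<lambda>x. B *v u x) k = (cmat B *v h) \<bullet> fourier_coeff Y u k"
proof -
  have "(c *s h) \<bullet> cvec (B *v v) = (c *s (cmat B *v h)) \<bullet> cvec v" for c v
    by (simp add: inner_cvec smult_cmat re_vec_cmat inner_matrix_symmetric[OF B])
  then have "L2_inner Y (\<lambda>x. fourier_char Y k x *s h) (\<lambda>x. cvec (B *v u x))
      = L2_inner Y (\<lambda>x. fourier_char Y k x *s (cmat B *v h)) (\<lambda>x. cvec (u x))"
    by (simp add: L2_inner_eq)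
  then show ?thesis
    by (simp add: inner_fourier_coeff L2_per_sqint[OF Y_pos] u L2_per_matrix)
qed

lemma potential_fourier_coeff:
  assumes v: "v \<in> potential_fields Y"
  obtains c where "fourier_coeff Y v k = c *s cvec (xi Y k)"
proof (cases "k = 0")
  case True
  have "a \<bullet> fourier_coeff Y v 0 = 0" for a
  proof -
    have "a \<bullet> fourier_coeff Y v 0 = L2_inner Y (\<lambda>x. fourier_char Y 0 x *s a) (\<lambda>x. cvec (v x))"
      by (rule inner_fourier_coeff[symmetric]) (intro L2_per_sqint[OF Y_pos] potential_L2_per v)
    also have "\<dots> = L2_inner Y (\<lambda>x. re_vec a) v"
      by (simp add: L2_inner_eq inner_cvec)
    also have "\<dots> = 0" using potential_orthogonal_const[OF v] by (simp add: L2_inner_commute[of Y _ v])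
    finally show ?thesis .
  qed
  then have "fourier_coeff Y v k = 0" using True by (metis inner_eq_zero_iff)
  then show ?thesis using that[of 0] by simp
next
  case False
  let ?x = "xi Y k" and ?v = "fourier_coeff Y v k"
  have n: "?x \<bullet> ?x \<noteq> 0" using False by (simp add: xi_eq_0_iff[OF Y_pos])
  have par: "of_real (?x $ \<beta>) * ?v $ \<alpha> = of_real (?x $ \<alpha>) * ?v $ \<beta>" for \<alpha> \<beta>
    using v by (intro fourier_coeff_parallel[OF Y_pos] curl_free_wave[OF Y_pos])
      (auto simp: potential_fields_def)
  \<comment> \<open>Multiplying the parallelism relation by \<open>xi Y k $ \<beta>\<close> and
    summing over \<beta> recovers the coefficient from its product with the frequency.\<close>
  have "of_real (?x \<bullet> ?x) * ?v $ \<alpha> = (\<Sum>\<beta>\<in>UNIV. of_real (?x $ \<beta>) * ?v $ \<beta>) * of_real (?x $ \<alpha>)" for \<alpha>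
  proof -
    have "of_real (?x \<bullet> ?x) * ?v $ \<alpha> = (\<Sum>\<beta>\<in>UNIV. of_real (?x $ \<beta>) * (of_real (?x $ \<beta>) * ?v $ \<alpha>))"
      by (simp add: inner_vec_def sum_distrib_right mult.assoc)
    also have "\<dots> = (\<Sum>\<beta>\<in>UNIV. of_real (?x $ \<beta>) * (of_real (?x $ \<alpha>) * ?v $ \<beta>))"
      by (simp only: par)
    finally show ?thesis by (simp add: sum_distrib_left sum_distrib_right mult_ac)
  qed
  then have "?v = ((\<Sum>\<beta>\<in>UNIV. of_real (?x $ \<beta>) * ?v $ \<beta>) / of_real (?x \<bullet> ?x)) *s cvec ?x"
    using n by (simp add: vec_eq_iff cvec_def field_simps)
  then show ?thesis by (rule that)
qed

end

section \<open>The Green operator as a projection weighted by the reference matrix\<close>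

context
  fixes Y :: "real^'n" and A0 :: "real^'n^'n" and c :: real
  assumes Y_pos: "\<forall>\<alpha>. 0 < Y $ \<alpha>" and A0_sym: "transpose A0 = A0"
    and c: "0 < c" and A0_coercive: "\<And>v. c * (norm v)\<^sup>2 \<le> (A0 *v v) \<bullet> v"
begin

text \<open>The symbol is homogeneous of degree 0 in the frequency: the two factors of the tensor
  are balanced by the denominator, which coercivity bounds below by c times the squared
  norm.\<close>

lemma Gamma_hat_bound: "norm (cmat (Gamma_hat Y A0 k) *v z) \<le> (1 / c) * norm z"
proof (cases "k = 0")
  case True
  then show ?thesis using c by (simp add: Gamma_hat_mult cvec_def norm_smult_complex)
next
  case False
  let ?x = "xi Y k" and ?q = "\<Sum>\<beta>\<in>UNIV. of_real (xi Y k $ \<beta>) * z $ \<beta>"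
  have n: "0 < norm ?x" using False by (simp add: xi_eq_0_iff[OF Y_pos])
  have nc: "norm (cvec ?x) = norm ?x" by (simp add: norm_eq_sqrt_inner)
  have d: "c * (norm ?x)\<^sup>2 \<le> (A0 *v ?x) \<bullet> ?x" by (rule A0_coercive)
  have d0: "0 < c * (norm ?x)\<^sup>2" using c n by simp
  have "norm (cmat (Gamma_hat Y A0 k) *v z) = cmod ?q / \<bar>(A0 *v ?x) \<bullet> ?x\<bar> * norm ?x"
    by (simp add: Gamma_hat_mult norm_smult_complex norm_divide nc)
  also have "\<dots> \<le> (norm ?x * norm z) / (c * (norm ?x)\<^sup>2) * norm ?x"
    using norm_xi_sum_le[of ?x z] d d0 by (intro mult_right_mono frac_le) (auto simp: nc)
  also have "\<dots> = (1 / c) * norm z" using n c by (simp add: power2_eq_square)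
  finally show ?thesis .
qed

text \<open>Existence of a limit is what gives the choice in \<open>Gamma0\<close> its meaning. The
  symbol is real and even in the frequency, which preserves conjugate symmetry, and its bound
  combines with Bessel's inequality to give square summability.\<close>

lemma Gamma0_has_L2_sum:
  assumes u: "u \<in> L2_per Y"
  shows "Gamma0 Y A0 u \<in> L2_per Y"
    and "has_L2_sum Y (\<lambda>k x. fourier_char Y k x *s (cmat (Gamma_hat Y A0 k) *v fourier_coeff Y u k))
       (\<lambda>x. cvec (Gamma0 Y A0 u x))"
proof -
  note sq = L2_per_sqint[OF Y_pos u]
  let ?h = "\<lambda>k. cmat (Gamma_hat Y A0 k) *v fourier_coeff Y u k"
  have "?h (- k) $ \<alpha> = cnj (?h k $ \<alpha>)" for k \<alpha>
  proof -
    have "A0 *v (- xi Y k) = - (A0 *v xi Y k)" by (simp add: matrix_vector_mult_def vec_eq_iff sum_negf)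
    then show ?thesis
      by (simp add: Gamma_hat_mult cvec_def xi_uminus fourier_coeff_uminus[OF sq] sum_negf)
  qed
  moreover have "(\<Sum>k\<in>F. (norm (?h k))\<^sup>2) \<le> (1 / c)\<^sup>2 * L2_inner Y u u" if "finite F" for F
  proof -
    have "(\<Sum>k\<in>F. (norm (?h k))\<^sup>2) \<le> (\<Sum>k\<in>F. ((1 / c) * norm (fourier_coeff Y u k))\<^sup>2)"
      by (intro sum_mono power_mono Gamma_hat_bound) simp
    also have "\<dots> = (1 / c)\<^sup>2 * (\<Sum>k\<in>F. (norm (fourier_coeff Y u k))\<^sup>2)"
      by (simp add: power_mult_distrib power_divide sum_divide_distrib)
    also have "\<dots> \<le> (1 / c)\<^sup>2 * L2_inner Y u u"
      by (intro mult_left_mono bessel_inequality[OF Y_pos sq that]) simp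
    finally show ?thesis .
  qed
  ultimately have "\<exists>w. w \<in> L2_per Y \<and> has_L2_sum Y (\<lambda>k x. fourier_char Y k x *s ?h k) (\<lambda>x. cvec (w x))"
    using riesz_fischer[OF Y_pos, of ?h "(1 / c)\<^sup>2 * L2_inner Y u u"] by blast
  from someI_ex[OF this] show "Gamma0 Y A0 u \<in> L2_per Y"
    "has_L2_sum Y (\<lambda>k x. fourier_char Y k x *s ?h k) (\<lambda>x. cvec (Gamma0 Y A0 u x))"
    by (simp_all add: Gamma0_def)
qed

text \<open>Every term of the Parseval sum against a test field is zero: the terms of the series
  point along the frequency, rotated gradients have coefficients orthogonal to it, and a constant
  has only the mode \<open>k = 0\<close>, where the frequency is zero.\<close>

lemma Gamma0_potential:
  assumes u: "u \<in> L2_per Y"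
  shows "Gamma0 Y A0 u \<in> potential_fields Y"
  unfolding potential_fields_iff[OF Y_pos]
proof (intro conjI ballI Gamma0_has_L2_sum(1)[OF u])
  fix t assume t: "t \<in> potential_tests Y"
  let ?h = "\<lambda>k. cmat (Gamma_hat Y A0 k) *v fourier_coeff Y u k"
  note tL2 = potential_tests_L2_per[OF Y_pos t]
  have "?h k \<bullet> fourier_coeff Y t k = 0" for k
  proof -
    define q where "q = (\<Sum>\<beta>\<in>UNIV. of_real (xi Y k $ \<beta>) * fourier_coeff Y u k $ \<beta>) / of_real ((A0 *v xi Y k) \<bullet> xi Y k)"
    have h: "?h k = q *s cvec (xi Y k)" unfolding q_def by (rule Gamma_hat_mult)
    consider (curl) \<alpha> \<beta> v g where "t = curl_test \<alpha> \<beta> g" "has_weak_gradient Y v g"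
      | (const) b where "t = (\<lambda>x. b)"
      using t by (auto simp: potential_tests_def)
    then show ?thesis
    proof cases
      case curl
      have g: "g \<in> L2_per Y" using curl(2) by (simp add: has_weak_gradient_def)
      note gsq = L2_per_sqint[OF Y_pos g] and tsq = L2_per_sqint[OF Y_pos tL2]
      have par: "of_real (xi Y k $ \<beta>) * fourier_coeff Y g k $ \<alpha> = of_real (xi Y k $ \<alpha>) * fourier_coeff Y g k $ \<beta>"
        by (intro fourier_coeff_parallel[OF Y_pos g] weak_gradient_wave[OF Y_pos curl(2)])
      have "fourier_coeff Y t k $ \<gamma> = (if \<gamma> = \<alpha> then fourier_coeff Y g k $ \<beta> else 0)
          - (if \<gamma> = \<beta> then fourier_coeff Y g k $ \<alpha> else 0)" for \<gamma>
        unfolding fourier_coeff_component[OF gsq] fourier_coeff_component[OF tsq]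
        by (auto simp: curl(1) curl_test_def axis_def)
      then have "(\<Sum>\<gamma>\<in>UNIV. of_real (xi Y k $ \<gamma>) * fourier_coeff Y t k $ \<gamma>)
          = of_real (xi Y k $ \<alpha>) * fourier_coeff Y g k $ \<beta> - of_real (xi Y k $ \<beta>) * fourier_coeff Y g k $ \<alpha>"
        by (simp add: right_diff_distrib sum_subtractf if_distrib[of "(*) _"] cong: if_cong)
      then show ?thesis unfolding h inner_smult_cvec by (simp add: par)
    next
      case const
      have "?h k \<bullet> fourier_coeff Y t k = L2_inner Y (\<lambda>x. fourier_char Y k x *s ?h k) (\<lambda>x. cvec (t x))"
        by (rule inner_fourier_coeff[symmetric]) (rule L2_per_sqint[OF Y_pos tL2])
      also have "\<dots> = L2_inner Y (\<lambda>x. fourier_char Y k x *s ?h k) (\<lambda>x. fourier_char Y 0 x *s cvec b)"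
        by (simp add: const)
      also have "\<dots> = 0"
      proof -
        have "?h k \<bullet> cvec b = 0" if "k = 0" unfolding h using that by (simp add: cvec_zero)
        then show ?thesis unfolding L2_inner_char_char[OF Y_pos] by metis
      qed
      finally show ?thesis .
    qed
  qed
  then have "((\<lambda>k. 0) has_sum L2_inner Y (Gamma0 Y A0 u) t) (UNIV :: (int^'n) set)"
    using parseval[OF Y_pos Gamma0_has_L2_sum(1)[OF u] tL2 Gamma0_has_L2_sum(2)[OF u]] by simp
  then show "L2_inner Y (Gamma0 Y A0 u) t = 0"
    using has_sum_unique[OF _ has_sum_0[of UNIV "\<lambda>k. 0"]] by simp
qed

text \<open>In each mode the coefficient of \<open>v\<close> is a multiple of the frequency, so
  pairing it with \<open>A0\<close> times the symbol reproduces the denominator, which cancels. Thus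
  \<open>Gamma0 Y A0 u\<close> is the projection of the inverse of \<open>A0\<close> applied to
  \<open>u\<close>, orthogonal for the product weighted by \<open>A0\<close>.\<close>

lemma Gamma0_inner:
  assumes u: "u \<in> L2_per Y" and v: "v \<in> potential_fields Y"
  shows "L2_inner Y (\<lambda>x. A0 *v Gamma0 Y A0 u x) v = L2_inner Y u v"
proof -
  let ?h = "\<lambda>k. cmat (Gamma_hat Y A0 k) *v fourier_coeff Y u k"
  let ?w = "Gamma0 Y A0 u"
  note vL2 = potential_L2_per[OF Y_pos v]
  have "?h k \<bullet> fourier_coeff Y (\<lambda>x. A0 *v v x) k = fourier_coeff Y v k \<bullet> fourier_coeff Y u k" for k
  proof (cases "k = 0")
    case True
    obtain b where "fourier_coeff Y v k = b *s cvec (xi Y k)"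
      by (rule potential_fourier_coeff[OF Y_pos v])
    with True show ?thesis
      unfolding fourier_coeff_matrix[OF Y_pos A0_sym vL2] by (simp add: cvec_def inner_vec_def)
  next
    case False
    let ?x = "xi Y k"
    let ?q = "\<Sum>\<beta>\<in>UNIV. of_real (?x $ \<beta>) * fourier_coeff Y u k $ \<beta>"
    obtain b where b: "fourier_coeff Y v k = b *s cvec ?x"
      by (rule potential_fourier_coeff[OF Y_pos v])
    have "0 < c * (norm ?x)\<^sup>2" using c False by (simp add: xi_eq_0_iff[OF Y_pos])
    then have d: "(A0 *v ?x) \<bullet> ?x \<noteq> 0" using A0_coercive[of ?x] by linarith
    have A: "cmat A0 *v (s *s cvec ?x) = s *s cvec (A0 *v ?x)" for s
      by (simp add: vec_eq_iff cmat_def cvec_def matrix_vector_mult_def sum_distrib_left mult_ac)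
    have "?h k \<bullet> fourier_coeff Y (\<lambda>x. A0 *v v x) k = (cmat A0 *v ?h k) \<bullet> fourier_coeff Y v k"
      by (rule fourier_coeff_matrix[OF Y_pos A0_sym vL2])
    also have "\<dots> = Re ((?q / of_real ((A0 *v ?x) \<bullet> ?x)) * cnj (\<Sum>\<beta>\<in>UNIV. of_real ((A0 *v ?x) $ \<beta>) * (b *s cvec ?x) $ \<beta>))"
      unfolding Gamma_hat_mult A b inner_smult_cvec ..
    also have "(\<Sum>\<beta>\<in>UNIV. of_real ((A0 *v ?x) $ \<beta>) * (b *s cvec ?x) $ \<beta>) = b * of_real ((A0 *v ?x) \<bullet> ?x)"
      by (simp add: inner_vec_def cvec_def sum_distrib_left mult_ac)
    also have "(?q / of_real ((A0 *v ?x) \<bullet> ?x)) * cnj (b * of_real ((A0 *v ?x) \<bullet> ?x)) = ?q * cnj b"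
      using d by simp
    also have "Re (?q * cnj b) = fourier_coeff Y v k \<bullet> fourier_coeff Y u k"
    proof -
      have "Re (q * cnj b) = Re (b * cnj q)" for q by simp
      then show ?thesis unfolding b inner_smult_cvec .
    qed
    finally show ?thesis .
  qed
  then have "((\<lambda>k. fourier_coeff Y v k \<bullet> fourier_coeff Y u k) has_sum L2_inner Y ?w (\<lambda>x. A0 *v v x)) UNIV"
    using parseval[OF Y_pos Gamma0_has_L2_sum(1)[OF u] L2_per_matrix[OF Y_pos vL2, of A0] Gamma0_has_L2_sum(2)[OF u]] by simp
  moreover have "((\<lambda>k. fourier_coeff Y v k \<bullet> fourier_coeff Y u k) has_sum L2_inner Y v u) UNIV"
    by (rule parseval[OF Y_pos vL2 u fourier_series_converges[OF Y_pos vL2]])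
  ultimately have "L2_inner Y ?w (\<lambda>x. A0 *v v x) = L2_inner Y v u" by (rule has_sum_unique)
  moreover have "L2_inner Y (\<lambda>x. A0 *v ?w x) v = L2_inner Y ?w (\<lambda>x. A0 *v v x)"
    by (simp add: L2_inner_eq inner_matrix_symmetric[OF A0_sym])
  ultimately show ?thesis by (simp add: L2_inner_commute)
qed

end

section \<open>The cell problem and the Lippmann--Schwinger equation\<close>

lemma norm_matrix_vector_le: "norm (B *v v) \<le> real CARD('m) * norm B * norm v"
  for B :: "real^'n^'m"
proof -
  have "norm (B *v v) \<le> (\<Sum>i\<in>UNIV. \<bar>(B *v v) $ i\<bar>)" by (rule norm_le_l1_cart)
  also have "\<dots> \<le> (\<Sum>i\<in>(UNIV :: 'm set). norm B * norm v)"
  proof (rule sum_mono)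
    fix i
    have "\<bar>(B *v v) $ i\<bar> \<le> norm (B $ i) * norm v"
      unfolding matrix_vector_mul_component by (rule Cauchy_Schwarz_ineq2)
    also have "\<dots> \<le> norm B * norm v"
      by (intro mult_right_mono Finite_Cartesian_Product.norm_nth_le) simp
    finally show "\<bar>(B *v v) $ i\<bar> \<le> norm B * norm v" .
  qed
  finally show ?thesis by (simp add: mult.assoc)
qed

lemma continuous_matrix_vector_mult:
  "continuous_on UNIV (\<lambda>p :: (real^'n^'m) \<times> (real^'n). fst p *v snd p)"
  unfolding matrix_vector_mult_def by (intro continuous_on_vec_lambda continuous_intros)

context
  fixes Y :: "real^'n"
  assumes Y_pos: "\<forall>\<alpha>. 0 < Y $ \<alpha>"
begin

lemma Linf_per_mult_bound:
  fixes A :: "real^'n \<Rightarrow> real^'n^'n"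
  assumes A: "A \<in> Linf_per Y"
  obtains C where "\<And>v. AE x in cell_measure Y. norm (A x *v v x) \<le> C * norm (v x)"
proof -
  obtain C where C: "AE x in cell_measure Y. norm (A x) \<le> C"
    using A compact_cell[of Y] by (auto simp: Linf_per_def AE_cell)
  have "AE x in cell_measure Y. norm (A x *v v x) \<le> real CARD('n) * C * norm (v x)" for v
    using C
  proof eventually_elim
    case (elim x)
    have "norm (A x *v v x) \<le> real CARD('n) * norm (A x) * norm (v x)" by (rule norm_matrix_vector_le)
    also have "\<dots> \<le> real CARD('n) * C * norm (v x)"
      using elim by (intro mult_right_mono mult_left_mono) auto
    finally show ?case .
  qed
  then show ?thesis by (rule that)
qed

lemma Linf_per_mult:
  fixes A :: "real^'n \<Rightarrow> real^'n^'n"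
  assumes A: "A \<in> Linf_per Y" and u: "u \<in> L2_per Y"
  shows "(\<lambda>x. A x *v u x) \<in> L2_per Y"
proof -
  obtain C where C: "\<And>v. AE x in cell_measure Y. norm (A x *v v x) \<le> C * norm (v x)"
    using Linf_per_mult_bound[OF A] by blast
  have "(\<lambda>x. A x *v u x) \<in> borel_measurable lebesgue"
    using A u by (intro borel_measurable_continuous_Pair[OF _ _ continuous_matrix_vector_mult])
      (auto simp: Linf_per_def L2_per_def)
  moreover from this have "square_integrable (cell_measure Y) (\<lambda>x. A x *v u x)"
    by (intro square_integrable_bound[OF L2_per_sqint[OF Y_pos u] measurable_on_cell C])
  ultimately show ?thesis
    using A u by (auto simp: L2_per_iff[OF Y_pos] Linf_per_def cell_periodic_def)
qed

lemma coercive_inner: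
  fixes B :: "real^'n \<Rightarrow> real^'n^'n"
  assumes coercive: "AE x in cell_measure Y. \<forall>v. c * (norm v)\<^sup>2 \<le> (B x *v v) \<bullet> v"
    and u: "u \<in> L2_per Y" and Bu: "(\<lambda>x. B x *v u x) \<in> L2_per Y"
  shows "c * L2_inner Y u u \<le> L2_inner Y (\<lambda>x. B x *v u x) u"
proof -
  note sq = L2_per_sqint[OF Y_pos u] L2_per_sqint[OF Y_pos Bu]
  have "(LINT x|cell_measure Y. c * (u x \<bullet> u x)) \<le> (LINT x|cell_measure Y. (B x *v u x) \<bullet> u x)"
  proof (rule integral_mono_AE)
    show "AE x in cell_measure Y. c * (u x \<bullet> u x) \<le> (B x *v u x) \<bullet> u x"
      using coercive by eventually_elim (simp add: power2_norm_eq_inner)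
  qed (use sq in \<open>auto intro: square_integrable_inner\<close>)
  then show ?thesis
    using cell_volume_pos[OF Y_pos] by (simp add: L2_inner_eq divide_right_mono)
qed

text \<open>Applied with \<open>A\<close> to the difference of two solutions of the cell problem,
  and with the constant \<open>A0\<close> to the residual of the Lippmann-Schwinger
  equation.\<close>

lemma coercive_eq_0:
  fixes B :: "real^'n \<Rightarrow> real^'n^'n"
  assumes "AE x in cell_measure Y. \<forall>v. c * (norm v)\<^sup>2 \<le> (B x *v v) \<bullet> v" "0 < c"
    and u: "u \<in> L2_per Y" "(\<lambda>x. B x *v u x) \<in> L2_per Y"
    and zero: "L2_inner Y (\<lambda>x. B x *v u x) u = 0"
  shows "AE x in cell_measure Y. u x = 0"
proof -
  have "c * L2_inner Y u u \<le> 0" using coercive_inner[OF assms(1) u] zero by simp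
  then have "L2_norm Y u = 0"
    using \<open>0 < c\<close> L2_inner_self_nonneg[OF Y_pos, of u] by (simp add: L2_norm_def mult_le_0_iff)
  then show ?thesis by (rule L2_norm_eq_0_imp_AE[OF Y_pos L2_per_sqint[OF Y_pos u(1)]])
qed

lemma L2_norm_le_of_AE:
  fixes u v :: "real^'n \<Rightarrow> 'b::euclidean_space"
  assumes u: "u \<in> L2_per Y" and v: "v \<in> L2_per Y" and C: "0 \<le> C"
    and ae: "AE x in cell_measure Y. norm (v x) \<le> C * norm (u x)"
  shows "L2_norm Y v \<le> C * L2_norm Y u"
proof (rule power2_le_imp_le)
  note sq = L2_per_sqint[OF Y_pos u] L2_per_sqint[OF Y_pos v]
  have "(LINT x|cell_measure Y. v x \<bullet> v x) \<le> (LINT x|cell_measure Y. C\<^sup>2 * (u x \<bullet> u x))"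
  proof (rule integral_mono_AE)
    show "AE x in cell_measure Y. v x \<bullet> v x \<le> C\<^sup>2 * (u x \<bullet> u x)"
      using ae
    proof eventually_elim
      case (elim x)
      then have "(norm (v x))\<^sup>2 \<le> (C * norm (u x))\<^sup>2" by (intro power_mono) auto
      then show ?case by (simp add: power_mult_distrib power2_norm_eq_inner)
    qed
  qed (use sq in \<open>auto intro: square_integrable_inner\<close>)
  then have "L2_inner Y v v \<le> C\<^sup>2 * L2_inner Y u u"
    using cell_volume_pos[OF Y_pos] by (simp add: L2_inner_eq divide_right_mono)
  then show "(L2_norm Y v)\<^sup>2 \<le> (C * L2_norm Y u)\<^sup>2"
    by (simp add: L2_norm_square[OF Y_pos] power_mult_distrib)
qed (rule mult_nonneg_nonneg[OF C L2_norm_nonneg[OF Y_pos]])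

lemma AE_eq_of_AE_cell:
  assumes "u \<in> L2_per Y" "v \<in> L2_per Y" "AE x in cell_measure Y. u x = v x"
  shows "AE x in lebesgue. u x = v x"
proof (rule AE_of_AE_cell[OF Y_pos])
  show "cell_periodic Y (\<lambda>x. u x = v x)"
    using assms(1,2) by (simp add: L2_per_def cell_periodic_def)
qed (use assms(3) in \<open>simp add: AE_cell\<close>)

text \<open>The telescoping estimate of Banach's fixed point theorem, carried out for the seminorm
  \<open>L2_norm\<close>.\<close>

lemma geometric_increments_Cauchy:
  fixes u :: "nat \<Rightarrow> real^'n \<Rightarrow> 'b::euclidean_space"
  assumes u: "\<And>n. u n \<in> L2_per Y" and q: "0 \<le> q" "q < 1"
    and step: "\<And>n. L2_norm Y (\<lambda>x. u (Suc n) x - u n x) \<le> q ^ n * d"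
    and e: "e > 0"
  shows "\<exists>N. \<forall>m\<ge>N. \<forall>n\<ge>N. L2_norm Y (\<lambda>x. u m x - u n x) < e"
proof -
  note sq = L2_per_sqint[OF Y_pos u]
  have d: "0 \<le> d" using step[of 0] L2_norm_nonneg[OF Y_pos, of "\<lambda>x. u (Suc 0) x - u 0 x"] by simp
  have far: "L2_norm Y (\<lambda>x. u (n + p) x - u n x) \<le> (\<Sum>i<p. q ^ i) * (q ^ n * d)" for n p
  proof (induction p)
    case 0
    then show ?case by (simp add: L2_norm_def)
  next
    case (Suc p)
    have "L2_norm Y (\<lambda>x. u (n + Suc p) x - u n x)
        = L2_norm Y (\<lambda>x. (u (Suc (n + p)) x - u (n + p) x) + (u (n + p) x - u n x))" by simp
    also have "\<dots> \<le> L2_norm Y (\<lambda>x. u (Suc (n + p)) x - u (n + p) x) + L2_norm Y (\<lambda>x. u (n + p) x - u n x)"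
      by (intro L2_norm_triangle[OF Y_pos] square_integrable_diff sq)
    also have "\<dots> \<le> q ^ (n + p) * d + (\<Sum>i<p. q ^ i) * (q ^ n * d)"
      by (intro add_mono step Suc.IH)
    finally show ?case by (simp add: power_add algebra_simps)
  qed
  have far': "L2_norm Y (\<lambda>x. u m x - u n x) \<le> q ^ n * (d / (1 - q))" if "n \<le> m" for m n
  proof -
    have "(\<Sum>i<m - n. q ^ i) \<le> 1 / (1 - q)"
      using q by (simp add: sum_gp_strict divide_right_mono)
    then have "(\<Sum>i<m - n. q ^ i) * (q ^ n * d) \<le> (1 / (1 - q)) * (q ^ n * d)"
      using q d by (intro mult_right_mono) auto
    with far[of n "m - n"] that show ?thesis by (simp add: algebra_simps)
  qed
  have "(\<lambda>n. q ^ n * (d / (1 - q))) \<longlonglongrightarrow> 0"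
    by (intro tendsto_mult_left_zero LIMSEQ_realpow_zero q)
  from LIMSEQ_D[OF this e] obtain N where N: "\<And>n. n \<ge> N \<Longrightarrow> \<bar>q ^ n * (d / (1 - q))\<bar> < e" by auto
  have *: "L2_norm Y (\<lambda>x. u m x - u n x) < e" if "N \<le> n" "n \<le> m" for m n
    using far'[OF that(2)] N[OF that(1)] by linarith
  have "L2_norm Y (\<lambda>x. u m x - u n x) < e" if "N \<le> m" "N \<le> n" for m n
  proof (cases "n \<le> m")
    case False
    then have "L2_norm Y (\<lambda>x. u n x - u m x) < e" using *[of m n] that by simp
    then show ?thesis
      unfolding L2_norm_l2_norm[OF Y_pos] by (simp only: l2_norm_diff_commute[of _ "u m"])
  qed (use * that in simp)
  then show ?thesis by blast
qed

section \<open>Unique solvability of the cell problem\<close>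

context
  fixes A :: "real^'n \<Rightarrow> real^'n^'n" and E :: "real^'n" and c :: real
  assumes A: "A \<in> Linf_per Y" and c: "0 < c"
    and coercive: "AE x in cell_measure Y. \<forall>v. c * (norm v)\<^sup>2 \<le> (A x *v v) \<bullet> v"
begin

text \<open>In terms of the total field \<open>E + et\<close> the equation is homogeneous, the form
  shared with the Lippmann-Schwinger equation.\<close>

lemma cell_problem_iff:
  "cell_problem_solution Y A E et \<longleftrightarrow> et \<in> potential_fields Y \<and>
    (\<forall>v\<in>potential_fields Y. L2_inner Y (\<lambda>x. A x *v (E + et x)) v = 0)"
proof -
  have "L2_inner Y (\<lambda>x. A x *v (E + et x)) v = L2_inner Y (\<lambda>x. A x *v E) v + L2_inner Y (\<lambda>x. A x *v et x) v"
    if "et \<in> potential_fields Y" "v \<in> potential_fields Y" for v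
    using L2_inner_add_left[of Y "\<lambda>x. A x *v E" "\<lambda>x. A x *v et x" v] that
    by (simp add: matrix_vector_right_distrib L2_per_sqint[OF Y_pos] Linf_per_mult[OF A] L2_per_const[OF Y_pos]
        potential_L2_per[OF Y_pos])
  then show ?thesis by (auto simp: cell_problem_solution_def)
qed

lemma cell_problem_unique:
  assumes "cell_problem_solution Y A E u" "cell_problem_solution Y A E v"
  shows "AE x in lebesgue. v x = u x"
proof -
  have uv: "u \<in> potential_fields Y" "v \<in> potential_fields Y"
    using assms by (auto simp: cell_problem_solution_def)
  note L2 = uv[THEN potential_L2_per[OF Y_pos]]
  let ?d = "\<lambda>x. v x - u x"
  have d: "?d \<in> potential_fields Y" by (rule potential_diff[OF Y_pos uv(2,1)])
  have "L2_inner Y (\<lambda>x. A x *v v x - A x *v u x) ?d = L2_inner Y (\<lambda>x. A x *v v x) ?d - L2_inner Y (\<lambda>x. A x *v u x) ?d"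
    by (intro L2_inner_diff_left L2_per_sqint[OF Y_pos] Linf_per_mult[OF A] L2 potential_L2_per[OF Y_pos d])
  also have "\<dots> = 0" using assms d by (auto simp: cell_problem_solution_def)
  finally have "L2_inner Y (\<lambda>x. A x *v v x - A x *v u x) ?d = 0" .
  then have "AE x in cell_measure Y. ?d x = 0"
    by (intro coercive_eq_0[OF coercive c] Linf_per_mult[OF A] potential_L2_per[OF Y_pos] d)
      (simp add: matrix_vector_mult_diff_distrib)
  then show ?thesis by (intro AE_eq_of_AE_cell L2) simp
qed

text \<open>
  The fixed point map \<open>e \<mapsto> e - P (A (E + e)) / l\<close>, with \<open>P\<close> the orthogonal projection onto the
  potential fields, is a contraction for large \<open>l\<close>; \<open>P\<close> is \<open>Gamma0 Y (mat 1)\<close>.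
\<close>

lemma cell_problem_exists: "\<exists>et. cell_problem_solution Y A E et"
proof -
  obtain C0 where C0: "\<And>v. AE x in cell_measure Y. norm (A x *v v x) \<le> C0 * norm (v x)"
    using Linf_per_mult_bound[OF A] by blast
  \<comment> \<open>The maximum ensures c \<le> C, so that \<open>q\<close> below is the root of a
    nonnegative number.\<close>
  define C where "C = max C0 c"
  have Cc: "c \<le> C" and C: "0 < C" using c by (auto simp: C_def)
  have CA: "AE x in cell_measure Y. norm (A x *v v x) \<le> C * norm (v x)" for v
    using C0[of v]
  proof eventually_elim
    case (elim x)
    have "C0 * norm (v x) \<le> C * norm (v x)" by (rule mult_right_mono) (simp_all add: C_def)
    with elim show ?case by simp
  qed
  \<comment> \<open>This value minimises 1 - 2c/l + C^2/l^2; the minimum is 1 - c^2/C^2.\<close>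
  define l where "l = C\<^sup>2 / c"
  have l: "0 < l" using C c by (simp add: l_def)
  define q where "q = sqrt (1 - c\<^sup>2 / C\<^sup>2)"
  have cC: "c\<^sup>2 / C\<^sup>2 \<le> 1" using Cc c C by (simp add: power_mono divide_le_eq)
  have q: "0 \<le> q" "q < 1" "q\<^sup>2 = 1 - c\<^sup>2 / C\<^sup>2"
    using cC c C by (auto simp: q_def)
  note pL2 = potential_L2_per[OF Y_pos]
  note AL2 = Linf_per_mult[OF A]
  have id_coercive: "1 * (norm v)\<^sup>2 \<le> (mat 1 *v v) \<bullet> v" for v :: "real^'n"
    by (simp add: power2_norm_eq_inner)
  have P: "Gamma0 Y (mat 1) u \<in> potential_fields Y" if "u \<in> L2_per Y" for u
    by (rule Gamma0_potential[OF Y_pos transpose_mat zero_less_one id_coercive that])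
  have Pinner: "L2_inner Y (Gamma0 Y (mat 1) u) v = L2_inner Y u v"
    if "u \<in> L2_per Y" "v \<in> potential_fields Y" for u v
    using Gamma0_inner[OF Y_pos transpose_mat zero_less_one id_coercive that] by simp
  define e where "e = rec_nat (\<lambda>x. 0 :: real^'n)
    (\<lambda>_ f x. f x - (1 / l) *\<^sub>R Gamma0 Y (mat 1) (\<lambda>x. A x *v (E + f x)) x)"
  have e0: "e 0 = (\<lambda>x. 0)"
    and eSuc: "e (Suc n) = (\<lambda>x. e n x - (1 / l) *\<^sub>R Gamma0 Y (mat 1) (\<lambda>x. A x *v (E + e n x)) x)" for n
    by (simp_all add: e_def)
  have F: "(\<lambda>x. A x *v (E + u x)) \<in> L2_per Y" if "u \<in> potential_fields Y" for u
    by (intro AL2 L2_per_add[OF Y_pos] L2_per_const[OF Y_pos] pL2 that)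
  have e: "e n \<in> potential_fields Y" for n
  proof (induction n)
    case 0
    then show ?case
      unfolding e0 potential_fields_iff[OF Y_pos] using L2_per_const[OF Y_pos, of 0] by simp
  next
    case (Suc n)
    then show ?case
      unfolding eSuc by (intro potential_diff[OF Y_pos] potential_scaleR[OF Y_pos] P F)
  qed
  \<comment> \<open>Against a potential field the projection disappears by
    \<open>Pinner\<close>.\<close>
  have estep: "L2_inner Y (e (Suc n)) v = L2_inner Y (e n) v - (1 / l) * L2_inner Y (\<lambda>x. A x *v (E + e n x)) v"
    if v: "v \<in> potential_fields Y" for v n
    unfolding eSuc using L2_per_sqint[OF Y_pos pL2[OF e]] L2_per_sqint[OF Y_pos pL2[OF v]]
      square_integrable_scaleR[OF L2_per_sqint[OF Y_pos pL2[OF P[OF F[OF e]]]]]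
    by (simp only: L2_inner_diff_left L2_inner_scaleR_left Pinner[OF F[OF e] v])
  have Fdiff: "L2_inner Y (\<lambda>x. A x *v (E + u x)) v - L2_inner Y (\<lambda>x. A x *v (E + w x)) v
      = L2_inner Y (\<lambda>x. A x *v (u x - w x)) v"
    if "u \<in> potential_fields Y" "w \<in> potential_fields Y" "v \<in> L2_per Y" for u w v
  proof -
    have "L2_inner Y (\<lambda>x. A x *v (E + u x)) v - L2_inner Y (\<lambda>x. A x *v (E + w x)) v
      = L2_inner Y (\<lambda>x. A x *v (E + u x) - A x *v (E + w x)) v"
      by (rule L2_inner_diff_left[symmetric]) (intro L2_per_sqint[OF Y_pos] F that)+
    then show ?thesis by (simp flip: matrix_vector_mult_diff_distrib)
  qed
  have contraction: "L2_norm Y (\<lambda>x. d x - (1 / l) *\<^sub>R (A x *v d x)) \<le> q * L2_norm Y d"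
    if d: "d \<in> L2_per Y" for d
  proof (rule power2_le_imp_le)
    let ?N = "L2_inner Y d d"
    have Ad: "(\<lambda>x. A x *v d x) \<in> L2_per Y" by (rule AL2[OF d])
    have "(L2_norm Y (\<lambda>x. A x *v d x))\<^sup>2 \<le> (C * L2_norm Y d)\<^sup>2"
      by (intro power_mono L2_norm_le_of_AE CA d Ad L2_norm_nonneg[OF Y_pos]) (use C in simp)
    then have upper: "L2_inner Y (\<lambda>x. A x *v d x) (\<lambda>x. A x *v d x) \<le> C\<^sup>2 * ?N"
      by (simp add: L2_norm_square[OF Y_pos] power_mult_distrib)
    have lower: "c * ?N \<le> L2_inner Y (\<lambda>x. A x *v d x) d"
      by (rule coercive_inner[OF coercive d Ad])
    have "(L2_norm Y (\<lambda>x. d x - (1 / l) *\<^sub>R (A x *v d x)))\<^sup>2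
        = ?N - 2 * L2_inner Y (\<lambda>x. (1 / l) *\<^sub>R (A x *v d x)) d
          + L2_inner Y (\<lambda>x. (1 / l) *\<^sub>R (A x *v d x)) (\<lambda>x. (1 / l) *\<^sub>R (A x *v d x))"
      by (intro L2_norm_diff_square[OF Y_pos] L2_per_sqint[OF Y_pos] L2_per_scaleR[OF Y_pos] d Ad)
    also have "\<dots> = ?N - (2 / l) * L2_inner Y (\<lambda>x. A x *v d x) d
          + (1 / l)\<^sup>2 * L2_inner Y (\<lambda>x. A x *v d x) (\<lambda>x. A x *v d x)"
      using L2_inner_scaleR_left[of Y "1 / l" "\<lambda>x. A x *v d x"] L2_inner_commute[of Y "\<lambda>x. A x *v d x" "\<lambda>x. (1 / l) *\<^sub>R (A x *v d x)"]
      by (simp add: power2_eq_square)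
    also have "\<dots> \<le> ?N - (2 / l) * (c * ?N) + (1 / l)\<^sup>2 * (C\<^sup>2 * ?N)"
      using l by (intro add_mono diff_mono mult_left_mono upper lower) auto
    also have "\<dots> = (1 - 2 * c / l + C\<^sup>2 / l\<^sup>2) * ?N"
      by (simp add: algebra_simps power_divide)
    also have "1 - 2 * c / l + C\<^sup>2 / l\<^sup>2 = q\<^sup>2"
      using c C unfolding q(3) l_def by (simp add: field_simps power2_eq_square)
    finally show "(L2_norm Y (\<lambda>x. d x - (1 / l) *\<^sub>R (A x *v d x)))\<^sup>2 \<le> (q * L2_norm Y d)\<^sup>2"
      by (simp add: power_mult_distrib L2_norm_square[OF Y_pos])
  qed (rule mult_nonneg_nonneg[OF q(1) L2_norm_nonneg[OF Y_pos]])
  let ?d = "\<lambda>n x. e (Suc n) x - e n x"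
  have dpot: "?d n \<in> potential_fields Y" for n by (rule potential_diff[OF Y_pos e e])
  \<comment> \<open>The new increment is paired with itself. As it is a potential field, the
    projection drops from the other factor, and Cauchy-Schwarz followed by division leaves the
    contraction factor.\<close>
  have dstep: "L2_norm Y (?d (Suc n)) \<le> q * L2_norm Y (?d n)" for n
  proof -
    have sq: "square_integrable (cell_measure Y) (e n)" for n by (intro L2_per_sqint[OF Y_pos] pL2 e)
    have dsq: "square_integrable (cell_measure Y) (?d n)" for n by (intro L2_per_sqint[OF Y_pos] pL2 dpot)
    have Adsq: "square_integrable (cell_measure Y) (\<lambda>x. A x *v ?d n x)" by (intro L2_per_sqint[OF Y_pos] pL2 dpot AL2)
    have "(L2_norm Y (?d (Suc n)))\<^sup>2 = L2_inner Y (?d (Suc n)) (?d (Suc n))" by (rule L2_norm_square[OF Y_pos])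
    also have "\<dots> = L2_inner Y (e (Suc (Suc n))) (?d (Suc n)) - L2_inner Y (e (Suc n)) (?d (Suc n))"
      by (rule L2_inner_diff_left[OF sq sq dsq])
    also have "\<dots> = (L2_inner Y (e (Suc n)) (?d (Suc n)) - L2_inner Y (e n) (?d (Suc n)))
        - (1 / l) * (L2_inner Y (\<lambda>x. A x *v (E + e (Suc n) x)) (?d (Suc n)) - L2_inner Y (\<lambda>x. A x *v (E + e n x)) (?d (Suc n)))"
      using estep[OF dpot[of "Suc n"], of "Suc n"] estep[OF dpot[of "Suc n"], of n]
      by (simp add: right_diff_distrib)
    also have "\<dots> = L2_inner Y (?d n) (?d (Suc n)) - (1 / l) * L2_inner Y (\<lambda>x. A x *v ?d n x) (?d (Suc n))"
      unfolding Fdiff[OF e e pL2[OF dpot]] by (simp only: L2_inner_diff_left[OF sq sq dsq])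
    also have "\<dots> = L2_inner Y (\<lambda>x. ?d n x - (1 / l) *\<^sub>R (A x *v ?d n x)) (?d (Suc n))"
      by (simp only: L2_inner_diff_left[OF dsq square_integrable_scaleR[OF Adsq] dsq] L2_inner_scaleR_left)
    also have "\<dots> \<le> L2_norm Y (\<lambda>x. ?d n x - (1 / l) *\<^sub>R (A x *v ?d n x)) * L2_norm Y (?d (Suc n))"
      by (rule order_trans[OF abs_ge_self L2_cauchy_schwarz[OF Y_pos square_integrable_diff[OF dsq square_integrable_scaleR[OF Adsq]] dsq]])
    also have "\<dots> \<le> (q * L2_norm Y (?d n)) * L2_norm Y (?d (Suc n))"
      by (intro mult_right_mono contraction pL2 dpot L2_norm_nonneg[OF Y_pos])
    finally have "L2_norm Y (?d (Suc n)) * L2_norm Y (?d (Suc n)) \<le> (q * L2_norm Y (?d n)) * L2_norm Y (?d (Suc n))"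
      by (simp only: power2_eq_square)
    then show ?thesis
      using L2_norm_nonneg[OF Y_pos, of "?d (Suc n)"] L2_norm_nonneg[OF Y_pos, of "?d n"] q(1)
      by (cases "L2_norm Y (?d (Suc n)) = 0") (simp_all add: mult_le_cancel_right)
  qed
  have geo: "L2_norm Y (?d n) \<le> q ^ n * L2_norm Y (?d 0)" for n
  proof (induction n)
    case (Suc n)
    have "L2_norm Y (?d (Suc n)) \<le> q * L2_norm Y (?d n)" by (rule dstep)
    also have "\<dots> \<le> q * (q ^ n * L2_norm Y (?d 0))" by (intro mult_left_mono Suc.IH q)
    finally show ?case by (simp only: power_Suc mult.assoc)
  qed simp
  obtain w where w: "w \<in> L2_per Y" and lim: "(\<lambda>n. L2_norm Y (\<lambda>x. e n x - w x)) \<longlonglongrightarrow> 0"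
    by (rule L2_per_complete[OF Y_pos pL2[OF e] geometric_increments_Cauchy[OF pL2[OF e] q(1,2) geo]],
        assumption, rule that)
  have wpot: "w \<in> potential_fields Y" by (rule potential_limit[OF Y_pos e w lim])
  have "L2_inner Y (\<lambda>x. A x *v (E + w x)) v = 0" if v: "v \<in> potential_fields Y" for v
  proof -
    have "(\<lambda>n. L2_inner Y (\<lambda>x. A x *v (E + e n x)) v) \<longlonglongrightarrow> L2_inner Y (\<lambda>x. A x *v (E + w x)) v"
    proof (rule L2_inner_tendsto[OF Y_pos F[OF e] F[OF wpot] pL2[OF v]], rule Lim_null_comparison)
      show "(\<lambda>n. C * L2_norm Y (\<lambda>x. e n x - w x)) \<longlonglongrightarrow> 0"
        by (rule tendsto_mult_right_zero[OF lim])
      have "L2_norm Y (\<lambda>x. A x *v (E + e n x) - A x *v (E + w x)) \<le> C * L2_norm Y (\<lambda>x. e n x - w x)" for n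
      proof -
        have "L2_norm Y (\<lambda>x. A x *v (e n x - w x)) \<le> C * L2_norm Y (\<lambda>x. e n x - w x)"
          by (intro L2_norm_le_of_AE CA AL2 L2_per_diff[OF Y_pos] pL2 e w) (use C in simp)
        then show ?thesis by (simp flip: matrix_vector_mult_diff_distrib)
      qed
      then show "\<forall>\<^sub>F n in sequentially. norm (L2_norm Y (\<lambda>x. A x *v (E + e n x) - A x *v (E + w x)))
          \<le> C * L2_norm Y (\<lambda>x. e n x - w x)"
        unfolding real_norm_def abs_of_nonneg[OF L2_norm_nonneg[OF Y_pos]] by simp
    qed
    \<comment> \<open>The residual is \<open>l\<close> times the difference of consecutive iterates
      paired with \<open>v\<close>, and both pairings have the same limit.\<close>
    moreover have "(\<lambda>n. L2_inner Y (\<lambda>x. A x *v (E + e n x)) v) \<longlonglongrightarrow> 0"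
    proof -
      have en: "(\<lambda>n. L2_inner Y (e n) v) \<longlonglongrightarrow> L2_inner Y w v"
        by (rule L2_inner_tendsto[OF Y_pos pL2[OF e] w pL2[OF v] lim])
      have "(\<lambda>n. l * (L2_inner Y (e n) v - L2_inner Y (e (Suc n)) v)) \<longlonglongrightarrow> l * (L2_inner Y w v - L2_inner Y w v)"
        by (intro tendsto_intros en LIMSEQ_Suc[OF en])
      moreover have "l * (L2_inner Y (e n) v - L2_inner Y (e (Suc n)) v) = L2_inner Y (\<lambda>x. A x *v (E + e n x)) v" for n
        using l by (simp add: estep[OF v])
      ultimately show ?thesis by simp
    qed
    ultimately show ?thesis by (rule LIMSEQ_unique)
  qed
  with wpot show ?thesis unfolding cell_problem_iff by blast
qed

section \<open>Equivalence with the Lippmann-Schwinger equation\<close>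

context
  fixes A0 :: "real^'n^'n" and c0 :: real
  assumes A0_sym: "transpose A0 = A0" and c0: "0 < c0"
    and A0_coercive: "\<And>v. c0 * (norm v)\<^sup>2 \<le> (A0 *v v) \<bullet> v"
begin

lemma polarization_L2_per:
  assumes "e \<in> L2_per Y"
  shows "(\<lambda>x. (A x - A0) *v e x) \<in> L2_per Y"
  using L2_per_diff[OF Y_pos Linf_per_mult[OF A assms] L2_per_matrix[OF Y_pos assms, of A0]]
  by (simp add: matrix_vector_mult_diff_rdistrib)

lemma polarization_inner:
  assumes e: "e \<in> L2_per Y" and v: "v \<in> L2_per Y"
  shows "L2_inner Y (\<lambda>x. (A x - A0) *v e x) v = L2_inner Y (\<lambda>x. A x *v e x) v - L2_inner Y (\<lambda>x. A0 *v e x) v"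
  unfolding matrix_vector_mult_diff_rdistrib
  by (intro L2_inner_diff_left L2_per_sqint[OF Y_pos] Linf_per_mult[OF A] L2_per_matrix[OF Y_pos] e v)

text \<open>\<open>A0 *v E\<close> is a constant field, hence orthogonal to
  \<open>v\<close>.\<close>

lemma constant_inner_potential:
  assumes e: "e \<in> L2_per Y" and v: "v \<in> potential_fields Y"
  shows "L2_inner Y (\<lambda>x. A0 *v (e x - E)) v = L2_inner Y (\<lambda>x. A0 *v e x) v"
proof -
  have "L2_inner Y (\<lambda>x. A0 *v e x - A0 *v E) v = L2_inner Y (\<lambda>x. A0 *v e x) v - L2_inner Y (\<lambda>x. A0 *v E) v"
    by (intro L2_inner_diff_left L2_per_sqint[OF Y_pos] L2_per_matrix[OF Y_pos] L2_per_const[OF Y_pos] e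
        potential_L2_per[OF Y_pos v])
  then show ?thesis
    using potential_orthogonal_const[OF Y_pos v]
    by (simp add: matrix_vector_mult_diff_distrib L2_inner_commute[of Y _ v])
qed

text \<open>By \<open>key\<close>, the \<open>A0\<close>-weighted products of the residual
  \<open>?et + ?w\<close> with potential fields are the products of \<open>A e\<close>. If the
  residual vanishes, so do they; conversely, when \<open>?et\<close> is potential, so is the
  residual, and testing it with itself makes it vanish by coercivity of \<open>A0\<close>.\<close>

lemma lippmann_schwinger_iff_cell_problem:
  assumes e: "e \<in> L2_per Y"
  shows "lippmann_schwinger_solution Y A A0 E e \<longleftrightarrow> cell_problem_solution Y A E (\<lambda>x. e x - E)"
proof -
  let ?s = "\<lambda>x. (A x - A0) *v e x"
  let ?et = "\<lambda>x. e x - E"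
  let ?w = "Gamma0 Y A0 ?s"
  have s: "?s \<in> L2_per Y" by (rule polarization_L2_per[OF e])
  have et: "?et \<in> L2_per Y" by (intro L2_per_diff[OF Y_pos] e L2_per_const[OF Y_pos])
  note \<Gamma> = Y_pos A0_sym c0 A0_coercive
  have w: "?w \<in> potential_fields Y" by (rule Gamma0_potential[OF \<Gamma> s])
  have wL2: "?w \<in> L2_per Y" by (rule potential_L2_per[OF Y_pos w])
  \<comment> \<open>The contributions of \<open>A0\<close> from \<open>e - E\<close> and from the
    polarization cancel; only \<open>A\<close> remains.\<close>
  have key: "L2_inner Y (\<lambda>x. A0 *v (?et x + ?w x)) v = L2_inner Y (\<lambda>x. A x *v e x) v"
    if v: "v \<in> potential_fields Y" for v
  proof -
    have "L2_inner Y (\<lambda>x. A0 *v (?et x + ?w x)) v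
        = L2_inner Y (\<lambda>x. A0 *v ?et x) v + L2_inner Y (\<lambda>x. A0 *v ?w x) v"
      unfolding matrix_vector_right_distrib
      by (intro L2_inner_add_left L2_per_sqint[OF Y_pos] L2_per_matrix[OF Y_pos] et wL2 potential_L2_per[OF Y_pos v])
    also have "\<dots> = L2_inner Y (\<lambda>x. A x *v e x) v"
      unfolding Gamma0_inner[OF \<Gamma> s v] polarization_inner[OF e potential_L2_per[OF Y_pos v]]
        constant_inner_potential[OF e v] by simp
    finally show ?thesis .
  qed
  have ls: "lippmann_schwinger_solution Y A A0 E e \<longleftrightarrow> (AE x in cell_measure Y. ?et x + ?w x = 0)"
    unfolding lippmann_schwinger_solution_def AE_cell using e by (simp add: algebra_simps)
  have cell: "cell_problem_solution Y A E ?et \<longleftrightarrow>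
      ?et \<in> potential_fields Y \<and> (\<forall>v\<in>potential_fields Y. L2_inner Y (\<lambda>x. A x *v e x) v = 0)"
    unfolding cell_problem_iff by simp
  show ?thesis
    unfolding ls cell
  proof (intro iffI conjI ballI)
    assume ae: "AE x in cell_measure Y. ?et x + ?w x = 0"
    \<comment> \<open>Almost everywhere equality with a multiple of \<open>?w\<close> is what shows
      that \<open>?et\<close>, known only to be square-integrable, is potential.\<close>
    then have "AE x in cell_measure Y. ?et x = (- 1) *\<^sub>R ?w x"
      by eventually_elim (simp add: add_eq_0_iff2)
    with potential_scaleR[OF Y_pos w] et show "?et \<in> potential_fields Y"
      by (rule potential_cong_AE[OF Y_pos])
    fix v assume v: "v \<in> potential_fields Y"
    have sum: "(\<lambda>x. A0 *v (?et x + ?w x)) \<in> L2_per Y"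
      by (intro L2_per_matrix[OF Y_pos] L2_per_add[OF Y_pos] et wL2)
    have "L2_inner Y (\<lambda>x. A0 *v (?et x + ?w x)) v = L2_inner Y (\<lambda>x. 0) v"
      using ae by (intro L2_inner_cong_AE L2_per_sqint[OF Y_pos] sum L2_per_const[OF Y_pos] potential_L2_per[OF Y_pos v])
        (auto elim: eventually_mono)
    then show "L2_inner Y (\<lambda>x. A x *v e x) v = 0" by (simp add: key[OF v])
  next
    assume sol: "?et \<in> potential_fields Y \<and> (\<forall>v\<in>potential_fields Y. L2_inner Y (\<lambda>x. A x *v e x) v = 0)"
    have "(\<lambda>x. ?et x - (- 1) *\<^sub>R ?w x) \<in> potential_fields Y"
      by (rule potential_diff[OF Y_pos conjunct1[OF sol] potential_scaleR[OF Y_pos w]])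
    then have p: "(\<lambda>x. ?et x + ?w x) \<in> potential_fields Y" by simp
    show "AE x in cell_measure Y. ?et x + ?w x = 0"
    proof (rule coercive_eq_0[of c0 "\<lambda>x. A0"])
      show "L2_inner Y (\<lambda>x. A0 *v (?et x + ?w x)) (\<lambda>x. ?et x + ?w x) = 0"
        using key[OF p] sol p by simp
    qed (use A0_coercive c0 p in \<open>auto intro: potential_L2_per[OF Y_pos] L2_per_matrix[OF Y_pos]\<close>)
  qed
qed

end

end

end

theorem proposition3:
  fixes Y E :: "real^'n"
    and A :: "real^'n \<Rightarrow> real^'n^'n"
    and A0 :: "real^'n^'n"
    and cA CA cA0 CA0 :: real
  assumes Y_pos: "\<forall>\<alpha>. 0 < Y $ \<alpha>"
    and A_Linf: "A \<in> Linf_per Y"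
    and A_consts: "0 < cA" "cA \<le> CA"
    and A_ell: "AE x in lebesgue. x \<in> cell Y \<longrightarrow>
        transpose (A x) = A x \<and>
        (\<forall>v. cA * (norm v)\<^sup>2 \<le> (A x *v v) \<bullet> v \<and> (A x *v v) \<bullet> v \<le> CA * (norm v)\<^sup>2)"
    and A0_sym: "transpose A0 = A0"
    and A0_consts: "0 < cA0" "cA0 \<le> CA0"
    and A0_ell: "\<forall>v. cA0 * (norm v)\<^sup>2 \<le> (A0 *v v) \<bullet> v \<and> (A0 *v v) \<bullet> v \<le> CA0 * (norm v)\<^sup>2"
  shows "ex1_ae (cell_problem_solution Y A E) \<and>
    ex1_ae (lippmann_schwinger_solution Y A A0 E) \<and>
    (\<forall>et e. cell_problem_solution Y A E et \<longrightarrow> lippmann_schwinger_solution Y A A0 E e \<longrightarrow>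
       (AE x in lebesgue. e x = E + et x))"
proof -
  have coercive: "AE x in cell_measure Y. \<forall>v. cA * (norm v)\<^sup>2 \<le> (A x *v v) \<bullet> v"
    unfolding AE_cell using A_ell by eventually_elim blast
  have A0_coercive: "cA0 * (norm v)\<^sup>2 \<le> (A0 *v v) \<bullet> v" for v
    using A0_ell by blast
  note hyps = Y_pos A_Linf A_consts(1) coercive
  note ls_iff = lippmann_schwinger_iff_cell_problem[OF hyps A0_sym A0_consts(1) A0_coercive]
  obtain et where et: "cell_problem_solution Y A E et"
    using cell_problem_exists[OF hyps] by blast
  \<comment> \<open>This gives both the relation between the solutions and, with the cell solution
    fixed, uniqueness for the Lippmann-Schwinger equation.\<close>
  have LS: "AE x in lebesgue. e x = E + et' x"
    if "cell_problem_solution Y A E et'" "lippmann_schwinger_solution Y A A0 E e" for et' e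
  proof -
    have "e \<in> L2_per Y" using that(2) by (simp add: lippmann_schwinger_solution_def)
    then have "cell_problem_solution Y A E (\<lambda>x. e x - E)" using that(2) ls_iff by blast
    from cell_problem_unique[OF hyps that(1) this] show ?thesis
      by eventually_elim (simp add: algebra_simps)
  qed
  have "et \<in> L2_per Y"
    using et potential_L2_per[OF Y_pos] by (simp add: cell_problem_solution_def)
  then have "(\<lambda>x. E + et x) \<in> L2_per Y" by (intro L2_per_add[OF Y_pos] L2_per_const[OF Y_pos])
  then have "lippmann_schwinger_solution Y A A0 E (\<lambda>x. E + et x)"
    using ls_iff[of "\<lambda>x. E + et x"] et by simp
  then have "ex1_ae (lippmann_schwinger_solution Y A A0 E)"
    unfolding ex1_ae_def using LS[OF et] by blast
  moreover have "ex1_ae (cell_problem_solution Y A E)"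
    unfolding ex1_ae_def using et cell_problem_unique[OF hyps et] by blast
  ultimately show ?thesis using LS by blast
qed

end
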